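(* Let $d\ge1$ and let $x_1,\dots,x_T$ be points drawn independently and uniformly at random from $[0,1]^d$, revealed one at a time. There is an online algorithm which selects signs $\chi_t\in\{\pm1\}$ such that, with high probability, for every axis-parallel box $B\subseteq[0,1]^d$, \[\max_{t\in[T]}\mathsf{disc}_t(B)=O_d(\log^{2d+1}T).\] Moreover, for any online algorithm, with constant probability there exists an axis-parallel box $B$ such that $\max_{t\in[T]}\mathsf{disc}_t(B)=\Omega_d(\log^{d/2}T)$.
   Context: For a signing $\chi_1,\dots,\chi_T$ and a box $B$, $\mathsf{disc}_t(B):=\left|\sum_{s=1}^t\chi_s\mathbf{1}_B(x_s)\right|$. An online algorithm must choose $\chi_t$ irrevocably after seeing $x_1,\dots,x_t$ only. $O_d,\Omega_d$ hide constants depending on $d$. "With high probability" means with probability $1-1/\mathrm{poly}(T)$, where the exponent can be made as large as desired by increasing the constant in the bound. Logarithms are base $2$. *)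

theory Defs
  imports "HOL-Probability.Probability"
begin

definition axis_parallel_box :: "(real ^ 'd) set \<Rightarrow> bool" where
  "axis_parallel_box B \<longleftrightarrow>
     (\<exists>I. (\<forall>i. is_interval (I i) \<and> I i \<subseteq> {0..1::real}) \<and> B = {x. \<forall>i. x $ i \<in> I i})"

definition disc :: "(nat \<Rightarrow> real) \<Rightarrow> (nat \<Rightarrow> real ^ 'd) \<Rightarrow> nat \<Rightarrow> (real ^ 'd) set \<Rightarrow> real" where
  "disc \<sigma> x t B = \<bar>\<Sum>s=1..t. \<sigma> s * indicator B (x s)\<bar>"

definition uniform_cube :: "(real ^ 'd) measure" where
  "uniform_cube = uniform_measure lborel (cbox 0 1)"

text \<open>
  A possibly randomised online algorithm for the horizon T. All internal randomness is a seed with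
  law R, drawn once and independently of the points; a deterministic algorithm is one that ignores
  the seed. The sign chosen at time t is a measurable function of the seed and of the points with
  indices 1..t only. It need not take the earlier signs as arguments, since these are determined by
  the same data.
\<close>
definition online_algorithm ::
  "nat \<Rightarrow> real measure \<Rightarrow> (nat \<Rightarrow> real \<times> (nat \<Rightarrow> real ^ 'd) \<Rightarrow> real) \<Rightarrow> bool" where
  "online_algorithm T R A \<longleftrightarrow> prob_space R \<and>
     (\<forall>t\<in>{1..T}. A t \<in> R \<Otimes>\<^sub>M (\<Pi>\<^sub>M s\<in>{1..t}. (uniform_cube :: (real ^ 'd) measure))
                       \<rightarrow>\<^sub>M count_space {-1, 1})"

definition signing ::
  "(nat \<Rightarrow> real \<times> (nat \<Rightarrow> real ^ 'd) \<Rightarrow> real) \<Rightarrow> real \<Rightarrow> (nat \<Rightarrow> real ^ 'd) \<Rightarrow> nat \<Rightarrow> real" where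
  "signing A r x t = A t (r, restrict x {1..t})"

definition random_input :: "nat \<Rightarrow> real measure \<Rightarrow> (real \<times> (nat \<Rightarrow> real ^ 'd)) measure" where
  "random_input T R = R \<Otimes>\<^sub>M (\<Pi>\<^sub>M s\<in>{1..T}. uniform_cube)"

end

theory Submission
  imports Defs
begin

text \<open>
  Upper bound: assign to a point the indicator vector of the dyadic boxes containing it, with side lengths
  down to about \<open>T\<close> to the power \<open>-2\<close>, and sign these vectors by the self-balancing walk of Alweiss, Liu and
  Sawhney: the next sign has conditional mean \<open>- \<langle>W, V\<rangle> / c\<close>, where \<open>W\<close> is the current signed sum.  The
  walk is subgaussian with variance proxy \<open>c\<close>, so all dyadic boxes have small discrepancy; a general box is
  a signed sum of polylogarithmically many dyadic ones, up to the points in boundary strips so thin that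
  each contains \<open>O(1)\<close> points.  Taking \<open>c\<close> larger than necessary by a factor \<open>log T\<close>, which the exponent
  \<open>2 * d + 1\<close> leaves room for, makes the walk fail with superpolynomially small probability, so that one
  algorithm serves all polynomial failure rates.

  Lower bound: it holds for every signing.  Regard time as an extra coordinate and apply Roth's method of
  orthogonal functions to the \<open>d + 1\<close> dimensional signed point set.  For each of the \<open>log T\<close> to the power
  \<open>d\<close> shapes of dyadic boxes of expected occupancy one, a constant fraction of the boxes contains exactly
  one point, near its centre, and the corresponding Haar coefficients contribute to the mean square of the
  discrepancy.
\<close>

section \<open>The self-balancing walk\<close>

text \<open>The walk is adaptive, and its bias \<open>- drift / c\<close> is a legitimate mean only
  while the drift stays within \<open>[-c, c]\<close>. The sign rule is therefore defined for every
  drift, and the estimates count only the seeds that are still \<open>tame\<close>; the same tail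
  bound then shows that few seeds ever stop being tame. As the inner products are integers, uniform
  seeds with \<open>2 * c\<close> values realise the bias exactly, so for fixed points the analysis
  is counting in a finite product, without conditional expectations. Randomness of the points
  matters only for the thin strips.

  Scales, with \<open>n\<close> about \<open>2 * log T\<close> and \<open>L = n + 1\<close>: a point
  lies in \<open>L ^ d\<close> dyadic boxes, the proxy is \<open>c = L ^ (d + 2)\<close>,
  coordinates stay below \<open>K * L ^ (d + 1)\<close> with high probability, and a general box
  costs \<open>(2 * L) ^ d\<close> of them, whence the exponent \<open>2 * d + 1\<close>.

  For the lower bound the good event concerns the points alone and serves all signings at once; a
  first moment gives it constant probability, as the count of good boxes has mean a constant
  fraction of its maximum.\<close>

lemma two_point_mgf_le:
  fixes a p :: real
  assumes "0 \<le> p" "p \<le> 1"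
  shows "p * exp a + (1 - p) * exp (- a) \<le> exp (a * (2 * p - 1) + a\<^sup>2 / 2)"
proof -
  have *: "p * exp a + (1 - p) * exp (- a) \<le> exp (a * (2 * p - 1) + a\<^sup>2 / 2)"
    if "0 \<le> p" "p \<le> 1" "0 \<le> a" for a p :: real
  proof -
    have pos: "0 < 1 + p * (exp (2 * a) - 1)"
      using that by (intro add_pos_nonneg mult_nonneg_nonneg) auto
    \<comment> \<open>The outcomes \<open>a\<close> and \<open>- a\<close> differ by
      \<open>2 * a\<close>, so Hoeffding's constant is \<open>(2 * a)\<^sup>2 / 8\<close>. The case
      of negative \<open>a\<close> is reduced to this one below by exchanging \<open>p\<close> and
      \<open>1 - p\<close>.\<close>
    have "ln (1 + p * (exp (2 * a) - 1)) \<le> 2 * a * p + a\<^sup>2 / 2"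
      using Hoeffdings_lemma_aux[of "2 * a" p] that by (simp add: power_mult_distrib)
    then have "1 + p * (exp (2 * a) - 1) \<le> exp (2 * a * p + a\<^sup>2 / 2)"
      using pos by (metis exp_le_cancel_iff exp_ln)
    then have "exp (- a) * (1 + p * (exp (2 * a) - 1)) \<le> exp (- a) * exp (2 * a * p + a\<^sup>2 / 2)"
      by (intro mult_left_mono) auto
    also have "exp (- a) * exp (2 * a * p + a\<^sup>2 / 2) = exp (a * (2 * p - 1) + a\<^sup>2 / 2)"
      by (simp add: algebra_simps flip: exp_add)
    also have "exp (- a) * (1 + p * (exp (2 * a) - 1)) = p * exp a + (1 - p) * exp (- a)"
      by (simp add: algebra_simps flip: exp_add)
    finally show ?thesis .
  qed
  show ?thesis
  proof (cases "0 \<le> a")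
    case True
    then show ?thesis using * assms by blast
  next
    case False
    have "- (a * (2 * (1 - p) - 1)) = a * (2 * p - 1)"
      by (simp add: algebra_simps)
    then show ?thesis using *[of "1 - p" "- a"] assms False by (simp add: add.commute)
  qed
qed

text \<open>Resampling one coordinate preserves the uniform law. This is the finite substitute for
  conditioning on all other coordinates when the next sign is averaged.\<close>

lemma sum_PiE_resample:
  fixes F :: "('a \<Rightarrow> 'b) \<Rightarrow> real"
  assumes "i \<in> J" "finite B" "B \<noteq> {}"
  shows "(\<Sum>f\<in>J \<rightarrow>\<^sub>E B. F f) = (\<Sum>f\<in>J \<rightarrow>\<^sub>E B. \<Sum>u\<in>B. F (f(i := u))) / card B"
proof -
  define J' where "J' = J - {i}"
  have J: "J = insert i J'" and i: "i \<notin> J'"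
    using assms by (auto simp: J'_def)
  have split: "(\<Sum>f\<in>J \<rightarrow>\<^sub>E B. G f) = (\<Sum>y\<in>B. \<Sum>g\<in>J' \<rightarrow>\<^sub>E B. G (g(i := y)))"
    for G :: "_ \<Rightarrow> real"
    unfolding J PiE_insert_eq
    by (subst sum.reindex)
       (use inj_combinator[OF i, of "\<lambda>_. B"] in \<open>auto simp: sum.cartesian_product case_prod_unfold\<close>)
  have "(\<Sum>f\<in>J \<rightarrow>\<^sub>E B. \<Sum>u\<in>B. F (f(i := u))) = card B * (\<Sum>g\<in>J' \<rightarrow>\<^sub>E B. \<Sum>u\<in>B. F (g(i := u)))"
    by (subst split) simp
  also have "(\<Sum>g\<in>J' \<rightarrow>\<^sub>E B. \<Sum>u\<in>B. F (g(i := u))) = (\<Sum>f\<in>J \<rightarrow>\<^sub>E B. F f)"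
    by (subst split) (rule sum.swap)
  finally have *: "(\<Sum>f\<in>J \<rightarrow>\<^sub>E B. \<Sum>u\<in>B. F (f(i := u))) = card B * (\<Sum>f\<in>J \<rightarrow>\<^sub>E B. F f)" .
  show ?thesis unfolding * using assms by simp
qed

text \<open>A uniform \<open>f t \<in> {..<2 * c}\<close> makes the sign at time \<open>t\<close> have conditional mean
  \<open>- drift / c\<close> exactly, because the drift is an integer.\<close>

fun walk_sign :: "nat \<Rightarrow> (nat \<Rightarrow> nat \<Rightarrow> int) \<Rightarrow> (nat \<Rightarrow> nat) \<Rightarrow> nat \<Rightarrow> int" where
  "walk_sign c \<kappa> f t =
     (if int (f t) < int c - (\<Sum>s\<in>{1..<t}. walk_sign c \<kappa> f s * \<kappa> s t) then 1 else - 1)"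

declare walk_sign.simps [simp del]

lemma walk_sign_cases: "walk_sign c \<kappa> f t = 1 \<or> walk_sign c \<kappa> f t = - 1"
  by (subst (1 2) walk_sign.simps) auto

text \<open>The recursion only looks back. This makes the algorithm online, since it may be fed the
  restricted input, and makes earlier signs immune to resampling a later seed.\<close>

lemma walk_sign_cong:
  assumes "\<And>s. s \<in> {1..t} \<Longrightarrow> f s = g s" "1 \<le> t"
    and "\<And>s s'. s \<in> {1..t} \<Longrightarrow> s' \<in> {1..t} \<Longrightarrow> \<kappa> s s' = \<kappa>' s s'"
  shows "walk_sign c \<kappa> f t = walk_sign c \<kappa>' g t"
  using assms
proof (induction t rule: less_induct)
  case (less t)
  have "(\<Sum>s\<in>{1..<t}. walk_sign c \<kappa> f s * \<kappa> s t) = (\<Sum>s\<in>{1..<t}. walk_sign c \<kappa>' g s * \<kappa>' s t)"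
  proof (intro sum.cong refl)
    fix s assume s: "s \<in> {1..<t}"
    then have "walk_sign c \<kappa> f s = walk_sign c \<kappa>' g s"
      using less.prems by (intro less.IH) auto
    moreover have "\<kappa> s t = \<kappa>' s t" using s by (intro less.prems) auto
    ultimately show "walk_sign c \<kappa> f s * \<kappa> s t = walk_sign c \<kappa>' g s * \<kappa>' s t" by simp
  qed
  moreover have "f t = g t" using less.prems by auto
  ultimately show ?case
    by (subst (1 2) walk_sign.simps) simp
qed

text \<open>The walk computes with the integer kernel \<open>\<kappa>\<close> only; the vectors
  \<open>V\<close> with Gram matrix \<open>\<kappa>\<close> exist for the analysis. So
  \<open>I\<close> may depend on all the points, even future ones, without harm to the online
  property.\<close>

locale self_balancing_walk =
  fixes T c :: nat and \<kappa> :: "nat \<Rightarrow> nat \<Rightarrow> int" and I :: "'i set"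
    and V :: "nat \<Rightarrow> 'i \<Rightarrow> real" and M :: real
  assumes finite_I: "finite I"
    and kernel: "\<And>s t. s \<in> {1..T} \<Longrightarrow> t \<in> {1..T} \<Longrightarrow> real_of_int (\<kappa> s t) = (\<Sum>i\<in>I. V s i * V t i)"
    and norm_V: "\<And>t. t \<in> {1..T} \<Longrightarrow> (\<Sum>i\<in>I. (V t i)\<^sup>2) \<le> M"
    and M_pos: "0 < M" and M_le: "M \<le> real c"
begin

definition "seeds = {1..T} \<rightarrow>\<^sub>E {..<2 * c}"

definition "pos f t i = (\<Sum>s=1..t. real_of_int (walk_sign c \<kappa> f s) * V s i)"

definition "drift f t = (\<Sum>s\<in>{1..<t}. walk_sign c \<kappa> f s * \<kappa> s t)"

text \<open>While the drift is at most \<open>c\<close> in absolute value, the threshold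
  \<open>c - drift\<close> lies between \<open>0\<close> and \<open>2 * c\<close> and the sign has
  exactly the mean \<open>- drift / c\<close>; beyond that the sign saturates and the moment
  computation breaks.\<close>

definition "tame f t \<longleftrightarrow> (\<forall>s\<in>{1..t}. \<bar>drift f s\<bar> \<le> int c)"

lemma c_pos: "0 < c"
  using M_pos M_le by linarith

lemma finite_seeds: "finite seeds"
  by (auto simp: seeds_def intro: finite_PiE)

lemma card_seeds: "card seeds = (2 * c) ^ T"
  by (simp add: seeds_def card_PiE)

lemma drift_eq:
  assumes "Suc t \<le> T"
  shows "real_of_int (drift f (Suc t)) = (\<Sum>i\<in>I. pos f t i * V (Suc t) i)"
proof -
  have "real_of_int (drift f (Suc t)) =
      (\<Sum>s=1..t. real_of_int (walk_sign c \<kappa> f s) * (\<Sum>i\<in>I. V s i * V (Suc t) i))"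
    unfolding drift_def of_int_sum of_int_mult using assms
    by (intro sum.cong) (auto simp: kernel)
  also have "\<dots> = (\<Sum>i\<in>I. pos f t i * V (Suc t) i)"
    unfolding pos_def sum_distrib_left sum_distrib_right
    by (subst sum.swap) (simp add: mult.assoc)
  finally show ?thesis .
qed

lemma pos_Suc: "pos f (Suc t) i = pos f t i + real_of_int (walk_sign c \<kappa> f (Suc t)) * V (Suc t) i"
  by (simp add: pos_def)

lemma tame_Suc: "tame f (Suc t) \<longleftrightarrow> tame f t \<and> \<bar>drift f (Suc t)\<bar> \<le> int c"
  by (auto simp: tame_def atLeastAtMostSuc_conv)

lemma walk_sign_upd: "1 \<le> s \<Longrightarrow> s < r \<Longrightarrow> walk_sign c \<kappa> (f(r := u)) s = walk_sign c \<kappa> f s"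
  by (intro walk_sign_cong) auto

lemma pos_upd: "t < r \<Longrightarrow> pos (f(r := u)) t = pos f t"
  unfolding pos_def by (intro ext sum.cong) (auto simp: walk_sign_upd)

text \<open>The drift at time \<open>t\<close> involves only signs before \<open>t\<close>, so even
  resampling the seed at \<open>t\<close> itself leaves it fixed. Hence the strict bound of
  \<open>pos_upd\<close> relaxes to \<open>t \<le> r\<close> here and for
  \<open>tame\<close>.\<close>

lemma drift_upd: "t \<le> r \<Longrightarrow> drift (f(r := u)) t = drift f t"
  unfolding drift_def by (intro sum.cong) (auto simp: walk_sign_upd)

lemma tame_upd: "t \<le> r \<Longrightarrow> tame (f(r := u)) t = tame f t"
  unfolding tame_def by (intro ball_cong) (auto simp: drift_upd)

lemma sum_sign_exp_le:
  assumes "\<bar>m\<bar> \<le> int c"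
  shows "(\<Sum>u<2 * c. exp ((if int u < int c - m then 1 else - 1) * a))
           \<le> 2 * c * exp (- a * m / c + a\<^sup>2 / 2)"
proof -
  \<comment> \<open>Exactly \<open>k\<close> of the \<open>2 * c\<close> seed values give the sign
    \<open>+1\<close>; the probability \<open>k / (2 * c)\<close> yields the mean
    \<open>- m / c\<close>.\<close>
  define k where "k = nat (int c - m)"
  have k: "int k = int c - m" "k \<le> 2 * c" using assms by (auto simp: k_def)
  have "(\<Sum>u<2 * c. exp ((if int u < int c - m then 1 else - 1) * a))
        = (\<Sum>u<2 * c. if u < k then exp a else exp (- a))"
    using k by (intro sum.cong) (auto simp: k(1)[symmetric])
  also have "\<dots> = (\<Sum>u\<in>{..<k}. exp a) + (\<Sum>u\<in>{k..<2 * c}. exp (- a))"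
  proof -
    have "{..<2 * c} \<inter> {u. u < k} = {..<k}" "{..<2 * c} \<inter> - {u. u < k} = {k..<2 * c}"
      using k by auto
    then show ?thesis by (subst sum.If_cases) simp_all
  qed
  also have "\<dots> = real k * exp a + (2 * c - real k) * exp (- a)"
    using k by (simp add: of_nat_diff)
  also have "\<dots> = 2 * c * (real k / (2 * c) * exp a + (1 - real k / (2 * c)) * exp (- a))"
    using c_pos by (simp add: field_simps)
  also have "\<dots> \<le> 2 * c * exp (a * (2 * (real k / (2 * c)) - 1) + a\<^sup>2 / 2)"
    by (intro mult_left_mono two_point_mgf_le) (use k c_pos in \<open>auto simp: field_simps\<close>)
  also have "a * (2 * (real k / (2 * c)) - 1) = - a * m / c"
  proof -
    have "real k = real c - real_of_int m" using k(1) by linarith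
    then have "2 * (real k / (2 * c)) - 1 = - real_of_int m / c"
      using c_pos by (simp add: diff_divide_distrib)
    then show ?thesis by simp
  qed
  finally show ?thesis .
qed

text \<open>Averaging over the next sign replaces \<open>u\<close> by \<open>u - (a / c) V\<close> with \<open>a = \<langle>u, V\<rangle>\<close>; the loss
  \<open>a\<^sup>2 / 2\<close> is exactly compensated by the decrease of \<open>c / 2 * \<parallel>u\<parallel>\<^sup>2\<close>.\<close>

lemma subgaussian:
  assumes "t \<le> T"
  shows "(\<Sum>f\<in>seeds. of_bool (tame f t) * exp (\<Sum>i\<in>I. u i * pos f t i))
           \<le> card seeds * exp (c / 2 * (\<Sum>i\<in>I. (u i)\<^sup>2))"
  using assms
\<comment> \<open>The direction must vary: the step for \<open>u\<close> calls the hypothesis for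
  the shifted direction \<open>u'\<close>.\<close>
proof (induction t arbitrary: u)
  case 0
  have "(\<Sum>f\<in>seeds. of_bool (tame f 0) * exp (\<Sum>i\<in>I. u i * pos f 0 i)) = card seeds"
    by (simp add: pos_def tame_def)
  also have "\<dots> \<le> card seeds * exp (c / 2 * (\<Sum>i\<in>I. (u i)\<^sup>2))"
    by (simp add: mult_le_cancel_left1 sum_nonneg)
  finally show ?case .
next
  case (Suc t)
  define v where "v = V (Suc t)"
  define a where "a = (\<Sum>i\<in>I. u i * v i)"
  define u' where "u' = (\<lambda>i. u i - a / c * v i)"
  define F where "F f = of_bool (tame f (Suc t)) * exp (\<Sum>i\<in>I. u i * pos f (Suc t) i)" for f
  have step: "(\<Sum>x<2 * c. F (f(Suc t := x)))
      \<le> 2 * c * exp (a\<^sup>2 / 2) * (of_bool (tame f t) * exp (\<Sum>i\<in>I. u' i * pos f t i))" for f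
  proof (cases "tame f (Suc t)")
    case True
    define m where "m = drift f (Suc t)"
    have m: "\<bar>m\<bar> \<le> int c" and tame: "tame f t" using True by (auto simp: tame_Suc m_def)
    have F: "F (f(Suc t := x)) = exp (\<Sum>i\<in>I. u i * pos f t i)
        * exp ((if int x < int c - m then 1 else - 1) * a)" for x
    proof -
      have *: "walk_sign c \<kappa> (f(Suc t := x)) (Suc t) = (if int x < int c - m then 1 else - 1)"
        using drift_upd[of "Suc t" "Suc t" f x]
        by (subst walk_sign.simps) (simp add: m_def drift_def)
      have "(\<Sum>i\<in>I. u i * pos (f(Suc t := x)) (Suc t) i)
            = (\<Sum>i\<in>I. u i * pos f t i) + (if int x < int c - m then 1 else - 1) * a"
        unfolding pos_Suc * a_def v_def
        by (simp add: pos_upd algebra_simps sum.distrib sum_distrib_left sum_negf sum_subtractf)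
      then show ?thesis
        using True by (simp add: F_def tame_upd flip: exp_add)
    qed
    have "(\<Sum>x<2 * c. F (f(Suc t := x)))
        \<le> exp (\<Sum>i\<in>I. u i * pos f t i) * (2 * c * exp (- a * m / c + a\<^sup>2 / 2))"
      unfolding F sum_distrib_left[symmetric]
      by (intro mult_left_mono sum_sign_exp_le m) auto
    also have "\<dots> = 2 * c * exp (a\<^sup>2 / 2) * exp ((\<Sum>i\<in>I. u i * pos f t i) - a / c * m)"
      by (simp add: exp_add[symmetric] exp_diff exp_minus field_simps)
    also have "(\<Sum>i\<in>I. u i * pos f t i) - a / c * m = (\<Sum>i\<in>I. u' i * pos f t i)"
      unfolding m_def using Suc.prems
      by (simp add: drift_eq u'_def v_def algebra_simps sum_subtractf sum_distrib_left)
    finally show ?thesis unfolding of_bool_eq_1_iff[THEN iffD2, OF tame] mult_1 .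
  next
    \<comment> \<open>Whether step \<open>Suc t\<close> is tame is decided before its seed is drawn,
      so here all resampled terms vanish together.\<close>
    case False
    then have "F (f(Suc t := x)) = 0" for x
      by (simp add: F_def tame_upd)
    then show ?thesis by simp
  qed
  have "(\<Sum>f\<in>seeds. F f) = (\<Sum>f\<in>seeds. \<Sum>x<2 * c. F (f(Suc t := x))) / (2 * c)"
    unfolding seeds_def using Suc.prems c_pos
    by (subst sum_PiE_resample[where i = "Suc t"]) (auto simp: lessThan_empty_iff)
  also have "\<dots> \<le> (\<Sum>f\<in>seeds. 2 * c * exp (a\<^sup>2 / 2)
      * (of_bool (tame f t) * exp (\<Sum>i\<in>I. u' i * pos f t i))) / (2 * c)"
    using c_pos by (intro divide_right_mono sum_mono step) auto
  also have "\<dots> = exp (a\<^sup>2 / 2) * (\<Sum>f\<in>seeds. of_bool (tame f t) * exp (\<Sum>i\<in>I. u' i * pos f t i))"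
    using c_pos by (simp add: sum_distrib_left sum_divide_distrib mult.assoc)
  also have "\<dots> \<le> exp (a\<^sup>2 / 2) * (card seeds * exp (c / 2 * (\<Sum>i\<in>I. (u' i)\<^sup>2)))"
    using Suc.prems by (intro mult_left_mono Suc.IH) auto
  also have "\<dots> = card seeds * exp (a\<^sup>2 / 2 + c / 2 * (\<Sum>i\<in>I. (u' i)\<^sup>2))"
    by (simp add: exp_add)
  also have "\<dots> \<le> card seeds * exp (c / 2 * (\<Sum>i\<in>I. (u i)\<^sup>2))"
  proof -
    have "(\<Sum>i\<in>I. (u' i)\<^sup>2) = (\<Sum>i\<in>I. (u i)\<^sup>2) - 2 * (a / c) * a + (a / c)\<^sup>2 * (\<Sum>i\<in>I. (v i)\<^sup>2)"
    proof -
      have "(\<Sum>i\<in>I. 2 * u i * (a / c * v i)) = 2 * (a / c) * (\<Sum>i\<in>I. u i * v i)"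
        unfolding sum_distrib_left by (intro sum.cong) auto
      then have "(\<Sum>i\<in>I. 2 * u i * (a / c * v i)) = 2 * (a / c) * a"
        unfolding a_def[symmetric] .
      moreover have "(\<Sum>i\<in>I. (a / c * v i)\<^sup>2) = (a / c)\<^sup>2 * (\<Sum>i\<in>I. (v i)\<^sup>2)"
        unfolding sum_distrib_left power_mult_distrib ..
      ultimately show ?thesis
        unfolding u'_def power2_diff sum.distrib sum_subtractf by simp
    qed
    \<comment> \<open>The hypotheses on \<open>M\<close> enter here: a squared norm of
      \<open>v\<close> of at most \<open>c\<close> keeps the quadratic term at half the size of the
      cross term, leaving the gain \<open>a\<^sup>2 / c\<close>.\<close>
    also have "\<dots> \<le> (\<Sum>i\<in>I. (u i)\<^sup>2) - 2 * (a / c) * a + (a / c)\<^sup>2 * c"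
      using norm_V[of "Suc t"] M_le Suc.prems by (intro add_mono mult_left_mono) (auto simp: v_def)
    also have "\<dots> = (\<Sum>i\<in>I. (u i)\<^sup>2) - a\<^sup>2 / c"
      using c_pos by (simp add: field_simps power2_eq_square)
    finally have "c / 2 * (\<Sum>i\<in>I. (u' i)\<^sup>2) \<le> c / 2 * ((\<Sum>i\<in>I. (u i)\<^sup>2) - a\<^sup>2 / c)"
      by (intro mult_left_mono) auto
    also have "\<dots> = c / 2 * (\<Sum>i\<in>I. (u i)\<^sup>2) - a\<^sup>2 / 2"
      using c_pos by (simp add: field_simps)
    finally show ?thesis by (intro mult_left_mono) auto
  qed
  finally show ?case by (simp add: F_def)
qed

text \<open>Chernoff's bound in counting form. The scaling of the exponent is left to the caller
  through \<open>u\<close> and \<open>l\<close>.\<close>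

lemma card_tame_tail_le:
  assumes "t \<le> T"
  shows "card {f \<in> seeds. tame f t \<and> l \<le> (\<Sum>i\<in>I. u i * pos f t i)}
           \<le> card seeds * exp (c / 2 * (\<Sum>i\<in>I. (u i)\<^sup>2) - l)"
proof -
  let ?A = "{f \<in> seeds. tame f t \<and> l \<le> (\<Sum>i\<in>I. u i * pos f t i)}"
  have "exp l * card ?A = (\<Sum>f\<in>?A. exp l)"
    by simp
  also have "\<dots> \<le> (\<Sum>f\<in>?A. of_bool (tame f t) * exp (\<Sum>i\<in>I. u i * pos f t i))"
    by (intro sum_mono) auto
  also have "\<dots> \<le> (\<Sum>f\<in>seeds. of_bool (tame f t) * exp (\<Sum>i\<in>I. u i * pos f t i))"
    by (intro sum_mono2) (auto simp: finite_seeds)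
  also have "\<dots> \<le> card seeds * exp (c / 2 * (\<Sum>i\<in>I. (u i)\<^sup>2))"
    by (rule subgaussian[OF assms])
  finally have "card ?A \<le> card seeds * exp (c / 2 * (\<Sum>i\<in>I. (u i)\<^sup>2)) / exp l"
    by (subst pos_le_divide_eq) (simp_all add: mult.commute)
  then show ?thesis by (simp add: exp_diff)
qed

lemma card_tame_abs_tail_le:
  assumes "t \<le> T"
  shows "card {f \<in> seeds. tame f t \<and> l \<le> \<bar>\<Sum>i\<in>I. u i * pos f t i\<bar>}
           \<le> 2 * card seeds * exp (c / 2 * (\<Sum>i\<in>I. (u i)\<^sup>2) - l)"
proof -
  let ?A = "\<lambda>u. {f \<in> seeds. tame f t \<and> l \<le> (\<Sum>i\<in>I. u i * pos f t i)}"
  have "{f \<in> seeds. tame f t \<and> l \<le> \<bar>\<Sum>i\<in>I. u i * pos f t i\<bar>} \<subseteq> ?A u \<union> ?A (\<lambda>i. - u i)"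
    by (auto simp: sum_negf abs_if)
  then have "card {f \<in> seeds. tame f t \<and> l \<le> \<bar>\<Sum>i\<in>I. u i * pos f t i\<bar>} \<le> card (?A u \<union> ?A (\<lambda>i. - u i))"
    by (intro card_mono) (auto simp: finite_seeds)
  also have "\<dots> \<le> card (?A u) + card (?A (\<lambda>i. - u i))"
    by (rule card_Un_le)
  finally have "real (card {f \<in> seeds. tame f t \<and> l \<le> \<bar>\<Sum>i\<in>I. u i * pos f t i\<bar>})
      \<le> real (card (?A u)) + real (card (?A (\<lambda>i. - u i)))"
    by linarith
  also have "\<dots> \<le> card seeds * exp (c / 2 * (\<Sum>i\<in>I. (u i)\<^sup>2) - l)
      + card seeds * exp (c / 2 * (\<Sum>i\<in>I. (- u i)\<^sup>2) - l)"
    by (intro add_mono card_tame_tail_le assms)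
  finally show ?thesis by simp
qed

text \<open>There is no circle: when the drift first exceeds \<open>c\<close>, the walk has been
  tame until then, and the drift is the inner product of its position with \<open>V t\<close>, to
  which the tail bound for tame seeds applies.\<close>

lemma card_not_tame_le:
  "card {f \<in> seeds. \<not> tame f T} \<le> T * (2 * card seeds * exp (- (c / (2 * M))))"
proof -
  let ?A = "\<lambda>t. {f \<in> seeds. tame f (t - 1) \<and> int c < \<bar>drift f t\<bar>}"
  have *: "\<exists>t\<in>{1..n}. tame f (t - 1) \<and> int c < \<bar>drift f t\<bar>" if "\<not> tame f n" for f n
    using that
  proof (induction n)
    case 0
    then show ?case by (simp add: tame_def)
  next
    case (Suc n)
    show ?case
    proof (cases "tame f n")
      case True
      then have "int c < \<bar>drift f (Suc n)\<bar>" using Suc.prems by (auto simp: tame_Suc)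
      then show ?thesis using True by (intro bexI[of _ "Suc n"]) auto
    next
      case False
      then show ?thesis using Suc.IH by force
    qed
  qed
  have "card {f \<in> seeds. \<not> tame f T} \<le> card (\<Union>t\<in>{1..T}. ?A t)"
  proof (intro card_mono subsetI)
    fix f assume "f \<in> {f \<in> seeds. \<not> tame f T}"
    then show "f \<in> (\<Union>t\<in>{1..T}. ?A t)" using *[of f T] by blast
  qed (simp add: finite_seeds)
  also have "\<dots> \<le> (\<Sum>t\<in>{1..T}. card (?A t))"
    by (intro card_UN_le) auto
  finally have "real (card {f \<in> seeds. \<not> tame f T}) \<le> (\<Sum>t\<in>{1..T}. real (card (?A t)))"
    unfolding of_nat_sum[symmetric] of_nat_le_iff .
  also have "\<dots> \<le> (\<Sum>t\<in>{1..T}. 2 * card seeds * exp (- (c / (2 * M))))"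
  proof (intro sum_mono)
    fix t assume t: "t \<in> {1..T}"
    \<comment> \<open>Among the multiples \<open>\<lambda>\<close> of \<open>V t\<close>, the factor
      \<open>1 / M\<close> minimises the exponent
      \<open>c / 2 * \<lambda>\<^sup>2 * M - \<lambda> * c\<close>.\<close>
    define u where "u = (\<lambda>i. V t i / M)"
    have u_pos: "(\<Sum>i\<in>I. u i * pos f (t - 1) i) = real_of_int (drift f t) / M" for f
      using drift_eq[of "t - 1" f] t
      by (auto simp: u_def sum_divide_distrib mult.commute)
    have "card (?A t) \<le> card {f \<in> seeds. tame f (t - 1) \<and> c / M \<le> \<bar>\<Sum>i\<in>I. u i * pos f (t - 1) i\<bar>}"
    proof (intro card_mono subsetI)
      fix f assume f: "f \<in> ?A t"
      have "real c \<le> \<bar>real_of_int (drift f t)\<bar>"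
        using f by simp linarith
      then have "c / M \<le> \<bar>\<Sum>i\<in>I. u i * pos f (t - 1) i\<bar>"
        unfolding u_pos using M_pos by (simp add: divide_right_mono)
      then show "f \<in> {f \<in> seeds. tame f (t - 1) \<and> c / M \<le> \<bar>\<Sum>i\<in>I. u i * pos f (t - 1) i\<bar>}"
        using f by auto
    qed (auto simp: finite_seeds)
    then have "real (card (?A t)) \<le> 2 * card seeds * exp (c / 2 * (\<Sum>i\<in>I. (u i)\<^sup>2) - c / M)"
      using t by (intro order_trans[OF _ card_tame_abs_tail_le[of "t - 1" "c / M" u]]) auto
    also have "(\<Sum>i\<in>I. (u i)\<^sup>2) \<le> 1 / M"
    proof -
      have "(\<Sum>i\<in>I. (u i)\<^sup>2) = (\<Sum>i\<in>I. (V t i)\<^sup>2) / M\<^sup>2"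
        by (simp add: u_def power_divide sum_divide_distrib)
      also have "\<dots> \<le> M / M\<^sup>2"
        using norm_V[OF t] by (intro divide_right_mono) auto
      finally show ?thesis using M_pos by (simp add: power2_eq_square)
    qed
    finally have "real (card (?A t)) \<le> 2 * card seeds * exp (c / 2 * (1 / M) - c / M)"
      by (simp add: mult_left_mono)
    also have "c / 2 * (1 / M) - c / M = - (c / (2 * M))"
      using M_pos by (simp add: field_simps)
    finally show "real (card (?A t)) \<le> 2 * card seeds * exp (- (c / (2 * M)))" .
  qed
  finally show ?thesis by simp
qed

lemma tame_mono: "tame f T \<Longrightarrow> t \<le> T \<Longrightarrow> tame f t"
  by (auto simp: tame_def)

theorem card_large_coordinate_le:
  assumes "0 \<le> l"
  shows "card {f \<in> seeds. \<exists>t\<in>{1..T}. \<exists>i\<in>I. l < \<bar>pos f t i\<bar>}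
    \<le> (2 * real T * exp (- (c / (2 * M))) + 2 * real T * card I * exp (- (l\<^sup>2 / (2 * real c)))) * card seeds"
proof -
  let ?A = "\<lambda>t i. {f \<in> seeds. tame f t \<and> l < \<bar>pos f t i\<bar>}"
  let ?N = "{f \<in> seeds. \<not> tame f T}"
  have A: "card (?A t i) \<le> 2 * card seeds * exp (- (l\<^sup>2 / (2 * real c)))" if "t \<in> {1..T}" "i \<in> I" for t i
  proof -
    \<comment> \<open>A single coordinate as direction; the weight \<open>l / c\<close> optimises
      the exponent to \<open>- l\<^sup>2 / (2 * c)\<close>.\<close>
    define u where "u = (\<lambda>k. if k = i then l / c else 0)"
    have u_pos: "(\<Sum>k\<in>I. u k * pos f t k) = l / c * pos f t i" for f
      using that finite_I by (simp add: u_def if_distrib[where f = "\<lambda>x. x * _"] cong: if_cong)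
    have u_sq: "(\<Sum>k\<in>I. (u k)\<^sup>2) = (l / c)\<^sup>2"
      using that finite_I by (simp add: u_def if_distrib[where f = "\<lambda>x. x\<^sup>2"] cong: if_cong)
    have "card (?A t i) \<le> card {f \<in> seeds. tame f t \<and> l\<^sup>2 / c \<le> \<bar>\<Sum>k\<in>I. u k * pos f t k\<bar>}"
    proof (intro card_mono subsetI)
      fix f assume f: "f \<in> ?A t i"
      then have "l / c * l \<le> l / c * \<bar>pos f t i\<bar>"
        using assms by (intro mult_left_mono) auto
      then have "l\<^sup>2 / c \<le> \<bar>\<Sum>k\<in>I. u k * pos f t k\<bar>"
        unfolding u_pos using assms by (simp add: power2_eq_square abs_mult)
      then show "f \<in> {f \<in> seeds. tame f t \<and> l\<^sup>2 / c \<le> \<bar>\<Sum>k\<in>I. u k * pos f t k\<bar>}"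
        using f by auto
    qed (auto simp: finite_seeds)
    then have "real (card (?A t i)) \<le> 2 * card seeds * exp (c / 2 * (l / c)\<^sup>2 - l\<^sup>2 / c)"
      using card_tame_abs_tail_le[of t "l\<^sup>2 / c" u] that by (simp add: u_sq)
    also have "c / 2 * (l / c)\<^sup>2 - l\<^sup>2 / c = - (l\<^sup>2 / (2 * real c))"
      using c_pos by (simp add: field_simps power2_eq_square)
    finally show ?thesis .
  qed
  have "card {f \<in> seeds. \<exists>t\<in>{1..T}. \<exists>i\<in>I. l < \<bar>pos f t i\<bar>} \<le> card (?N \<union> (\<Union>(t, i)\<in>{1..T} \<times> I. ?A t i))"
    by (intro card_mono) (auto simp: finite_seeds finite_I dest: tame_mono)
  also have "\<dots> \<le> card ?N + card (\<Union>(t, i)\<in>{1..T} \<times> I. ?A t i)"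
    by (rule card_Un_le)
  also have "card (\<Union>(t, i)\<in>{1..T} \<times> I. ?A t i) \<le> (\<Sum>(t, i)\<in>{1..T} \<times> I. card (?A t i))"
    using card_UN_le[of "{1..T} \<times> I" "\<lambda>(t, i). ?A t i"] finite_I by (simp add: case_prod_unfold)
  finally have "real (card {f \<in> seeds. \<exists>t\<in>{1..T}. \<exists>i\<in>I. l < \<bar>pos f t i\<bar>})
      \<le> real (card ?N) + (\<Sum>(t, i)\<in>{1..T} \<times> I. real (card (?A t i)))"
    by (simp add: case_prod_unfold flip: of_nat_sum of_nat_add)
  also have "\<dots> \<le> T * (2 * card seeds * exp (- (c / (2 * M))))
      + (\<Sum>(t, i)\<in>{1..T} \<times> I. 2 * card seeds * exp (- (l\<^sup>2 / (2 * real c))))"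
    by (intro add_mono card_not_tame_le sum_mono) (use A in auto)
  also have "\<dots> = (2 * real T * exp (- (c / (2 * M))) + 2 * real T * card I * exp (- (l\<^sup>2 / (2 * real c)))) * card seeds"
    by (simp add: case_prod_unfold card_cartesian_product algebra_simps)
  finally show ?thesis .
qed

end

section \<open>Boxes as signed sums of dyadic boxes\<close>

text \<open>The initial segment below \<open>b\<close> splits into one dyadic interval of length
  \<open>2 ^ j\<close> for each binary digit \<open>1\<close> at place \<open>j\<close>; the
  induction peels off the lowest digit. An odd quotient is positive, so the subtraction does not
  truncate where it counts.\<close>

lemma less_dyadic_decomposition:
  fixes b q n :: nat
  assumes "b < 2 ^ Suc n"
  shows "(of_bool (q < b) :: real) =
    (\<Sum>j\<le>n. of_bool (odd (b div 2 ^ j)) * of_bool (q div 2 ^ j = b div 2 ^ j - 1))"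
  using assms
proof (induction n arbitrary: b q)
  case 0
  then have "b = 0 \<or> b = 1" by auto
  then show ?case by auto
next
  case (Suc n)
  have "(of_bool (q < b) :: real) = of_bool (odd b) * of_bool (q = b - 1) + of_bool (q div 2 < b div 2)"
  proof (cases "even b")
    case True
    then obtain b' where "b = 2 * b'" by blast
    then have "q < b \<longleftrightarrow> q div 2 < b div 2" by auto
    then show ?thesis using True by simp
  next
    case False
    then obtain b' where b: "b = 2 * b' + 1" by (blast elim: oddE)
    have "q < b \<longleftrightarrow> q = b - 1 \<or> q div 2 < b div 2" "\<not> (q = b - 1 \<and> q div 2 < b div 2)"
      unfolding b by auto
    then show ?thesis using False by auto
  qed
  also have "(of_bool (q div 2 < b div 2) :: real) =
      (\<Sum>j\<le>n. of_bool (odd (b div 2 ^ Suc j)) * of_bool (q div 2 ^ Suc j = b div 2 ^ Suc j - 1))"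
    using Suc.prems by (subst Suc.IH) (auto simp: div_mult2_eq)
  finally show ?case unfolding sum.atMost_Suc_shift power_0 div_by_1 .
qed

text \<open>An interval is the difference of two initial segments, told apart by the Boolean. Zero
  weights pad the sum to a fixed index set, so that products over coordinates can be
  expanded.\<close>

lemma interval_dyadic_decomposition:
  fixes a b n :: nat
  assumes "a \<le> b" "b < 2 ^ Suc n"
  shows "\<exists>w k. (\<forall>p. \<bar>w p\<bar> \<le> 1) \<and> (\<forall>q. (of_bool (a \<le> q \<and> q < b) :: real)
      = (\<Sum>p\<in>{..n} \<times> (UNIV :: bool set). w p * of_bool (q div 2 ^ fst p = (k p :: nat))))"
proof -
  define e where "e p = (if snd p then b else a)" for p :: "nat \<times> bool"
  define w :: "nat \<times> bool \<Rightarrow> real"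
    where "w p = (if snd p then 1 else - 1) * of_bool (odd (e p div 2 ^ fst p))" for p
  have w: "\<bar>w p\<bar> \<le> 1" for p by (simp add: w_def)
  have "of_bool (a \<le> q \<and> q < b)
      = (\<Sum>p\<in>{..n} \<times> UNIV. w p * of_bool (q div 2 ^ fst p = e p div 2 ^ fst p - 1))" for q
  proof -
    have "(\<Sum>p\<in>{..n} \<times> UNIV. w p * of_bool (q div 2 ^ fst p = e p div 2 ^ fst p - 1))
        = (\<Sum>j\<le>n. of_bool (odd (b div 2 ^ j)) * of_bool (q div 2 ^ j = b div 2 ^ j - 1))
          - (\<Sum>j\<le>n. of_bool (odd (a div 2 ^ j)) * of_bool (q div 2 ^ j = a div 2 ^ j - 1))"
      unfolding sum.cartesian_product' UNIV_bool sum_subtractf[symmetric]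
      by (intro sum.cong) (auto simp: w_def e_def simp del: sum_mult_of_bool_eq sum_of_bool_mult_eq)
    also have "\<dots> = of_bool (q < b) - of_bool (q < a)"
      using assms by (subst (1 2) less_dyadic_decomposition[where n = n]) auto
    also have "\<dots> = of_bool (a \<le> q \<and> q < b)"
      using assms by auto
    finally show ?thesis ..
  qed
  then show ?thesis
    using w by (intro exI[of _ w] exI[of _ "\<lambda>p. e p div 2 ^ fst p - 1"]) blast
qed

text \<open>Expanding the product over the coordinates turns a box into
  \<open>(2 * (n + 1)) ^ CARD('d)\<close> dyadic boxes with weights of absolute value at most one;
  this count is the price of passing from dyadic to general boxes.\<close>

lemma grid_box_sum_le:
  fixes q :: "nat \<Rightarrow> 'd::finite \<Rightarrow> nat" and \<sigma> :: "nat \<Rightarrow> real"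
  assumes dyadic: "\<And>j k. (\<And>i. j i \<le> n) \<Longrightarrow>
      \<bar>\<Sum>s\<in>S. \<sigma> s * of_bool (\<forall>i. q s i div 2 ^ j i = k i)\<bar> \<le> l"
    and ab: "\<And>i. a i \<le> b i" "\<And>i. b i < 2 ^ Suc n"
  shows "\<bar>\<Sum>s\<in>S. \<sigma> s * of_bool (\<forall>i. a i \<le> q s i \<and> q s i < b i)\<bar> \<le> (2 * real (n + 1)) ^ CARD('d) * l"
proof -
  obtain w :: "'d \<Rightarrow> nat \<times> bool \<Rightarrow> real" and k :: "'d \<Rightarrow> nat \<times> bool \<Rightarrow> nat"
    where wk: "\<forall>i. (\<forall>p. \<bar>w i p\<bar> \<le> 1) \<and> (\<forall>x. of_bool (a i \<le> x \<and> x < b i)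
        = (\<Sum>p\<in>{..n} \<times> UNIV. w i p * of_bool (x div 2 ^ fst p = k i p)))"
  proof -
    have "\<forall>i. \<exists>w k. (\<forall>p. \<bar>w p\<bar> \<le> 1) \<and> (\<forall>x. (of_bool (a i \<le> x \<and> x < b i) :: real)
        = (\<Sum>p\<in>{..n} \<times> (UNIV :: bool set). w p * of_bool (x div 2 ^ fst p = (k p :: nat))))"
      using interval_dyadic_decomposition[OF ab] by (rule allI)
    then show ?thesis
      using that unfolding choice_iff by (elim exE)
  qed
  then have w: "\<And>i p. \<bar>w i p\<bar> \<le> 1"
      and eq: "\<And>i x. of_bool (a i \<le> x \<and> x < b i)
        = (\<Sum>p\<in>{..n} \<times> UNIV. w i p * of_bool (x div 2 ^ fst p = k i p))"
    by blast+
  define P where "P = (UNIV :: 'd set) \<rightarrow>\<^sub>E {..n} \<times> (UNIV :: bool set)"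
  have forall_of_bool: "(of_bool (\<forall>i. Q i) :: real) = (\<Prod>i\<in>UNIV. of_bool (Q i))" for Q :: "'d \<Rightarrow> bool"
    by (auto simp: of_bool_def)
  have card_P: "real (card P) = (2 * real (n + 1)) ^ CARD('d)"
    by (simp add: P_def card_PiE card_cartesian_product mult.commute)
  have "(of_bool (\<forall>i. a i \<le> q s i \<and> q s i < b i) :: real)
      = (\<Sum>g\<in>P. (\<Prod>i\<in>UNIV. w i (g i)) * of_bool (\<forall>i. q s i div 2 ^ fst (g i) = k i (g i)))" for s
    unfolding forall_of_bool eq P_def prod.distrib[symmetric] by (rule prod_sum_PiE) auto
  then have "(\<Sum>s\<in>S. \<sigma> s * of_bool (\<forall>i. a i \<le> q s i \<and> q s i < b i))
      = (\<Sum>g\<in>P. (\<Prod>i\<in>UNIV. w i (g i)) *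
          (\<Sum>s\<in>S. \<sigma> s * of_bool (\<forall>i. q s i div 2 ^ fst (g i) = k i (g i))))"
    by (subst sum_distrib_left, subst sum.swap) (simp add: sum_distrib_left mult_ac)
  also have "\<bar>\<dots>\<bar> \<le> (\<Sum>g\<in>P. 1 * l)"
    unfolding abs_mult abs_prod
  proof (intro order_trans[OF sum_abs] sum_mono)
    fix g assume "g \<in> P"
    then have "fst (g i) \<le> n" for i
      by (simp add: P_def PiE_iff mem_Times_iff)
    then have "\<bar>\<Sum>s\<in>S. \<sigma> s * of_bool (\<forall>i. q s i div 2 ^ fst (g i) = k i (g i))\<bar> \<le> l"
      by (rule dyadic)
    then show "\<bar>(\<Prod>i\<in>UNIV. w i (g i)) *
        (\<Sum>s\<in>S. \<sigma> s * of_bool (\<forall>i. q s i div 2 ^ fst (g i) = k i (g i)))\<bar> \<le> 1 * l"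
      unfolding abs_mult abs_prod using w by (intro mult_mono prod_le_1) auto
  qed
  finally show ?thesis by (simp add: card_P)
qed

section \<open>Rounding real boxes to grid boxes\<close>

definition cell :: "nat \<Rightarrow> real ^ 'd \<Rightarrow> 'd \<Rightarrow> nat" where
  "cell n x i = nat \<lfloor>2 ^ n * x $ i\<rfloor>"

lemma cell_mono: "x $ i \<le> y $ i \<Longrightarrow> cell n x i \<le> cell n y i"
  by (auto simp: cell_def intro!: nat_mono floor_mono)

lemma cell_less_imp_less: "cell n x i < cell n y i \<Longrightarrow> x $ i < y $ i"
  using cell_mono[of y i x n] by force

text \<open>The value \<open>2 ^ n\<close> is attained at coordinate \<open>1\<close>. This is why
  endpoints up to \<open>2 ^ n\<close> inclusive occur and the digit expansion allows
  \<open>b < 2 ^ Suc n\<close>.\<close>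

lemma cell_le:
  assumes "x $ i \<le> 1"
  shows "cell n x i \<le> 2 ^ n"
proof -
  have "2 ^ n * x $ i \<le> 2 ^ n"
    using assms by (subst mult_le_cancel_left2) auto
  then have "2 ^ n * x $ i < 2 ^ n + 1"
    by (rule le_less_trans) simp
  then have "\<lfloor>2 ^ n * x $ i\<rfloor> \<le> 2 ^ n"
    by (simp add: floor_le_iff)
  then show ?thesis
    unfolding cell_def by (simp add: nat_le_iff)
qed

text \<open>The endpoints of each side are rounded to their cells. Whether a side is open or closed
  at an end can only matter for points sharing a cell coordinate with that end, and the second
  alternative gives these away.\<close>

lemma axis_parallel_box_cells:
  fixes B :: "(real ^ 'd) set"
  assumes "axis_parallel_box B"
  obtains a b :: "'d \<Rightarrow> nat"
  where "\<And>i. a i \<le> b i" "\<And>i. b i \<le> 2 ^ n"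
    and "\<And>x. (x \<in> B \<longleftrightarrow> (\<forall>i. a i \<le> cell n x i \<and> cell n x i < b i)) \<or> (\<exists>i. cell n x i = a i \<or> cell n x i = b i)"
proof -
  obtain I where "\<forall>i. is_interval (I i) \<and> I i \<subseteq> {0..1::real}" and B: "B = {x. \<forall>i. x $ i \<in> I i}"
    using assms unfolding axis_parallel_box_def by (elim exE conjE)
  then have I: "\<And>i. is_interval (I i)" "\<And>i. I i \<subseteq> {0..1::real}"
    by auto
  show ?thesis
  \<comment> \<open>An empty side is set apart because \<open>Inf\<close> and \<open>Sup\<close> of
    the empty set carry no information.\<close>
  proof (cases "\<exists>i. I i = {}")
    case True
    then have "B = {}" using B by auto
    then show ?thesis by (intro that[of "\<lambda>_. 0" "\<lambda>_. 0"]) auto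
  next
    case False
    define lo hi :: "real ^ 'd" where "lo = (\<chi> i. Inf (I i))" and "hi = (\<chi> i. Sup (I i))"
    have bdd: "bdd_below (I i)" "bdd_above (I i)" for i
      using I(2)[of i] by (meson bdd_below_Icc bdd_below_mono bdd_above_Icc bdd_above_mono)+
    have lo: "lo $ i \<le> y" and hi: "y \<le> hi $ i" if "y \<in> I i" for y i
      using that bdd by (auto simp: lo_def hi_def intro: cInf_lower cSup_upper)
    have mid: "y \<in> I i" if y: "lo $ i < y" "y < hi $ i" for y i
    proof -
      have "\<exists>u\<in>I i. u < y"
        using y False bdd by (simp add: lo_def cInf_less_iff)
      moreover have "\<exists>v\<in>I i. y < v"
        using y False bdd by (simp add: hi_def less_cSup_iff)
      ultimately show ?thesis
        using I(1)[of i] unfolding is_interval_1 by (meson less_imp_le)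
    qed
    have hi1: "hi $ i \<le> 1" for i
      using False I(2)[of i] by (auto simp: hi_def intro!: cSup_least)
    have lohi: "lo $ i \<le> hi $ i" for i
      using False lo hi by (meson equals0I order_trans)
    show ?thesis
    proof (rule that[of "cell n lo" "cell n hi"])
      show "cell n lo i \<le> cell n hi i" "cell n hi i \<le> 2 ^ n" for i
        using lohi hi1 by (auto intro: cell_mono cell_le)
      fix x
      show "(x \<in> B \<longleftrightarrow> (\<forall>i. cell n lo i \<le> cell n x i \<and> cell n x i < cell n hi i))
          \<or> (\<exists>i. cell n x i = cell n lo i \<or> cell n x i = cell n hi i)"
      proof (cases "\<exists>i. cell n x i = cell n lo i \<or> cell n x i = cell n hi i")
        case ex: False
        have "x $ i \<in> I i \<longleftrightarrow> cell n lo i \<le> cell n x i \<and> cell n x i < cell n hi i" for i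
        proof
          assume "x $ i \<in> I i"
          then have "cell n lo i \<le> cell n x i" "cell n x i \<le> cell n hi i"
            using lo hi by (auto intro: cell_mono)
          then show "cell n lo i \<le> cell n x i \<and> cell n x i < cell n hi i"
            using ex by (auto simp: le_less)
        next
          assume "cell n lo i \<le> cell n x i \<and> cell n x i < cell n hi i"
          then have "cell n lo i < cell n x i" "cell n x i < cell n hi i"
            using ex by (metis le_neq_implies_less, blast)
          then show "x $ i \<in> I i"
            by (intro mid) (auto dest: cell_less_imp_less)
        qed
        then show ?thesis using B by auto
      qed auto
    qed
  qed
qed

text \<open>The rounding error is at most the number of points in the strips through the endpoints:
  two strips per coordinate with at most \<open>r\<close> points each.\<close>

lemma disc_le_dyadic:
  fixes x :: "nat \<Rightarrow> real ^ 'd"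
  assumes B: "axis_parallel_box B" and t: "t \<le> T"
    and \<sigma>: "\<And>s. s \<in> {1..T} \<Longrightarrow> \<bar>\<sigma> s\<bar> \<le> 1"
    and dyadic: "\<And>j k. (\<And>i. j i \<le> n) \<Longrightarrow>
      \<bar>\<Sum>s=1..t. \<sigma> s * of_bool (\<forall>i. cell n (x s) i div 2 ^ j i = k i)\<bar> \<le> l"
    and strip: "\<And>i k. k \<le> 2 ^ n \<Longrightarrow> card {s \<in> {1..T}. cell n (x s) i = k} \<le> r"
  shows "disc \<sigma> x t B \<le> (2 * real (n + 1)) ^ CARD('d) * l + 2 * real CARD('d) * r"
proof -
  obtain a b :: "'d \<Rightarrow> nat"
    where ab: "\<And>i. a i \<le> b i" "\<And>i. b i \<le> 2 ^ n"
      and cells: "\<And>x. (x \<in> B \<longleftrightarrow> (\<forall>i. a i \<le> cell n x i \<and> cell n x i < b i)) \<or> (\<exists>i. cell n x i = a i \<or> cell n x i = b i)"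
    using axis_parallel_box_cells[OF B] by blast
  define inner where "inner s \<longleftrightarrow> (\<forall>i. a i \<le> cell n (x s) i \<and> cell n (x s) i < b i)" for s
  define E where "E = (\<Union>i. {s \<in> {1..T}. cell n (x s) i = a i} \<union> {s \<in> {1..T}. cell n (x s) i = b i})"
  have [simp]: "finite E" by (simp add: E_def)
  have "card E \<le> (\<Sum>i\<in>UNIV. card ({s \<in> {1..T}. cell n (x s) i = a i} \<union> {s \<in> {1..T}. cell n (x s) i = b i}))"
    unfolding E_def by (rule card_UN_le) simp
  also have "\<dots> \<le> (\<Sum>i\<in>(UNIV::'d set). r + r)"
    by (intro sum_mono order_trans[OF card_Un_le] add_mono strip) (use ab in \<open>auto intro: order_trans\<close>)
  finally have "card E \<le> 2 * CARD('d) * r"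
    by (simp add: algebra_simps)
  then have card_E: "real (card E) \<le> 2 * real CARD('d) * r"
    by (metis of_nat_le_iff of_nat_mult of_nat_numeral)
  have "\<bar>\<Sum>s=1..t. \<sigma> s * (indicator B (x s) - of_bool (inner s))\<bar>
      \<le> (\<Sum>s=1..t. of_bool (s \<in> E))"
  proof (intro order_trans[OF sum_abs] sum_mono)
    fix s assume s: "s \<in> {1..t}"
    show "\<bar>\<sigma> s * (indicator B (x s) - of_bool (inner s))\<bar> \<le> of_bool (s \<in> E)"
    proof (cases "s \<in> E")
      case True
      have "\<bar>\<sigma> s\<bar> * \<bar>indicator B (x s) - of_bool (inner s)\<bar> \<le> 1 * 1"
        using s t \<sigma> by (intro mult_mono) (auto simp: indicator_def)
      then show ?thesis using True by (simp add: abs_mult)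
    next
      case False
      then have "x s \<in> B \<longleftrightarrow> inner s"
        using cells[of "x s"] s t by (auto simp: E_def inner_def)
      then show ?thesis by (simp add: indicator_def)
    qed
  qed
  also have "\<dots> \<le> card E"
  proof -
    have "(\<Sum>s=1..t. of_bool (s \<in> E) :: real) = card ({1..t} \<inter> E)"
      by (simp add: sum.If_cases of_bool_def if_distrib)
    also have "\<dots> \<le> card E" by (simp add: card_mono)
    finally show ?thesis .
  qed
  finally have "\<bar>\<Sum>s=1..t. \<sigma> s * (indicator B (x s) - of_bool (inner s))\<bar> \<le> 2 * real CARD('d) * r"
    using card_E by linarith
  moreover have "\<bar>\<Sum>s=1..t. \<sigma> s * of_bool (inner s)\<bar> \<le> (2 * real (n + 1)) ^ CARD('d) * l"
    unfolding inner_def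
  proof (intro grid_box_sum_le dyadic ab)
    show "b i < 2 ^ Suc n" for i
      using ab(2)[of i] by (rule le_less_trans) simp
  qed
  moreover have "(\<Sum>s=1..t. \<sigma> s * indicator B (x s))
      = (\<Sum>s=1..t. \<sigma> s * (indicator B (x s) - of_bool (inner s))) + (\<Sum>s=1..t. \<sigma> s * of_bool (inner s))"
    unfolding sum.distrib[symmetric] by (intro sum.cong) (simp_all only: right_diff_distrib diff_add_cancel)
  ultimately show ?thesis
    unfolding disc_def by linarith
qed

section \<open>Measurability\<close>

lemma borel_measurable_vec_nth' [measurable]:
  "(\<lambda>x :: real ^ 'd. x $ i) \<in> borel_measurable borel"
  by (intro borel_measurable_continuous_onI continuous_intros)

text \<open>There are uncountably many boxes, but discrepancy sees only which points a box contains.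
  The smallest box around \<open>S\<close> decides whether \<open>S\<close> is such a trace, and
  this is a finite combination of comparisons of coordinates, hence measurable. The unit bounds
  appear because the sample space is the whole vector space.\<close>

lemma box_trace_iff:
  fixes x :: "nat \<Rightarrow> real ^ 'd"
  assumes "S \<subseteq> N"
  shows "(\<exists>B. axis_parallel_box B \<and> S = {s \<in> N. x s \<in> B}) \<longleftrightarrow>
    (\<forall>s\<in>S. \<forall>i. 0 \<le> x s $ i \<and> x s $ i \<le> 1) \<and>
    (\<forall>u\<in>N - S. \<exists>i. (\<forall>s\<in>S. x u $ i < x s $ i) \<or> (\<forall>s\<in>S. x s $ i < x u $ i))" (is "?L \<longleftrightarrow> ?R")
proof
  assume ?L
  then obtain B I where S: "S = {s \<in> N. x s \<in> B}" and B: "B = {x. \<forall>i. x $ i \<in> I i}"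
    and I: "\<forall>i. is_interval (I i) \<and> I i \<subseteq> {0..1::real}"
    unfolding axis_parallel_box_def by blast
  have sep: "\<exists>i. (\<forall>s\<in>S. x u $ i < x s $ i) \<or> (\<forall>s\<in>S. x s $ i < x u $ i)" if u: "u \<in> N - S" for u
  proof (rule ccontr)
    assume *: "\<not> ?thesis"
    have "x u $ i \<in> I i" for i
    proof -
      obtain s s' where s: "s \<in> S" "s' \<in> S" "x s $ i \<le> x u $ i" "x u $ i \<le> x s' $ i"
        using * by (meson not_le)
      then have "x s $ i \<in> I i" "x s' $ i \<in> I i" using S B by auto
      then show ?thesis using s I unfolding is_interval_1 by blast
    qed
    then show False using u S B by auto
  qed
  have unit: "0 \<le> x s $ i \<and> x s $ i \<le> 1" if "s \<in> S" for s i
  proof -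
    have "x s $ i \<in> I i" using that S B by auto
    then show ?thesis using I by (meson atLeastAtMost_iff subsetD)
  qed
  show ?R by (rule conjI; intro ballI allI sep unit)
next
  assume R: ?R
  \<comment> \<open>The coordinatewise hull of \<open>S\<close>, which is empty for empty
    \<open>S\<close>.\<close>
  define I where "I i = {z. (\<exists>s\<in>S. x s $ i \<le> z) \<and> (\<exists>s\<in>S. z \<le> x s $ i)}" for i
  have "axis_parallel_box {x. \<forall>i. x $ i \<in> I i}"
    unfolding axis_parallel_box_def
  proof (intro exI[of _ I] conjI allI refl)
    show "is_interval (I i)" for i
      unfolding is_interval_1 I_def by (auto intro: order_trans)
    have unit: "0 \<le> x s $ i" "x s $ i \<le> 1" if "s \<in> S" for s i
      using R that by blast+
    show "I i \<subseteq> {0..1}" for i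
      unfolding I_def by (auto intro: order_trans[OF unit(1)] order_trans[OF _ unit(2)])
  qed
  moreover have "S = {s \<in> N. x s \<in> {x. \<forall>i. x $ i \<in> I i}}"
  proof (intro equalityI subsetI)
    fix s assume "s \<in> S"
    then show "s \<in> {s \<in> N. x s \<in> {x. \<forall>i. x $ i \<in> I i}}"
      using assms by (auto simp: I_def)
  next
    fix s assume s: "s \<in> {s \<in> N. x s \<in> {x. \<forall>i. x $ i \<in> I i}}"
    show "s \<in> S"
    proof (rule ccontr)
      assume "s \<notin> S"
      then obtain i where i: "(\<forall>u\<in>S. x s $ i < x u $ i) \<or> (\<forall>u\<in>S. x u $ i < x s $ i)"
        using R s by blast
      have "x s $ i \<in> I i" using s by simp
      then show False using i by (auto simp: I_def not_less[symmetric])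
    qed
  qed
  ultimately show ?L by blast
qed

text \<open>The quantifier over boxes becomes a finite one over traces. A predicate \<open>Q\<close>
  instead of a threshold covers both the strict inequality of the upper bound and the weak one of
  the lower bound.\<close>

lemma sets_ex_box_disc:
  fixes X :: "'w \<Rightarrow> nat \<Rightarrow> real ^ 'd" and \<sigma> :: "'w \<Rightarrow> nat \<Rightarrow> real"
  assumes [measurable]: "\<And>t. t \<in> {1..T} \<Longrightarrow> (\<lambda>w. X w t) \<in> borel_measurable M"
    "\<And>t. t \<in> {1..T} \<Longrightarrow> (\<lambda>w. \<sigma> w t) \<in> borel_measurable M"
    and Q [measurable]: "Measurable.pred borel Q"
  shows "{w \<in> space M. \<exists>B. axis_parallel_box B \<and> Q (MAX t\<in>{1..T}. disc (\<sigma> w) (X w) t B)} \<in> sets M"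
proof -
  let ?D = "\<lambda>S w. MAX t\<in>{1..T}. \<bar>\<Sum>s=1..t. \<sigma> w s * indicator S s\<bar>"
  let ?R = "\<lambda>S w. (\<forall>s\<in>S. \<forall>i. 0 \<le> X w s $ i \<and> X w s $ i \<le> 1) \<and>
    (\<forall>u\<in>{1..T} - S. \<exists>i. (\<forall>s\<in>S. X w u $ i < X w s $ i) \<or> (\<forall>s\<in>S. X w s $ i < X w u $ i))"
  have disc_eq: "disc (\<sigma> w) (X w) t B = \<bar>\<Sum>s=1..t. \<sigma> w s * indicator {s \<in> {1..T}. X w s \<in> B} s\<bar>"
    if "t \<in> {1..T}" for t B w
    unfolding disc_def using that by (intro arg_cong[where f = abs] sum.cong) (auto simp: indicator_def)
  have "(\<exists>B. axis_parallel_box B \<and> Q (MAX t\<in>{1..T}. disc (\<sigma> w) (X w) t B))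
      \<longleftrightarrow> (\<exists>S\<in>Pow {1..T}. ?R S w \<and> Q (?D S w))" for w
  proof
    assume "\<exists>B. axis_parallel_box B \<and> Q (MAX t\<in>{1..T}. disc (\<sigma> w) (X w) t B)"
    then obtain B where B: "axis_parallel_box B" "Q (MAX t\<in>{1..T}. disc (\<sigma> w) (X w) t B)" by blast
    define S where "S = {s \<in> {1..T}. X w s \<in> B}"
    have S: "S \<subseteq> {1..T}" by (auto simp: S_def)
    have "?R S w"
      using box_trace_iff[OF S, of "X w"] B(1) S_def by blast
    moreover have "?D S w = (MAX t\<in>{1..T}. disc (\<sigma> w) (X w) t B)"
      by (intro arg_cong[where f = Max] image_cong refl) (simp add: disc_eq S_def)
    ultimately show "\<exists>S\<in>Pow {1..T}. ?R S w \<and> Q (?D S w)"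
      using B(2) S by (intro bexI[of _ S]) auto
  next
    assume "\<exists>S\<in>Pow {1..T}. ?R S w \<and> Q (?D S w)"
    then obtain S where S: "S \<subseteq> {1..T}" "?R S w" "Q (?D S w)" by blast
    then obtain B where B: "axis_parallel_box B" "S = {s \<in> {1..T}. X w s \<in> B}"
      using box_trace_iff[OF S(1), of "X w"] by blast
    have "?D S w = (MAX t\<in>{1..T}. disc (\<sigma> w) (X w) t B)"
      by (intro arg_cong[where f = Max] image_cong refl) (simp add: disc_eq B(2))
    then show "\<exists>B. axis_parallel_box B \<and> Q (MAX t\<in>{1..T}. disc (\<sigma> w) (X w) t B)"
      using S(3) B(1) by auto
  qed
  moreover have "{w \<in> space M. \<exists>S\<in>Pow {1..T}. ?R S w \<and> Q (?D S w)} \<in> sets M"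
  proof (intro sets.sets_Collect_finite_Ex sets.sets_Collect_conj)
    fix S assume S: "S \<in> Pow {1..T}"
    then have [measurable]: "(\<lambda>w. X w s) \<in> borel_measurable M" if "s \<in> S" for s
      using that assms(1) by blast
    have [simp]: "finite S" using S finite_subset by blast
    show "{w \<in> space M. \<forall>s\<in>S. \<forall>i. 0 \<le> X w s $ i \<and> X w s $ i \<le> 1} \<in> sets M"
      by measurable
    show "{w \<in> space M. \<forall>u\<in>{1..T} - S. \<exists>i. (\<forall>s\<in>S. X w u $ i < X w s $ i) \<or> (\<forall>s\<in>S. X w s $ i < X w u $ i)} \<in> sets M"
      by measurable
    have "?D S \<in> borel_measurable M"
      by (intro borel_measurable_Max borel_measurable_abs borel_measurable_sum borel_measurable_times) auto
    then show "{w \<in> space M. Q (?D S w)} \<in> sets M"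
      by measurable
  qed auto
  ultimately show ?thesis by simp
qed

section \<open>The uniform distribution on the cube\<close>

lemma emeasure_cube: "emeasure lborel (cbox 0 1 :: (real ^ 'd) set) = 1"
proof -
  have "emeasure lborel (cbox 0 1 :: (real ^ 'd) set) = ennreal (measure lborel (cbox 0 1 :: (real ^ 'd) set))"
    by (intro emeasure_eq_ennreal_measure) (auto simp: emeasure_lborel_cbox_eq)
  then show ?thesis
    by (simp add: content_cbox_if_cart interval_eq_empty_cart)
qed

lemma prob_space_uniform_cube: "prob_space uniform_cube"
  unfolding uniform_cube_def by (rule prob_space_uniform_measure) (auto simp: emeasure_cube)

lemma sets_uniform_cube [measurable_cong, simp]: "sets uniform_cube = sets borel"
  by (simp add: uniform_cube_def)

lemma space_uniform_cube [simp]: "space uniform_cube = UNIV"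
  by (simp add: uniform_cube_def)

lemma measure_uniform_cube:
  "A \<in> sets borel \<Longrightarrow> measure uniform_cube A = measure lborel (cbox 0 1 \<inter> A)"
  unfolding uniform_cube_def
  by (subst measure_uniform_measure) (auto simp: emeasure_cube measure_def)

lemma cell_measurable [measurable]: "(\<lambda>x. cell n x i) \<in> borel \<rightarrow>\<^sub>M count_space UNIV"
  unfolding cell_def by measurable

lemma cell_eq_iff:
  assumes "0 \<le> x $ i"
  shows "cell n x i = k \<longleftrightarrow> real k / 2 ^ n \<le> x $ i \<and> x $ i < (real k + 1) / 2 ^ n"
proof -
  have "cell n x i = k \<longleftrightarrow> \<lfloor>2 ^ n * x $ i\<rfloor> = int k"
    using assms by (auto simp: cell_def)
  also have "\<dots> \<longleftrightarrow> real k / 2 ^ n \<le> x $ i \<and> x $ i < (real k + 1) / 2 ^ n"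
    by (simp add: floor_eq_iff field_simps)
  finally show ?thesis .
qed

lemma cell_div:
  assumes "l \<le> n"
  shows "cell n x i div 2 ^ l = cell (n - l) x i"
proof -
  have "cell n x i div 2 ^ l = nat (\<lfloor>2 ^ n * x $ i\<rfloor> div 2 ^ l)"
    by (simp add: cell_def nat_div_distrib' nat_power_eq)
  also have "\<lfloor>2 ^ n * x $ i\<rfloor> div 2 ^ l = \<lfloor>2 ^ n * x $ i / real_of_int (2 ^ l)\<rfloor>"
    by (rule floor_divide_real_eq_div [symmetric]) simp
  also have "2 ^ n * x $ i / real_of_int (2 ^ l) = 2 ^ (n - l) * x $ i"
    using assms by (simp add: power_diff field_simps)
  finally show ?thesis by (simp add: cell_def)
qed

lemma measure_lborel_box_cart:
  fixes a b :: "real ^ 'd"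
  assumes "\<And>i. a $ i \<le> b $ i"
  shows "measure lborel (cbox a b) = (\<Prod>i\<in>UNIV. b $ i - a $ i)"
    and "measure lborel (box a b) = (\<Prod>i\<in>UNIV. b $ i - a $ i)"
proof -
  show *: "measure lborel (cbox a b) = (\<Prod>i\<in>UNIV. b $ i - a $ i)"
    using assms by (subst content_cbox_cart) (auto simp: interval_eq_empty_cart not_less)
  have "a \<bullet> k \<le> b \<bullet> k" if "k \<in> Basis" for k
    using that assms by (auto simp: Basis_vec_def inner_axis)
  then have "measure lborel (box a b) = measure lborel (cbox a b)"
    by (simp add: measure_def)
  then show "measure lborel (box a b) = (\<Prod>i\<in>UNIV. b $ i - a $ i)"
    using * by simp
qed

lemma prob_cells:
  fixes j k :: "'d::finite \<Rightarrow> nat"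
  assumes k: "\<And>i. k i < 2 ^ j i"
  shows "measure uniform_cube {x :: real ^ 'd. (\<forall>i. cell (j i) x i = k i) \<and> x \<in> cbox 0 1} = (\<Prod>i\<in>UNIV. 1 / 2 ^ j i)"
proof -
  define a b :: "real ^ 'd" where "a = (\<chi> i. real (k i) / 2 ^ j i)" and "b = (\<chi> i. (real (k i) + 1) / 2 ^ j i)"
  let ?A = "{x :: real ^ 'd. (\<forall>i. cell (j i) x i = k i) \<and> x \<in> cbox 0 1}"
  have le: "a $ i \<le> b $ i" for i
    by (simp add: a_def b_def divide_right_mono)
  have b1: "b $ i \<le> 1" for i
  proof -
    have "k i + 1 \<le> 2 ^ j i" using k[of i] by simp
    then have "real (k i + 1) \<le> real (2 ^ j i)" by (rule of_nat_mono)
    then show ?thesis by (simp add: b_def field_simps)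
  qed
  have a0: "0 \<le> a $ i" for i by (simp add: a_def)
  have len: "(\<Prod>i\<in>UNIV. b $ i - a $ i) = (\<Prod>i\<in>UNIV. 1 / 2 ^ j i)"
    by (intro prod.cong refl) (simp add: a_def b_def flip: diff_divide_distrib)
  have A: "cbox 0 1 \<inter> ?A = {x. \<forall>i. a $ i \<le> x $ i \<and> x $ i < b $ i}"
  proof (intro set_eqI)
    fix x :: "real ^ 'd"
    show "x \<in> cbox 0 1 \<inter> ?A \<longleftrightarrow> x \<in> {x. \<forall>i. a $ i \<le> x $ i \<and> x $ i < b $ i}"
    proof
      assume "x \<in> cbox 0 1 \<inter> ?A"
      then show "x \<in> {x. \<forall>i. a $ i \<le> x $ i \<and> x $ i < b $ i}"
        by (auto simp: mem_box_cart cell_eq_iff a_def b_def)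
    next
      assume x: "x \<in> {x. \<forall>i. a $ i \<le> x $ i \<and> x $ i < b $ i}"
      then have x01: "0 \<le> x $ i" "x $ i \<le> 1" for i
        using a0[of i] b1[of i] by (auto intro: order_trans less_imp_le)
      then show "x \<in> cbox 0 1 \<inter> ?A"
        using x by (auto simp: mem_box_cart cell_eq_iff a_def b_def)
    qed
  qed
  have sets: "?A \<in> sets borel" by measurable
  \<comment> \<open>The half-open box is squeezed between the closed and the open box with the same
    corners, whose volumes agree.\<close>
  have "measure lborel (cbox 0 1 \<inter> ?A) \<le> measure lborel (cbox a b)"
    unfolding A by (intro measure_mono_fmeasurable) (use sets A in \<open>auto simp: mem_box_cart less_imp_le\<close>)
  moreover have "measure lborel (box a b) \<le> measure lborel (cbox 0 1 \<inter> ?A)"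
  proof (intro measure_mono_fmeasurable)
    show "box a b \<subseteq> cbox 0 1 \<inter> ?A"
      unfolding A by (auto simp: mem_box_cart less_imp_le)
    show "cbox 0 1 \<inter> ?A \<in> fmeasurable lborel"
      using sets by (intro fmeasurable_Int_fmeasurable) auto
  qed auto
  ultimately show ?thesis
    using sets by (simp add: measure_uniform_cube measure_lborel_box_cart le len)
qed

lemma prob_cell_le:
  "measure uniform_cube {x :: real ^ 'd. cell n x i = k} \<le> 1 / 2 ^ n"
proof -
  define a b :: "real ^ 'd" where "a = (\<chi> l. if l = i then real k / 2 ^ n else 0)"
    and "b = (\<chi> l. if l = i then (real k + 1) / 2 ^ n else 1)"
  have "measure uniform_cube {x :: real ^ 'd. cell n x i = k}
      = measure lborel (cbox 0 1 \<inter> {x :: real ^ 'd. cell n x i = k})"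
    by (rule measure_uniform_cube) measurable
  also have "\<dots> \<le> measure lborel (cbox a b)"
  proof (intro measure_mono_fmeasurable)
    show "cbox 0 1 \<inter> {x. cell n x i = k} \<subseteq> cbox a b"
    proof
      fix x :: "real ^ 'd" assume "x \<in> cbox 0 1 \<inter> {x. cell n x i = k}"
      then have x: "\<And>l. 0 \<le> x $ l \<and> x $ l \<le> 1" and "cell n x i = k"
        by (auto simp: mem_box_cart)
      then have "real k / 2 ^ n \<le> x $ i \<and> x $ i \<le> (real k + 1) / 2 ^ n"
        using cell_eq_iff[of x i n k] by simp
      then show "x \<in> cbox a b"
        using x by (simp add: mem_box_cart a_def b_def)
    qed
  qed (auto intro!: sets.Int)
  also have "\<dots> = (\<Prod>l\<in>UNIV. if l = i then 1 / 2 ^ n else 1)"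
  proof (subst measure_lborel_box_cart)
    show "a $ l \<le> b $ l" for l by (simp add: a_def b_def divide_right_mono)
    show "(\<Prod>l\<in>UNIV. b $ l - a $ l) = (\<Prod>l\<in>UNIV. if l = i then 1 / 2 ^ n else 1)"
      by (intro prod.cong) (auto simp: a_def b_def simp flip: diff_divide_distrib)
  qed
  also have "\<dots> = 1 / 2 ^ n"
    by simp
  finally show ?thesis .
qed

section \<open>The upper bound\<close>

lemma abs_walk_sign: "\<bar>real_of_int (walk_sign c \<kappa> f t)\<bar> = 1"
  using walk_sign_cases[of c \<kappa> f t] by auto

definition levels :: "nat \<Rightarrow> ('d::finite \<Rightarrow> nat) set" where
  "levels n = UNIV \<rightarrow>\<^sub>E {..n}"

lemma finite_levels [simp]: "finite (levels n)"
  by (auto simp: levels_def intro: finite_PiE)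

lemma card_levels: "card (levels n :: ('d::finite \<Rightarrow> nat) set) = (n + 1) ^ CARD('d)"
  by (simp add: levels_def card_PiE)

lemma mem_levels_iff: "j \<in> levels n \<longleftrightarrow> (\<forall>i. j i \<le> n)"
  by (auto simp: levels_def PiE_iff)

text \<open>The inner product of the indicator vectors: the number of dyadic boxes containing both
  points, an integer computed from these two points alone. Here \<open>j i\<close> counts levels
  from the finest cells upward.\<close>

definition dyadic_kernel :: "nat \<Rightarrow> (nat \<Rightarrow> real ^ 'd) \<Rightarrow> nat \<Rightarrow> nat \<Rightarrow> int" where
  "dyadic_kernel n x s t =
     int (card {j \<in> levels n. \<forall>i. cell n (x s) i div 2 ^ j i = cell n (x t) i div 2 ^ j i})"

lemma walk_disc_le:
  fixes x :: "nat \<Rightarrow> real ^ 'd"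
  assumes l: "0 \<le> l" and c: "(n + 1) ^ CARD('d) \<le> c"
    and strip: "\<And>i k. k \<le> 2 ^ n \<Longrightarrow> card {s \<in> {1..T}. cell n (x s) i = k} \<le> r"
  shows "card {f \<in> {1..T} \<rightarrow>\<^sub>E {..<2 * c}. \<exists>B. axis_parallel_box B \<and> (\<exists>t\<in>{1..T}.
       (2 * real (n + 1)) ^ CARD('d) * l + 2 * real CARD('d) * r
         < disc (\<lambda>t. real_of_int (walk_sign c (dyadic_kernel n x) f t)) x t B)}
    \<le> (2 * real T * exp (- (c / (2 * real (n + 1) ^ CARD('d))))
        + 2 * real T * (real T * real (n + 1) ^ CARD('d)) * exp (- (l\<^sup>2 / (2 * real c)))) * (2 * c) ^ T"
    (is "real (card ?bad) \<le> _")
proof -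
  \<comment> \<open>\<open>key s j\<close> names the dyadic box of shape \<open>j\<close> around
    point \<open>s\<close>. Only boxes that contain a point become coordinates, so \<open>I\<close>
    is finite, of size at most \<open>T * (n + 1) ^ CARD('d)\<close>; all other boxes have
    discrepancy zero.\<close>
  define key where "key s j = (j, \<lambda>i. cell n (x s) i div 2 ^ j i)" for s :: nat and j :: "'d \<Rightarrow> nat"
  define I where "I = case_prod key ` ({1..T} \<times> levels n)"
  define V :: "nat \<Rightarrow> ('d \<Rightarrow> nat) \<times> ('d \<Rightarrow> nat) \<Rightarrow> real"
    where "V s p = of_bool (\<forall>i. cell n (x s) i div 2 ^ fst p i = snd p i)" for s p
  have fin_I: "finite I" by (simp add: I_def)
  have V_key: "V t (key s j) = of_bool (\<forall>i. cell n (x s) i div 2 ^ j i = cell n (x t) i div 2 ^ j i)" for s t j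
    unfolding V_def key_def fst_conv snd_conv by (intro arg_cong[where f = of_bool] all_cong1) (rule eq_commute)
  have V_zero: "V s p = 0" if "p \<noteq> key s (fst p)" for s p
    using that by (auto simp: V_def key_def prod_eq_iff fun_eq_iff eq_commute[of "snd p _"])
  have kernel: "real_of_int (dyadic_kernel n x s t) = (\<Sum>p\<in>I. V s p * V t p)" if s: "s \<in> {1..T}" for s t
  proof -
    have "(\<Sum>p\<in>I. V s p * V t p) = (\<Sum>p\<in>key s ` levels n. V s p * V t p)"
    proof (rule sum.mono_neutral_right[OF fin_I])
      show "key s ` levels n \<subseteq> I" using s by (force simp: I_def)
      show "\<forall>p\<in>I - key s ` levels n. V s p * V t p = 0"
      proof
        fix p assume p: "p \<in> I - key s ` levels n"
        then have "fst p \<in> levels n" by (auto simp: I_def key_def)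
        then have "p \<noteq> key s (fst p)" using p by blast
        then show "V s p * V t p = 0" using V_zero by simp
      qed
    qed
    also have "\<dots> = (\<Sum>j\<in>levels n. V s (key s j) * V t (key s j))"
      by (subst sum.reindex) (auto simp: inj_on_def key_def)
    also have "\<dots> = (\<Sum>j\<in>levels n. of_bool (\<forall>i. cell n (x s) i div 2 ^ j i = cell n (x t) i div 2 ^ j i))"
      unfolding V_key by simp
    also have "\<dots> = real_of_int (dyadic_kernel n x s t)"
      by (simp add: dyadic_kernel_def Int_def)
    finally show ?thesis ..
  qed
  interpret self_balancing_walk T c "dyadic_kernel n x" I V "real (n + 1) ^ CARD('d)"
  proof
    \<comment> \<open>Each point lies in exactly one box of each shape, so its squared norm is the
      number of shapes.\<close>
    show "(\<Sum>i\<in>I. (V t i)\<^sup>2) \<le> real (n + 1) ^ CARD('d)" if "t \<in> {1..T}" for t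
    proof -
      have "(\<Sum>i\<in>I. (V t i)\<^sup>2) = real_of_int (dyadic_kernel n x t t)"
        unfolding kernel[OF that] power2_eq_square ..
      also have "\<dots> = real (card (levels n :: ('d \<Rightarrow> nat) set))"
        by (simp add: dyadic_kernel_def)
      finally show ?thesis by (simp add: card_levels)
    qed
    show "real (n + 1) ^ CARD('d) \<le> real c"
      using c by (metis of_nat_le_iff of_nat_power)
  qed (auto simp: fin_I kernel)
  have "?bad \<subseteq> {f \<in> seeds. \<exists>t\<in>{1..T}. \<exists>p\<in>I. l < \<bar>pos f t p\<bar>}"
  proof (rule subsetI, rule ccontr)
    fix f assume f: "f \<in> ?bad" and "f \<notin> {f \<in> seeds. \<exists>t\<in>{1..T}. \<exists>p\<in>I. l < \<bar>pos f t p\<bar>}"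
    then have small: "\<bar>pos f t p\<bar> \<le> l" if "t \<in> {1..T}" "p \<in> I" for t p
      using that by (force simp: seeds_def not_less)
    obtain B t where B: "axis_parallel_box B" and t: "t \<in> {1..T}"
      and less: "(2 * real (n + 1)) ^ CARD('d) * l + 2 * real CARD('d) * r
         < disc (\<lambda>t. real_of_int (walk_sign c (dyadic_kernel n x) f t)) x t B"
      using f by blast
    have dyadic: "\<bar>\<Sum>s=1..t. real_of_int (walk_sign c (dyadic_kernel n x) f s)
        * of_bool (\<forall>i. cell n (x s) i div 2 ^ j i = k i)\<bar> \<le> l" if j: "\<And>i. j i \<le> n" for j k
    proof (cases "(j, k) \<in> I")
      case True
      then show ?thesis using small[OF t True] by (simp only: pos_def V_def fst_conv snd_conv)
    next
      case False
      have "\<not> (\<forall>i. cell n (x s) i div 2 ^ j i = k i)" if "s \<in> {1..t}" for s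
      proof
        assume *: "\<forall>i. cell n (x s) i div 2 ^ j i = k i"
        have "(j, k) = key s j" using * by (auto simp: key_def)
        moreover have "j \<in> levels n" using j by (simp add: mem_levels_iff)
        ultimately have "(j, k) \<in> I" using that t by (force simp: I_def)
        then show False using False by simp
      qed
      then have "(\<Sum>s=1..t. real_of_int (walk_sign c (dyadic_kernel n x) f s)
        * of_bool (\<forall>i. cell n (x s) i div 2 ^ j i = k i)) = 0"
        by (intro sum.neutral) simp
      then show ?thesis using l by simp
    qed
    have "disc (\<lambda>t. real_of_int (walk_sign c (dyadic_kernel n x) f t)) x t B
        \<le> (2 * real (n + 1)) ^ CARD('d) * l + 2 * real CARD('d) * r"
      using t by (intro disc_le_dyadic[OF B _ _ dyadic strip]) (simp_all add: abs_walk_sign)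
    then show False using less by simp
  qed
  then have "card ?bad \<le> card {f \<in> seeds. \<exists>t\<in>{1..T}. \<exists>p\<in>I. l < \<bar>pos f t p\<bar>}"
    by (intro card_mono) (auto simp: finite_seeds)
  then have "real (card ?bad) \<le> (2 * real T * exp (- (c / (2 * real (n + 1) ^ CARD('d))))
        + 2 * real T * card I * exp (- (l\<^sup>2 / (2 * real c)))) * card seeds"
    using card_large_coordinate_le[OF l] by linarith
  also have "\<dots> \<le> (2 * real T * exp (- (c / (2 * real (n + 1) ^ CARD('d))))
        + 2 * real T * (real T * real (n + 1) ^ CARD('d)) * exp (- (l\<^sup>2 / (2 * real c)))) * card seeds"
  proof (intro mult_right_mono add_left_mono mult_left_mono)
    have "card I \<le> card ({1..T} \<times> (levels n :: ('d \<Rightarrow> nat) set))"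
      unfolding I_def by (rule card_image_le) simp
    also have "\<dots> = T * (n + 1) ^ CARD('d)"
      by (simp add: card_cartesian_product card_levels)
    finally have "real (card I) \<le> real (T * (n + 1) ^ CARD('d))"
      by (rule of_nat_mono)
    then show "real (card I) \<le> real T * real (n + 1) ^ CARD('d)"
      by simp
  qed auto
  finally show ?thesis by (simp add: card_seeds)
qed

text \<open>Union bound over the direction, the strip and \<open>r\<close> times that fall into it;
  by independence each such event has probability at most \<open>(1 / 2 ^ n) ^ r\<close>.\<close>

lemma prob_strip_le:
  fixes T n r :: nat
  defines "P \<equiv> \<Pi>\<^sub>M s\<in>{1..T}. (uniform_cube :: (real ^ 'd) measure)"
  shows "measure P {x \<in> space P. \<exists>i. \<exists>k\<in>{..2 ^ n}. r \<le> card {s \<in> {1..T}. cell n (x s) i = k}}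
    \<le> CARD('d) * (2 ^ n + 1) * real T ^ r * (1 / 2 ^ n) ^ r" (is "measure P ?Z \<le> _")
proof -
  interpret U: prob_space "uniform_cube :: (real ^ 'd) measure" by (rule prob_space_uniform_cube)
  interpret product_prob_space "\<lambda>_. uniform_cube :: (real ^ 'd) measure" "{1..T}" ..
  let ?J = "{J. J \<subseteq> {1..T} \<and> card J = r}"
  let ?E = "\<lambda>(i, k, J). {x \<in> space P. \<forall>s\<in>J. x s \<in> {x. cell n x i = k}}"
  let ?I = "(UNIV :: 'd set) \<times> {..(2::nat) ^ n} \<times> ?J"
  have finJ: "finite ?J" by (rule finite_subset[of _ "Pow {1..T}"]) auto
  have E_sets: "?E p \<in> sets P" if pI: "p \<in> ?I" for p
  proof -
    obtain i k J where p: "p = (i, k, J)" and J: "J \<subseteq> {1..T}" using pI by auto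
    have [simp]: "finite J" using J finite_subset by blast
    have [measurable]: "(\<lambda>x. x s) \<in> P \<rightarrow>\<^sub>M borel" if "s \<in> J" for s
      using measurable_component_singleton[of s "{1..T}" "\<lambda>_. uniform_cube :: (real ^ 'd) measure"] that J
      unfolding P_def by (auto cong: measurable_cong_sets)
    show ?thesis unfolding p by simp measurable
  qed
  have E_prob: "measure P (?E p) \<le> (1 / 2 ^ n) ^ r" if pI: "p \<in> ?I" for p
  proof -
    obtain i k J where p: "p = (i, k, J)" and J: "J \<subseteq> {1..T}" "card J = r" using pI by auto
    have "emeasure P (?E p) = (\<Prod>s\<in>J. emeasure uniform_cube {x :: real ^ 'd. cell n x i = k})"
      unfolding p P_def prod.case using J by (intro emeasure_PiM_Collect) (auto intro: finite_subset)
    also have "\<dots> = ennreal (measure uniform_cube {x :: real ^ 'd. cell n x i = k} ^ r)"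
      using J by (simp add: U.emeasure_eq_measure ennreal_power)
    finally have "measure P (?E p) = measure uniform_cube {x :: real ^ 'd. cell n x i = k} ^ r"
      by (simp add: measure_def)
    also have "\<dots> \<le> (1 / 2 ^ n) ^ r"
      by (intro power_mono prob_cell_le) simp
    finally show ?thesis .
  qed
  have "?Z \<subseteq> (\<Union>p\<in>?I. ?E p)"
  proof
    fix x assume x: "x \<in> ?Z"
    then obtain i k where k: "k \<le> 2 ^ n" and r: "r \<le> card {s \<in> {1..T}. cell n (x s) i = k}" by auto
    then obtain J where "J \<subseteq> {s \<in> {1..T}. cell n (x s) i = k}" "card J = r"
      using obtain_subset_with_card_n[OF r] by blast
    then show "x \<in> (\<Union>p\<in>?I. ?E p)"
      using x k by (intro UN_I[of "(i, k, J)"]) auto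
  qed
  then have "measure P ?Z \<le> measure P (\<Union>p\<in>?I. ?E p)"
    using E_sets finJ unfolding P_def by (intro P.finite_measure_mono sets.finite_UN) auto
  also have "\<dots> \<le> (\<Sum>p\<in>?I. measure P (?E p))"
    using finJ E_sets by (intro measure_UNION_le) auto
  also have "\<dots> \<le> (\<Sum>p\<in>?I. (1 / 2 ^ n) ^ r)"
    by (intro sum_mono E_prob)
  also have "\<dots> = CARD('d) * (2 ^ n + 1) * real (T choose r) * (1 / 2 ^ n) ^ r"
    using n_subsets[of "{1..T}" r] by (simp add: card_cartesian_product algebra_simps)
  also have "\<dots> \<le> CARD('d) * (2 ^ n + 1) * real T ^ r * (1 / 2 ^ n) ^ r"
  proof -
    have "T choose r \<le> T ^ r"
      by (cases "r \<le> T") (auto simp: binomial_le_pow binomial_eq_0)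
    then have "real (T choose r) \<le> real T ^ r"
      by (metis of_nat_le_iff of_nat_power)
    then show ?thesis by (intro mult_right_mono mult_left_mono) auto
  qed
  finally show ?thesis .
qed

text \<open>Fubini with the points outermost: outside the exceptional set \<open>Z\<close> the seed
  is the only randomness left, so a counting bound for each fixed input suffices.\<close>

lemma measure_pair_le:
  assumes "prob_space R" "prob_space P" and A: "A \<in> sets (R \<Otimes>\<^sub>M P)" and Z: "Z \<in> sets P"
    and le: "\<And>x. x \<in> space P - Z \<Longrightarrow> measure R {r \<in> space R. (r, x) \<in> A} \<le> \<delta>" and "0 \<le> \<delta>"
  shows "measure (R \<Otimes>\<^sub>M P) A \<le> measure P Z + \<delta>"
proof -
  interpret R: prob_space R by fact
  interpret Q: prob_space P by fact
  interpret pair_prob_space R P ..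
  have "emeasure (R \<Otimes>\<^sub>M P) A = (\<integral>\<^sup>+x. emeasure R ((\<lambda>r. (r, x)) -` A) \<partial>P)"
    by (rule emeasure_pair_measure_alt2[OF A])
  also have "\<dots> \<le> (\<integral>\<^sup>+x. indicator Z x + ennreal \<delta> \<partial>P)"
  proof (intro nn_integral_mono)
    fix x assume x: "x \<in> space P"
    have eq: "(\<lambda>r. (r, x)) -` A = {r \<in> space R. (r, x) \<in> A}"
      using sets.sets_into_space[OF A] by (auto simp: space_pair_measure)
    show "emeasure R ((\<lambda>r. (r, x)) -` A) \<le> indicator Z x + ennreal \<delta>"
    proof (cases "x \<in> Z")
      case True
      have "emeasure R ((\<lambda>r. (r, x)) -` A) \<le> 1" by (rule R.emeasure_le_1)
      also have "\<dots> \<le> indicator Z x + ennreal \<delta>" using True by simp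
      finally show ?thesis .
    next
      case False
      then show ?thesis
        unfolding eq R.emeasure_eq_measure using le[of x] x by (simp add: ennreal_leI)
    qed
  qed
  also have "\<dots> = emeasure P Z + ennreal \<delta>"
    using Z by (subst nn_integral_add) (auto simp: Q.emeasure_space_1)
  also have "\<dots> = ennreal (measure P Z + \<delta>)"
    using \<open>0 \<le> \<delta>\<close> by (simp add: Q.emeasure_eq_measure ennreal_plus)
  finally show ?thesis
    using \<open>0 \<le> \<delta>\<close> by (simp add: emeasure_eq_measure ennreal_le_iff del: ennreal_plus)
qed

section \<open>Choice of scales and the failure probabilities\<close>

definition resolution :: "nat \<Rightarrow> nat" where
  "resolution T = 2 * nat \<lceil>log 2 (real T)\<rceil>"

text \<open>A cell side of at most \<open>1 / T\<^sup>2\<close> makes each further point in a strip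
  cost a factor \<open>1 / T\<close>, while the number of levels stays of order
  \<open>log T\<close>.\<close>

lemma resolution_bounds:
  assumes "2 \<le> T"
  shows "(real T)\<^sup>2 \<le> 2 ^ resolution T"
    and "2 * log 2 (real T) \<le> real (resolution T + 1)"
    and "real (resolution T + 1) \<le> 5 * log 2 (real T)"
proof -
  define h where "h = nat \<lceil>log 2 (real T)\<rceil>"
  have log: "1 \<le> log 2 (real T)" using assms by simp
  then have h: "real h = of_int \<lceil>log 2 (real T)\<rceil>" by (simp add: h_def)
  have h_ge: "log 2 (real T) \<le> real h" and h_le: "real h \<le> log 2 (real T) + 1"
    unfolding h using le_of_int_ceiling of_int_ceiling_le_add_one by auto
  have "real T \<le> 2 powr real h"
    using h_ge assms by (simp add: log_le_iff)
  then have "real T \<le> 2 ^ h" by (simp add: powr_realpow)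
  then have "(real T)\<^sup>2 \<le> (2 ^ h)\<^sup>2" by (intro power_mono) auto
  then show "(real T)\<^sup>2 \<le> 2 ^ resolution T"
    by (simp add: resolution_def h_def power_mult[symmetric] mult.commute)
  show "2 * log 2 (real T) \<le> real (resolution T + 1)"
    using h_ge by (simp add: resolution_def flip: h_def)
  \<comment> \<open>\<open>2 * (log T + 1) + 1 \<le> 5 * log T\<close> because
    \<open>log T \<ge> 1\<close>.\<close>
  show "real (resolution T + 1) \<le> 5 * log 2 (real T)"
    using h_le log by (simp add: resolution_def flip: h_def)
qed

lemma exp_le_powr:
  assumes "2 \<le> T" "0 \<le> z" "log 2 (real T) * z \<le> y"
  shows "exp (- y) \<le> real T powr (- z)"
proof -
  have "ln (real T) \<le> log 2 (real T)"
    using assms ln_2_less_1 by (simp add: log_def field_simps mult_left_le)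
  then have "ln (real T) * z \<le> y"
    using assms by (meson mult_right_mono order_trans)
  then show ?thesis
    using assms by (simp add: powr_def mult.commute)
qed

lemma of_nat_power_mult_powr:
  "0 < T \<Longrightarrow> real T ^ a * real T powr b = real T powr (real a + b)"
  by (simp add: powr_add powr_realpow)

text \<open>With \<open>c = L ^ (d + 2)\<close> and \<open>M = L ^ d\<close> the exponent is
  \<open>L\<^sup>2 / 2\<close>, quadratic in \<open>log T\<close>, so it beats
  \<open>(k + 4) * log T\<close> once \<open>log T \<ge> k + 4\<close>. Two powers of
  \<open>T\<close> absorb the factor \<open>2 * T\<close>.\<close>

lemma walk_failure_le:
  assumes "2 \<le> T" "0 < k" "k + 4 \<le> log 2 (real T)" "2 * log 2 (real T) \<le> L"
  shows "2 * real T * exp (- (L ^ (d + 2) / (2 * L ^ d))) \<le> real T powr (- (k + 2))"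
proof -
  have l: "1 \<le> log 2 (real T)" using assms by simp
  then have L: "0 < L" using assms by linarith
  have "log 2 (real T) * (k + 4) \<le> log 2 (real T) * (2 * log 2 (real T))"
    using assms l by (intro mult_left_mono) auto
  also have "\<dots> \<le> (2 * log 2 (real T))\<^sup>2 / 2" by (simp add: power2_eq_square)
  also have "\<dots> \<le> L\<^sup>2 / 2"
    using assms l by (intro divide_right_mono power_mono) auto
  also have "\<dots> = L ^ (d + 2) / (2 * L ^ d)"
    using L by (simp add: power_add power2_eq_square)
  finally have "exp (- (L ^ (d + 2) / (2 * L ^ d))) \<le> real T powr (- (k + 4))"
    using assms by (intro exp_le_powr) auto
  then have "2 * real T * exp (- (L ^ (d + 2) / (2 * L ^ d))) \<le> real T ^ 2 * real T powr (- (k + 4))"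
    using assms by (intro mult_mono) (auto simp: power2_eq_square)
  also have "\<dots> = real T powr (real 2 + - (k + 4))"
    using assms by (intro of_nat_power_mult_powr) simp
  also have "real 2 + - (k + 4) = - (k + 2)" by simp
  finally show ?thesis .
qed

text \<open>The exponent is \<open>K\<^sup>2 / 2 * L ^ d\<close>, at least
  \<open>(d + k + 5) * L\<close>. The part \<open>d * L\<close> pays for the \<open>L ^ d\<close>
  shapes, the rest for powers of \<open>T\<close>, with
  \<open>2 * T * T \<le> T ^ 3\<close>.\<close>

lemma coordinate_failure_le:
  assumes "2 \<le> T" "0 < k" "2 * log 2 (real T) \<le> L" "K\<^sup>2 = 2 * (real d + k + 5)" "1 \<le> d"
  shows "2 * real T * (real T * L ^ d) * exp (- ((K * L ^ (d + 1))\<^sup>2 / (2 * L ^ (d + 2))))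
    \<le> real T powr (- (k + 2))"
proof -
  have l: "1 \<le> log 2 (real T)" using assms by simp
  then have L: "1 \<le> L" "log 2 (real T) \<le> L" using assms by linarith+
  have "(K * L ^ (d + 1))\<^sup>2 / (2 * L ^ (d + 2)) = K\<^sup>2 / 2 * L ^ d"
  proof -
    have "(L ^ (d + 1))\<^sup>2 = L ^ d * L ^ (d + 2)" by (simp add: power2_eq_square algebra_simps)
    then show ?thesis using L by (simp add: power_mult_distrib)
  qed
  also have "\<dots> \<ge> K\<^sup>2 / 2 * L"
    using L assms(5) by (intro mult_left_mono self_le_power) auto
  also have "K\<^sup>2 / 2 * L = real d * L + (k + 5) * L"
    unfolding assms(4) by (simp add: algebra_simps)
  finally have "exp (- ((K * L ^ (d + 1))\<^sup>2 / (2 * L ^ (d + 2)))) \<le> exp (- (real d * L)) * exp (- ((k + 5) * L))"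
    by (simp flip: exp_add)
  then have "L ^ d * exp (- ((K * L ^ (d + 1))\<^sup>2 / (2 * L ^ (d + 2))))
      \<le> exp L ^ d * (exp (- (real d * L)) * exp (- ((k + 5) * L)))"
  proof (intro mult_mono power_mono)
    show "L \<le> exp L" using exp_ge_add_one_self[of L] by linarith
  qed (use L in auto)
  also have "\<dots> = exp (- ((k + 5) * L))"
    by (simp flip: exp_add exp_of_nat_mult)
  also have "\<dots> \<le> real T powr (- (k + 5))"
    using L assms by (intro exp_le_powr) (auto simp: mult.commute mult_left_mono)
  finally have "2 * real T * (real T * (L ^ d * exp (- ((K * L ^ (d + 1))\<^sup>2 / (2 * L ^ (d + 2))))))
      \<le> (real T * real T) * (real T * real T powr (- (k + 5)))"
    using assms L by (intro mult_mono) auto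
  also have "\<dots> = real T ^ 3 * real T powr (- (k + 5))"
    by (simp add: power3_eq_cube)
  also have "\<dots> = real T powr (real 3 + - (k + 5))"
    using assms by (intro of_nat_power_mult_powr) simp
  also have "real 3 + - (k + 5) = - (k + 2)" by simp
  finally show ?thesis by (simp only: mult.assoc)
qed

text \<open>One of the \<open>r\<close> factors \<open>1 / 2 ^ n\<close> is spent on the number of
  strips, and \<open>T ^ (d + 1)\<close> covers \<open>2 * d\<close>. What remains is the power
  \<open>d + 1 + r - 2 * (r - 1) = d + 3 - r\<close> of \<open>T\<close>, which dictates
  \<open>r\<close>.\<close>

lemma strip_failure_le:
  assumes "2 \<le> T" "0 < k" "(real T)\<^sup>2 \<le> 2 ^ n" "r = nat \<lceil>k\<rceil> + d + 5"
  shows "real d * (2 ^ n + 1) * real T ^ r * (1 / 2 ^ n) ^ r \<le> real T powr (- (k + 2))"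
proof -
  define q where "q = r - 1"
  have r: "r = Suc q" using assms by (simp add: q_def)
  have "real d * (2 ^ n + 1) * real T ^ r * (1 / 2 ^ n) ^ r
      = real d * ((2 ^ n + 1) / 2 ^ n) * real T ^ r / (2 ^ n) ^ q"
    by (simp add: r power_divide)
  also have "\<dots> \<le> real d * 2 * real T ^ r / ((real T)\<^sup>2) ^ q"
    using assms by (intro frac_le mult_mono mult_nonneg_nonneg power_mono) (auto simp: field_simps)
  also have "real d * 2 \<le> real T ^ (d + 1)"
  proof -
    have "d < 2 ^ d" by (rule less_exp)
    then have "d * 2 \<le> 2 ^ (d + 1)" by simp
    also have "\<dots> \<le> T ^ (d + 1)" using assms by (intro power_mono) auto
    finally have "real (d * 2) \<le> real (T ^ (d + 1))" by (rule of_nat_mono)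
    then show ?thesis by simp
  qed
  finally have "real d * (2 ^ n + 1) * real T ^ r * (1 / 2 ^ n) ^ r
      \<le> real T ^ (d + 1) * real T ^ r / ((real T)\<^sup>2) ^ q"
    by (simp add: divide_right_mono mult_right_mono)
  also have "\<dots> = real T powr (real (d + 1) + real r - real (2 * q))"
  proof -
    have "real T ^ m = real T powr real m" for m
      using assms by (simp add: powr_realpow)
    then show ?thesis unfolding power_mult[symmetric] powr_add powr_diff by (simp only:)
  qed
  also have "\<dots> \<le> real T powr (- (k + 2))"
  proof (intro powr_mono)
    have "k \<le> real (nat \<lceil>k\<rceil>)" using assms by linarith
    then show "real (d + 1) + real r - real (2 * q) \<le> - (k + 2)"
      using assms(4) by (simp add: q_def)
  qed (use assms in auto)
  finally show ?thesis .
qed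

section \<open>Seeds as reals and measurability of the walk\<close>

lemma ex_real_code:
  assumes "finite A"
  shows "\<exists>S (dec :: real \<Rightarrow> 'a). finite S \<and> bij_betw dec S A"
proof -
  obtain h where h: "bij_betw h {0..<card A} A"
    using ex_bij_betw_nat_finite[OF assms] by blast
  have "bij_betw (\<lambda>r. nat \<lfloor>r\<rfloor>) (real ` {0..<card A}) {0..<card A}"
    by (rule bij_betw_byWitness[where f' = real]) auto
  from bij_betw_trans[OF this h] show ?thesis by blast
qed

lemma measurable_pm_one:
  fixes f :: "'a \<Rightarrow> real"
  assumes [measurable]: "f \<in> borel_measurable M" and "\<And>x. f x \<in> {-1, 1}"
  shows "f \<in> M \<rightarrow>\<^sub>M count_space {-1, 1}"
proof (subst measurable_count_space_eq2)
  show "f \<in> space M \<rightarrow> {-1, 1} \<and> (\<forall>a\<in>{-1, 1}. f -` {a} \<inter> space M \<in> sets M)"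
    using assms by (auto intro!: measurable_sets)
qed simp

lemma borel_measurable_walk_sign:
  fixes N :: "nat set" and f :: "nat \<Rightarrow> nat"
  assumes "1 \<le> t" "{1..t} \<subseteq> N"
  shows "(\<lambda>x. real_of_int (walk_sign c (dyadic_kernel n x) f t))
    \<in> borel_measurable (\<Pi>\<^sub>M s\<in>N. (uniform_cube :: (real ^ 'd) measure))"
  using assms
proof (induction t rule: less_induct)
  case (less t)
  let ?P = "\<Pi>\<^sub>M s\<in>N. (uniform_cube :: (real ^ 'd) measure)"
  have [measurable]: "(\<lambda>x. x s) \<in> ?P \<rightarrow>\<^sub>M borel" if "s \<in> {1..t}" for s
    using measurable_component_singleton[of s N "\<lambda>_. uniform_cube :: (real ^ 'd) measure"] that less.prems
    by (auto cong: measurable_cong_sets)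
  have kernel: "(\<lambda>x. real_of_int (dyadic_kernel n x s t)) \<in> borel_measurable ?P" if s: "s \<in> {1..<t}" for s
  proof -
    have [measurable]: "(\<lambda>x. x s) \<in> ?P \<rightarrow>\<^sub>M borel" "(\<lambda>x. x t) \<in> ?P \<rightarrow>\<^sub>M borel"
      using s by auto
    have eq: "(\<lambda>x :: nat \<Rightarrow> real ^ 'd. real_of_int (dyadic_kernel n x s t)) = (\<lambda>x. \<Sum>j\<in>levels n.
        if \<forall>i. cell n (x s) i div 2 ^ j i = cell n (x t) i div 2 ^ j i then 1 else 0)"
      by (simp add: dyadic_kernel_def Int_def flip: sum.inter_filter)
    show ?thesis unfolding eq by measurable
  qed
  have [measurable]: "(\<lambda>x. \<Sum>s\<in>{1..<t}. real_of_int (walk_sign c (dyadic_kernel n x) f s)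
      * real_of_int (dyadic_kernel n x s t)) \<in> borel_measurable ?P"
    using less.prems by (intro borel_measurable_sum borel_measurable_times less.IH kernel) auto
  have eq: "real_of_int (walk_sign c (dyadic_kernel n x) f t) =
      (if real (f t) < real c - (\<Sum>s\<in>{1..<t}. real_of_int (walk_sign c (dyadic_kernel n x) f s)
      * real_of_int (dyadic_kernel n x s t)) then 1 else - 1)" for x :: "nat \<Rightarrow> real ^ 'd"
  proof -
    have "int (f t) < int c - m \<longleftrightarrow> real (f t) < real c - real_of_int m" for m
      by linarith
    then show ?thesis by (subst walk_sign.simps) simp
  qed
  show ?case unfolding eq by measurable
qed

lemma borel_measurable_signing:
  fixes A :: "nat \<Rightarrow> real \<times> (nat \<Rightarrow> real ^ 'd) \<Rightarrow> real"
  assumes "online_algorithm T R A" "t \<in> {1..T}"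
  shows "(\<lambda>w. signing A (fst w) (snd w) t) \<in> borel_measurable (random_input T R)"
    and "\<And>w. w \<in> space (random_input T R) \<Longrightarrow> signing A (fst w) (snd w) t \<in> {-1, 1}"
proof -
  have [measurable]: "A t \<in> R \<Otimes>\<^sub>M (\<Pi>\<^sub>M s\<in>{1..t}. (uniform_cube :: (real ^ 'd) measure)) \<rightarrow>\<^sub>M count_space {-1, 1}"
    using assms unfolding online_algorithm_def by blast
  have sub: "{1..t} \<subseteq> {1..T}" using assms by auto
  have [measurable]: "(\<lambda>x. restrict x {1..t}) \<in> (\<Pi>\<^sub>M s\<in>{1..T}. (uniform_cube :: (real ^ 'd) measure))
      \<rightarrow>\<^sub>M (\<Pi>\<^sub>M s\<in>{1..t}. uniform_cube)"
    by (rule measurable_restrict_subset[OF sub])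
  have *: "(\<lambda>w. signing A (fst w) (snd w) t) \<in> random_input T R \<rightarrow>\<^sub>M count_space {-1, 1}"
    unfolding signing_def random_input_def by measurable
  from measurable_compose[OF this, of "\<lambda>x. x" borel]
  show "(\<lambda>w. signing A (fst w) (snd w) t) \<in> borel_measurable (random_input T R)" by simp
  show "signing A (fst w) (snd w) t \<in> {-1, 1}" if "w \<in> space (random_input T R)" for w
    using measurable_space[OF * that] by simp
qed

lemma sets_ex_box_disc_random_input:
  fixes A :: "nat \<Rightarrow> real \<times> (nat \<Rightarrow> real ^ 'd) \<Rightarrow> real"
  assumes "online_algorithm T R A" "Measurable.pred borel Q"
  shows "{w \<in> space (random_input T R). \<exists>B. axis_parallel_box B \<and>
    Q (MAX t\<in>{1..T}. disc (signing A (fst w) (snd w)) (snd w) t B)} \<in> sets (random_input T R)"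
proof (rule sets_ex_box_disc)
  fix t assume t: "t \<in> {1..T}"
  show "(\<lambda>w. signing A (fst w) (snd w) t) \<in> borel_measurable (random_input T R)"
    by (rule borel_measurable_signing[OF assms(1) t])
  have *: "(\<lambda>x. x t) \<in> (\<Pi>\<^sub>M s\<in>{1..T}. (uniform_cube :: (real ^ 'd) measure)) \<rightarrow>\<^sub>M borel"
    using measurable_component_singleton[of t "{1..T}" "\<lambda>_. uniform_cube :: (real ^ 'd) measure"] t
    by (auto cong: measurable_cong_sets)
  show "(\<lambda>w. snd w t :: real ^ 'd) \<in> borel_measurable (random_input T R)"
    unfolding random_input_def by (rule measurable_compose[OF measurable_snd *])
qed fact

text \<open>This trivial bound settles the bounded range \<open>log T < k + 4\<close>, where the
  walk estimate is not yet polynomially small.\<close>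

lemma disc_le_time:
  assumes "\<And>s. s \<in> {1..t} \<Longrightarrow> \<bar>\<sigma> s\<bar> \<le> 1"
  shows "disc \<sigma> x t B \<le> t"
proof -
  have "disc \<sigma> x t B \<le> (\<Sum>s=1..t. \<bar>\<sigma> s * indicator B (x s)\<bar>)"
    unfolding disc_def by (rule sum_abs)
  also have "\<dots> \<le> (\<Sum>s=1..t. 1)"
    using assms by (intro sum_mono) (auto simp: abs_mult indicator_def)
  finally show ?thesis by simp
qed

lemma prob_space_random_input:
  assumes "prob_space R"
  shows "prob_space (random_input T R :: (real \<times> (nat \<Rightarrow> real ^ 'd)) measure)"
proof -
  interpret R: prob_space R by fact
  interpret Q: prob_space "\<Pi>\<^sub>M s\<in>{1..T}. (uniform_cube :: (real ^ 'd) measure)"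
    by (intro prob_space_PiM prob_space_uniform_cube)
  interpret pair_prob_space R "\<Pi>\<^sub>M s\<in>{1..T}. (uniform_cube :: (real ^ 'd) measure)" ..
  show ?thesis unfolding random_input_def by (rule prob_space_axioms)
qed

theorem online_disc_upper_bound:
  "\<exists>(R :: nat \<Rightarrow> real measure) (A :: nat \<Rightarrow> nat \<Rightarrow> real \<times> (nat \<Rightarrow> real ^ 'd) \<Rightarrow> real).
     (\<forall>T. online_algorithm T (R T) (A T)) \<and>
     (\<forall>k>0. \<exists>C>0. \<forall>T\<ge>2.
        \<P>((r, x) in random_input T (R T).
           \<forall>B. axis_parallel_box B \<longrightarrow>
             (MAX t\<in>{1..T}. disc (signing (A T) r x) x t B)
               \<le> C * log 2 (real T) ^ (2 * CARD('d) + 1))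
        \<ge> 1 - real T powr (- k))"
proof -
  let ?d = "CARD('d)"
  \<comment> \<open>No \<open>k\<close> enters \<open>c\<close>: failure of tameness is
    superpolynomially rare, and all dependence on the failure rate goes into \<open>K\<close>,
    \<open>r\<close> and \<open>C\<close> below.\<close>
  define c where "c T = (resolution T + 1) ^ (?d + 2)" for T
  define seeds where "seeds T = {1..T} \<rightarrow>\<^sub>E {..<2 * c T}" for T
  have c_pos: "0 < c T" for T by (simp add: c_def)
  have fin_seeds: "finite (seeds T)" for T
    by (auto simp: seeds_def intro: finite_PiE)
  have card_seeds: "card (seeds T) = (2 * c T) ^ T" for T
    by (simp add: seeds_def card_PiE)
  \<comment> \<open>The seed of an online algorithm is a real number, so the finitely many walk
    seeds are coded by reals; the uniform law on the codes turns probabilities into the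
    cardinalities bounded above.\<close>
  have "\<forall>T. \<exists>S (dec :: real \<Rightarrow> _). finite S \<and> bij_betw dec S (seeds T)"
    using ex_real_code[OF fin_seeds] by (rule allI)
  then obtain S dec where S: "\<And>T. finite (S T)"
    and dec: "\<And>T. bij_betw (dec T :: real \<Rightarrow> nat \<Rightarrow> nat) (S T) (seeds T)"
    unfolding choice_iff by (elim exE) auto
  have card_S: "card (S T) = (2 * c T) ^ T" for T
    using bij_betw_same_card[OF dec, of T] card_seeds by simp
  have S_ne: "S T \<noteq> {}" for T
    using card_S[of T] c_pos[of T] by (intro notI) simp
  define R where "R T = uniform_count_measure (S T)" for T
  define A :: "nat \<Rightarrow> nat \<Rightarrow> real \<times> (nat \<Rightarrow> real ^ 'd) \<Rightarrow> real"
    where "A T t = (\<lambda>(r, x). real_of_int (walk_sign (c T) (dyadic_kernel (resolution T) x) (dec T r) t))" for T t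
  have prob_R: "prob_space (R T)" for T
    unfolding R_def by (intro prob_space_uniform_count_measure S S_ne)
  have online: "online_algorithm T (R T) (A T)" for T
    unfolding online_algorithm_def
  proof (intro conjI ballI prob_R)
    fix t assume t: "t \<in> {1..T}"
    let ?P = "\<Pi>\<^sub>M s\<in>{1..t}. (uniform_cube :: (real ^ 'd) measure)"
    \<comment> \<open>The seed space is countable and discrete, so joint measurability reduces to
      measurability in the points for each fixed seed.\<close>
    have "A T t \<in> count_space (S T) \<Otimes>\<^sub>M ?P \<rightarrow>\<^sub>M count_space {-1, 1}"
    proof (rule measurable_pair_measure_countable1)
      show "countable (S T)" using S by (rule countable_finite)
      show "(\<lambda>x. A T t (r, x)) \<in> ?P \<rightarrow>\<^sub>M count_space {-1, 1}" for r
      proof (rule measurable_pm_one)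
        show "A T t (r, x) \<in> {- 1, 1}" for x
          using walk_sign_cases[of "c T" "dyadic_kernel (resolution T) x" "dec T r" t] by (auto simp: A_def)
        show "(\<lambda>x. A T t (r, x)) \<in> borel_measurable ?P"
          unfolding A_def prod.case using t by (intro borel_measurable_walk_sign) auto
      qed
    qed
    moreover have "sets (R T \<Otimes>\<^sub>M ?P) = sets (count_space (S T) \<Otimes>\<^sub>M ?P)"
      unfolding R_def by (intro sets_pair_measure_cong sets_uniform_count_measure_count_space refl)
    ultimately show "A T t \<in> R T \<Otimes>\<^sub>M ?P \<rightarrow>\<^sub>M count_space {-1, 1}"
      using measurable_cong_sets by blast
  qed
  have signing_eq: "signing (A T) r x t
      = real_of_int (walk_sign (c T) (dyadic_kernel (resolution T) x) (dec T r) t)" if "1 \<le> t" for T r x t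
    unfolding signing_def A_def prod.case using that
    by (intro arg_cong[where f = real_of_int] walk_sign_cong) (auto simp: dyadic_kernel_def)
  have main: "\<exists>C>0. \<forall>T\<ge>2.
      \<P>((r, x) in random_input T (R T). \<forall>B. axis_parallel_box B \<longrightarrow>
          (MAX t\<in>{1..T}. disc (signing (A T) r x) x t B) \<le> C * log 2 (real T) ^ (2 * ?d + 1))
      \<ge> 1 - real T powr (- k)" if k: "0 < k" for k :: real
  proof -
    define r where "r = nat \<lceil>k\<rceil> + ?d + 5"
    define K where "K = sqrt (2 * (real ?d + k + 5))"
    have K: "0 \<le> K" "K\<^sup>2 = 2 * (real ?d + k + 5)"
      using k by (auto simp: K_def)
    \<comment> \<open>The first summand comes from \<open>(2 * L) ^ ?d * l + 2 * ?d * r\<close> and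
      \<open>L \<le> 5 * log T\<close>; the second exceeds every \<open>T\<close> with
      \<open>log T < k + 4\<close>.\<close>
    define C where "C = (2 ^ ?d * K + 2 * real ?d * r) * 5 ^ (2 * ?d + 1) + 2 powr (k + 4)"
    have C_pos: "0 < C" using K by (auto simp: C_def intro!: add_nonneg_pos)
    have "1 - real T powr (- k) \<le> \<P>((r, x) in random_input T (R T). \<forall>B. axis_parallel_box B \<longrightarrow>
          (MAX t\<in>{1..T}. disc (signing (A T) r x) x t B) \<le> C * log 2 (real T) ^ (2 * ?d + 1))"
      if T: "2 \<le> T" for T
    proof -
      let ?P = "\<Pi>\<^sub>M s\<in>{1..T}. (uniform_cube :: (real ^ 'd) measure)"
      define D where "D = C * log 2 (real T) ^ (2 * ?d + 1)"
      define \<Omega> where "\<Omega> = (random_input T (R T) :: (real \<times> (nat \<Rightarrow> real ^ 'd)) measure)"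
      define bad where "bad = {w \<in> space \<Omega>. \<exists>B. axis_parallel_box B \<and>
          D < (MAX t\<in>{1..T}. disc (signing (A T) (fst w) (snd w)) (snd w) t B)}"
      have bad_iff: "D < (MAX t\<in>{1..T}. disc \<sigma> x t B) \<longleftrightarrow> (\<exists>t\<in>{1..T}. D < disc \<sigma> x t B)"
        for \<sigma> and x :: "nat \<Rightarrow> real ^ 'd" and B
        using T by (subst Max_gr_iff) auto
      interpret \<Omega>: prob_space \<Omega>
        unfolding \<Omega>_def by (rule prob_space_random_input[OF prob_R])
      have bad_sets: "bad \<in> sets \<Omega>"
        unfolding bad_def \<Omega>_def by (rule sets_ex_box_disc_random_input[OF online]) simp
      have l: "1 \<le> log 2 (real T)" using T by simp
      have "measure \<Omega> bad \<le> real T powr (- k)"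
      proof (cases "log 2 (real T) < k + 4")
        case True
        have "real T \<le> 2 powr (k + 4)"
          using True T by (simp add: log_less_iff)
        also have "\<dots> \<le> C" using K by (simp add: C_def)
        also have "\<dots> \<le> D"
          unfolding D_def using C_pos mult_left_mono[OF one_le_power[OF l], of C "2 * ?d + 1"] by simp
        finally have TD: "real T \<le> D" .
        have "bad = {}"
        proof (rule ccontr)
          assume "bad \<noteq> {}"
          then obtain w B t where t: "t \<in> {1..T}"
            and less: "D < disc (signing (A T) (fst w) (snd w)) (snd w) t B"
            unfolding bad_def bad_iff by blast
          have "disc (signing (A T) (fst w) (snd w)) (snd w) t B \<le> t"
            by (rule disc_le_time) (simp add: signing_eq abs_walk_sign)
          then show False using TD t less by simp
        qed
        then show ?thesis by simp
      next
        case False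
        define n where "n = resolution T"
        define L where "L = real (n + 1)"
        have L: "2 * log 2 (real T) \<le> L" "L \<le> 5 * log 2 (real T)" and n: "(real T)\<^sup>2 \<le> 2 ^ n"
          using resolution_bounds[OF T] by (auto simp: L_def n_def)
        have L1: "1 \<le> L" by (simp add: L_def)
        have c_L: "real (c T) = L ^ (?d + 2)"
          unfolding c_def L_def n_def of_nat_power ..
        define Z where "Z = {x \<in> space ?P. \<exists>i. \<exists>k\<in>{..2 ^ n}. r \<le> card {s \<in> {1..T}. cell n (x s) i = k}}"
        \<comment> \<open>This makes \<open>l\<^sup>2 / (2 * c)\<close> equal to
          \<open>K\<^sup>2 / 2 * L ^ ?d\<close> and \<open>(2 * L) ^ ?d * l\<close> of order
          \<open>L ^ (2 * ?d + 1)\<close>.\<close>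
        define l where "l = K * L ^ (?d + 1)"
        have D_ge: "(2 * L) ^ ?d * l + 2 * real ?d * r \<le> D"
        proof -
          have "(2 * L) ^ ?d * l + 2 * real ?d * r = 2 ^ ?d * K * L ^ (2 * ?d + 1) + 2 * real ?d * r * 1"
          proof -
            have "L ^ (2 * ?d + 1) = L ^ ?d * L ^ (?d + 1)"
              unfolding power_add[symmetric] by (simp add: mult_2)
            then show ?thesis unfolding l_def power_mult_distrib by (simp only: mult_ac mult_1_right)
          qed
          also have "\<dots> \<le> 2 ^ ?d * K * L ^ (2 * ?d + 1) + 2 * real ?d * r * L ^ (2 * ?d + 1)"
            using L1 by (intro add_left_mono mult_left_mono one_le_power) auto
          also have "\<dots> = (2 ^ ?d * K + 2 * real ?d * r) * L ^ (2 * ?d + 1)"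
            by (simp add: algebra_simps)
          also have "\<dots> \<le> (2 ^ ?d * K + 2 * real ?d * r) * (5 * log 2 (real T)) ^ (2 * ?d + 1)"
            using L L1 K by (intro mult_left_mono power_mono) auto
          also have "\<dots> = (2 ^ ?d * K + 2 * real ?d * r) * 5 ^ (2 * ?d + 1) * log 2 (real T) ^ (2 * ?d + 1)"
            by (simp only: power_mult_distrib mult.assoc)
          also have "\<dots> \<le> D"
            unfolding D_def C_def using \<open>1 \<le> log 2 (real T)\<close> by (intro mult_right_mono) auto
          finally show ?thesis .
        qed
        have Z_sets: "Z \<in> sets ?P"
        proof -
          have [measurable]: "(\<lambda>x. x s) \<in> ?P \<rightarrow>\<^sub>M borel" if "s \<in> {1..T}" for s
            using measurable_component_singleton[of s "{1..T}" "\<lambda>_. uniform_cube :: (real ^ 'd) measure"] that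
            by (auto cong: measurable_cong_sets)
          have eq: "real (card {s \<in> {1..T}. cell n (x s) i = k}) = (\<Sum>s\<in>{1..T}. if cell n (x s) i = k then 1 else 0)"
            for x :: "nat \<Rightarrow> real ^ 'd" and i k
            by (simp flip: sum.inter_filter)
          have *: "r \<le> card {s \<in> {1..T}. cell n (x s) i = k} \<longleftrightarrow>
              real r \<le> (\<Sum>s\<in>{1..T}. if cell n (x s) i = k then 1 else 0)" for x :: "nat \<Rightarrow> real ^ 'd" and i k
            unfolding eq[symmetric] of_nat_le_iff ..
          show ?thesis unfolding Z_def * by measurable
        qed
        let ?\<delta> = "2 * real T * exp (- (c T / (2 * L ^ ?d)))
            + 2 * real T * (real T * L ^ ?d) * exp (- (l\<^sup>2 / (2 * real (c T))))"
        have "measure (R T \<Otimes>\<^sub>M ?P) bad \<le> measure ?P Z + ?\<delta>"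
        proof (rule measure_pair_le[OF prob_R])
          show "prob_space ?P" by (intro prob_space_PiM prob_space_uniform_cube)
          show "bad \<in> sets (R T \<Otimes>\<^sub>M ?P)" using bad_sets by (simp add: \<Omega>_def random_input_def)
          show "Z \<in> sets ?P" by (rule Z_sets)
          show "0 \<le> ?\<delta>" using L1 by simp
          \<comment> \<open>The points are frozen from here on; only seeds are counted.\<close>
          fix x assume x: "x \<in> space ?P - Z"
          have strip: "card {s \<in> {1..T}. cell n (x s) i = k} \<le> r" if "k \<le> 2 ^ n" for i k
            using x that by (force simp: Z_def not_le less_imp_le)
          let ?F = "{f \<in> seeds T. \<exists>B. axis_parallel_box B \<and> (\<exists>t\<in>{1..T}.
             (2 * L) ^ ?d * l + 2 * real ?d * r
             < disc (\<lambda>t. real_of_int (walk_sign (c T) (dyadic_kernel n x) f t)) x t B)}"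
          have "(n + 1) ^ ?d \<le> c T" by (simp add: c_def n_def)
          moreover have "0 \<le> l" using K L1 by (simp add: l_def)
          ultimately have F: "real (card ?F) \<le> ?\<delta> * (2 * c T) ^ T"
            using walk_disc_le[OF _ _ strip, where l = l and c = "c T"] unfolding seeds_def L_def by auto
          have space_R: "space (R T) = S T" by (simp add: R_def space_uniform_count_measure)
          let ?G = "{r \<in> S T. (r, x) \<in> bad}"
          have "dec T ` ?G \<subseteq> ?F"
          proof
            fix f assume "f \<in> dec T ` ?G"
            then obtain q where q: "q \<in> S T" "(q, x) \<in> bad" "f = dec T q" by blast
            then obtain B t where B: "axis_parallel_box B" and t: "t \<in> {1..T}"
              and less: "D < disc (signing (A T) q x) x t B"
              unfolding bad_def bad_iff by auto
            have "disc (signing (A T) q x) x t B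
                = disc (\<lambda>t. real_of_int (walk_sign (c T) (dyadic_kernel n x) f t)) x t B"
              unfolding disc_def by (intro arg_cong[where f = abs] sum.cong) (auto simp: signing_eq n_def q)
            then have "(2 * L) ^ ?d * l + 2 * real ?d * r
                < disc (\<lambda>t. real_of_int (walk_sign (c T) (dyadic_kernel n x) f t)) x t B"
              using less D_ge by linarith
            moreover have "f \<in> seeds T" using dec[of T] q by (auto simp: bij_betw_def)
            ultimately show "f \<in> ?F" using B t by blast
          qed
          then have "card (dec T ` ?G) \<le> card ?F"
            by (intro card_mono) (auto simp: fin_seeds)
          moreover have "card (dec T ` ?G) = card ?G"
            using dec[of T] by (intro card_image) (auto simp: bij_betw_def intro: inj_on_subset)
          ultimately have "real (card ?G) \<le> ?\<delta> * (2 * c T) ^ T"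
            using F by linarith
          then have "real (card ?G) / card (S T) \<le> ?\<delta>"
            unfolding card_S using c_pos[of T] by (subst pos_divide_le_eq) auto
          moreover have "measure (R T) ?G = real (card ?G) / card (S T)"
            unfolding R_def using S by (intro measure_uniform_count_measure) auto
          ultimately show "measure (R T) {r \<in> space (R T). (r, x) \<in> bad} \<le> ?\<delta>"
            by (simp add: space_R)
        qed
        also have "measure ?P Z \<le> real ?d * (2 ^ n + 1) * real T ^ r * (1 / 2 ^ n) ^ r"
          unfolding Z_def by (rule order_trans[OF prob_strip_le]) (simp add: algebra_simps)
        also have "\<dots> \<le> real T powr (- (k + 2))"
          using T k n r_def by (rule strip_failure_le)
        also have "?\<delta> \<le> real T powr (- (k + 2)) + real T powr (- (k + 2))"
          unfolding c_L l_def using T k False L(1) K(2)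
          by (intro add_mono walk_failure_le coordinate_failure_le) (auto simp: Suc_le_eq)
        finally have "measure \<Omega> bad \<le> real T powr (- (k + 2)) + (real T powr (- (k + 2)) + real T powr (- (k + 2)))"
          by (simp add: \<Omega>_def random_input_def)
        \<comment> \<open>The surplus \<open>T powr - 2\<close> in each of the three failure bounds
          absorbs the factor \<open>3\<close>, as \<open>3 / T\<^sup>2 \<le> 3 / 4\<close>.\<close>
        also have "\<dots> = 3 * real T powr (- 2) * real T powr (- k)"
        proof -
          have "real T powr (- (k + 2)) = real T powr (- 2) * real T powr (- k)"
            unfolding powr_add[symmetric] by (rule arg_cong[where f = "\<lambda>z. _ powr z"]) simp
          then show ?thesis by simp
        qed
        also have "\<dots> \<le> 1 * real T powr (- k)"
        proof (rule mult_right_mono)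
          have "real 2 ^ 2 \<le> real T ^ 2" using T by (intro power_mono) auto
          then show "3 * real T powr (- 2) \<le> 1"
            using T by (simp add: powr_minus powr_numeral field_simps)
        qed simp
        finally show ?thesis by simp
      qed
      moreover have "\<P>((r, x) in random_input T (R T). \<forall>B. axis_parallel_box B \<longrightarrow>
          (MAX t\<in>{1..T}. disc (signing (A T) r x) x t B) \<le> C * log 2 (real T) ^ (2 * ?d + 1))
          = 1 - measure \<Omega> bad"
      proof -
        have "{(r, x). (r, x) \<in> space \<Omega> \<and> (\<forall>B. axis_parallel_box B \<longrightarrow>
            (MAX t\<in>{1..T}. disc (signing (A T) r x) x t B) \<le> D)} = space \<Omega> - bad"
          by (auto simp: bad_def not_less)
        then show ?thesis
          unfolding D_def[symmetric] \<Omega>_def[symmetric] \<Omega>.prob_compl[OF bad_sets, symmetric] by (simp only:)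
      qed
      ultimately show ?thesis by simp
    qed
    then show ?thesis using C_pos by blast
  qed
  show ?thesis
    by (intro exI[of _ R] exI[of _ A] conjI allI impI online main)
qed

section \<open>Roth's lower bound for signed point sets\<close>

text \<open>The unnormalised Haar function of the dyadic interval of length
  \<open>2 ^ (e + 1)\<close> with index \<open>k\<close>. Working on integers replaces all integrals
  by finite sums.\<close>

definition haar :: "nat \<Rightarrow> nat \<Rightarrow> nat \<Rightarrow> real" where
  "haar e k y = of_bool (y div 2 ^ e = 2 * k) - of_bool (y div 2 ^ e = 2 * k + 1)"

lemma nat_div_eq_iff:
  fixes y h m :: nat
  assumes "0 < h"
  shows "y div h = m \<longleftrightarrow> m * h \<le> y \<and> y < (m + 1) * h"
proof -
  have "y div h = m \<longleftrightarrow> m \<le> y div h \<and> y div h < m + 1" by auto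
  then show ?thesis
    using assms by (simp only: less_eq_div_iff_mult_less_eq div_less_iff_less_mult)
qed

lemma sum_of_bool_div:
  "(\<Sum>y<q. of_bool (y div 2 ^ e = m) :: real) = real (min q ((m + 1) * 2 ^ e)) - real (min q (m * 2 ^ e))"
proof -
  have eq: "y div 2 ^ e = m \<longleftrightarrow> m * 2 ^ e \<le> y \<and> y < (m + 1) * 2 ^ e" for y :: nat
    by (rule nat_div_eq_iff) simp
  have "{..<q} \<inter> {y. y div 2 ^ e = m} = {min q (m * 2 ^ e)..<min q ((m + 1) * 2 ^ e)}"
    unfolding eq by (rule set_eqI) (simp only: Int_iff lessThan_iff mem_Collect_eq atLeastLessThan_iff
        min_le_iff_disj min_less_iff_conj, linarith)
  then have "(\<Sum>y<q. of_bool (y div 2 ^ e = m) :: real) = real (min q ((m + 1) * 2 ^ e) - min q (m * 2 ^ e))"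
    by simp
  also have "\<dots> = real (min q ((m + 1) * 2 ^ e)) - real (min q (m * 2 ^ e))"
    by (intro of_nat_diff) (simp add: min_le_iff_disj)
  finally show ?thesis .
qed

text \<open>The primitive of a Haar function is a tent: it rises on the left half of the interval,
  falls on the right half and vanishes elsewhere. The form with \<open>min\<close> covers all
  positions of \<open>q\<close> at once.\<close>

lemma sum_haar_prefix:
  "(\<Sum>y<q. haar e k y) = 2 * real (min q ((2 * k + 1) * 2 ^ e))
     - real (min q ((2 * k) * 2 ^ e)) - real (min q ((2 * k + 2) * 2 ^ e))"
  unfolding haar_def sum_subtractf sum_of_bool_div by simp

context
  fixes n e k :: nat
  assumes e: "e < n" and k: "k < 2 ^ (n - 1 - e)"
begin

lemma haar_support_le: "(2 * k + 2) * 2 ^ e \<le> (2 :: nat) ^ n"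
proof -
  have "(2 * k + 2) * 2 ^ e = (k + 1) * 2 ^ (e + 1)" by simp
  also have "\<dots> \<le> 2 ^ (n - 1 - e) * 2 ^ (e + 1)" using k by (intro mult_right_mono) auto
  also have "\<dots> = 2 ^ (n - 1 - e + (e + 1))" by (rule power_add[symmetric])
  also have "n - 1 - e + (e + 1) = n" using e by simp
  finally show ?thesis .
qed

lemma sum_haar: "(\<Sum>y<2 ^ n. haar e k y) = 0"
proof -
  have "(2 * k + 1) * 2 ^ e \<le> (2 * k + 2) * (2 :: nat) ^ e" "2 * k * 2 ^ e \<le> (2 * k + 2) * (2 :: nat) ^ e"
    by auto
  then have "(2 * k + 1) * 2 ^ e \<le> (2 :: nat) ^ n" "2 * k * 2 ^ e \<le> (2 :: nat) ^ n"
    using haar_support_le by linarith+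
  then show ?thesis
    unfolding sum_haar_prefix using haar_support_le by (simp add: min_absorb2 algebra_simps)
qed

lemma sum_haar_square: "(\<Sum>y<2 ^ n. haar e k y * haar e k y) = 2 ^ (e + 1)"
proof -
  have "(2 * k + 1) * 2 ^ e \<le> (2 * k + 2) * (2 :: nat) ^ e" "2 * k * 2 ^ e \<le> (2 * k + 2) * (2 :: nat) ^ e"
    by auto
  then have le: "(2 * k + 1) * 2 ^ e \<le> (2 :: nat) ^ n" "2 * k * 2 ^ e \<le> (2 :: nat) ^ n"
    using haar_support_le by linarith+
  have "(\<Sum>y<2 ^ n. haar e k y * haar e k y)
      = (\<Sum>y<2 ^ n. of_bool (y div 2 ^ e = 2 * k) + of_bool (y div 2 ^ e = 2 * k + 1))"
    by (intro sum.cong) (auto simp: haar_def)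
  also have "\<dots> = 2 ^ (e + 1)"
    unfolding sum.distrib sum_of_bool_div using le haar_support_le
    by (simp add: min_absorb2 algebra_simps)
  finally show ?thesis .
qed

text \<open>A coarser Haar function is constant on the support of a finer one, and the finer one has
  sum zero.\<close>

lemma sum_haar_coarser:
  assumes "e < e'"
  shows "(\<Sum>y<2 ^ n. haar e k y * haar e' k' y) = 0"
proof -
  define g where "g = (of_bool (k div 2 ^ (e' - e - 1) = 2 * k') - of_bool (k div 2 ^ (e' - e - 1) = 2 * k' + 1) :: real)"
  have "haar e k y * haar e' k' y = haar e k y * g" for y
  proof (cases "haar e k y = 0")
    case False
    then have "y div 2 ^ e = 2 * k \<or> y div 2 ^ e = 2 * k + 1"
      by (auto simp: haar_def split: if_splits)
    then have "y div 2 ^ e div 2 = k" by auto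
    then have y: "y div 2 ^ (e + 1) = k" by (simp only: div_mult2_eq power_add power_one_right)
    have "y div 2 ^ e' = y div (2 ^ (e + 1) * 2 ^ (e' - e - 1))"
      unfolding power_add[symmetric] using assms by simp
    also have "\<dots> = k div 2 ^ (e' - e - 1)" unfolding div_mult2_eq y ..
    finally show ?thesis by (simp add: haar_def[of e'] g_def)
  qed simp
  then have "(\<Sum>y<2 ^ n. haar e k y * haar e' k' y) = (\<Sum>y<2 ^ n. haar e k y) * g"
    by (simp only: sum_distrib_right)
  then show ?thesis by (simp add: sum_haar)
qed

text \<open>The tail indicator is what one coordinate of a point contributes to the discrepancy
  function; its Haar coefficient is minus the tent at \<open>q\<close>.\<close>

lemma sum_haar_tail:
  assumes "q \<le> 2 ^ n"
  shows "(\<Sum>y<2 ^ n. of_bool (q \<le> y) * haar e k y) = - (\<Sum>y<q. haar e k y)"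
proof -
  have "(\<Sum>y<2 ^ n. haar e k y)
      = (\<Sum>y<2 ^ n. of_bool (q \<le> y) * haar e k y) + (\<Sum>y<2 ^ n. of_bool (y < q) * haar e k y)"
    unfolding sum.distrib[symmetric] by (intro sum.cong) auto
  also have "(\<Sum>y<2 ^ n. of_bool (y < q) * haar e k y) = (\<Sum>y<q. haar e k y)"
  proof -
    have "{..<2 ^ n} \<inter> {y. y < q} = {..<q}" using assms by auto
    then show ?thesis by simp
  qed
  finally show ?thesis by (simp add: sum_haar)
qed

lemma sum_haar_tail_outside:
  assumes "q \<le> 2 ^ n" "q div 2 ^ (e + 1) \<noteq> k"
  shows "(\<Sum>y<2 ^ n. of_bool (q \<le> y) * haar e k y) = 0"
proof -
  have "q < k * 2 ^ (e + 1) \<or> (k + 1) * 2 ^ (e + 1) \<le> q"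
    using assms(2) by (subst (asm) nat_div_eq_iff) (auto simp: not_le not_less)
  then have "q < 2 * k * 2 ^ e \<or> (2 * k + 2) * 2 ^ e \<le> q"
    by (simp add: algebra_simps)
  then show ?thesis
  proof
    assume "q < 2 * k * 2 ^ e"
    then show ?thesis unfolding sum_haar_tail[OF assms(1)] sum_haar_prefix
      by (simp add: algebra_simps)
  next
    assume "(2 * k + 2) * 2 ^ e \<le> q"
    then show ?thesis unfolding sum_haar_tail[OF assms(1)] sum_haar_prefix
      by (simp add: algebra_simps)
  qed
qed

text \<open>In the second quarter of its interval the tent has climbed for at least one full
  quarter, of length \<open>2 ^ (e - 1)\<close>, and has not yet passed the peak.\<close>

lemma sum_haar_tail_inside:
  assumes "q \<le> 2 ^ n" "1 \<le> e" "q div 2 ^ (e - 1) = 4 * k + 1"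
  shows "2 ^ (e - 1) \<le> \<bar>\<Sum>y<2 ^ n. of_bool (q \<le> y) * haar e k y\<bar>"
proof -
  define h :: nat where "h = 2 ^ (e - 1)"
  have h: "2 ^ e = 2 * h" using assms(2) by (simp add: h_def flip: power_Suc)
  have "(4 * k + 1) * h \<le> q" "q < (4 * k + 2) * h"
    using assms(3) unfolding h_def by (subst (asm) nat_div_eq_iff; simp)+
  then have q: "4 * k * h + h \<le> q" "q < 4 * k * h + 2 * h" by (auto simp: algebra_simps)
  have "(\<Sum>y<q. haar e k y) = 2 * real q - real (4 * k * h) - real q"
    unfolding sum_haar_prefix h using q by (simp add: min_absorb1 min_absorb2 algebra_simps)
  moreover have "real (4 * k * h) + real h \<le> real q"
    using of_nat_mono[OF q(1), where 'a = real] by simp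
  ultimately show ?thesis
    unfolding sum_haar_tail[OF assms(1)] by (simp add: h_def)
qed

end

lemma sum_haar_orthogonal:
  assumes "e < n" "k < 2 ^ (n - 1 - e)" "e' < n" "k' < 2 ^ (n - 1 - e')" "(e, k) \<noteq> (e', k')"
  shows "(\<Sum>y<2 ^ n. haar e k y * haar e' k' y) = 0"
proof -
  consider "e < e'" | "e' < e" | "e = e'" "k \<noteq> k'"
    using assms by fastforce
  then show ?thesis
  proof cases
    case 1
    then show ?thesis using assms by (intro sum_haar_coarser)
  next
    case 2
    then show ?thesis using sum_haar_coarser[OF assms(3,4) 2, of k] by (simp only: mult.commute)
  next
    case 3
    then have "haar e k y * haar e' k' y = 0" for y by (auto simp: haar_def)
    then show ?thesis by (intro sum.neutral) blast
  qed
qed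

section \<open>Bessel's inequality and the signed count of points\<close>

lemma bessel_finite:
  fixes D :: "'y \<Rightarrow> real" and H :: "'a \<Rightarrow> 'y \<Rightarrow> real"
  assumes "finite \<Omega>" "0 < \<nu>"
    and orth: "\<And>a b. a \<in> \<Omega> \<Longrightarrow> b \<in> \<Omega> \<Longrightarrow> (\<Sum>y\<in>Y. H a y * H b y) = (if a = b then \<nu> else 0)"
  shows "(\<Sum>a\<in>\<Omega>. (\<Sum>y\<in>Y. D y * H a y)\<^sup>2) \<le> \<nu> * (\<Sum>y\<in>Y. (D y)\<^sup>2)"
proof -
  define u where "u a = (\<Sum>y\<in>Y. D y * H a y) / \<nu>" for a
  \<comment> \<open>\<open>p\<close> is the orthogonal projection of \<open>D\<close> to the span of
    the \<open>H a\<close>: its square sum equals its product sum with \<open>D\<close>, and the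
    claim is that \<open>D - p\<close> has nonnegative square sum.\<close>
  define p where "p y = (\<Sum>a\<in>\<Omega>. u a * H a y)" for y
  have u: "(\<Sum>y\<in>Y. D y * H a y) = \<nu> * u a" for a using assms(2) by (simp add: u_def)
  have Dp: "(\<Sum>y\<in>Y. D y * p y) = \<nu> * (\<Sum>a\<in>\<Omega>. (u a)\<^sup>2)"
  proof -
    have "(\<Sum>y\<in>Y. D y * p y) = (\<Sum>a\<in>\<Omega>. u a * (\<Sum>y\<in>Y. D y * H a y))"
      unfolding p_def sum_distrib_left by (subst sum.swap) (simp add: mult_ac)
    then show ?thesis unfolding u sum_distrib_left by (simp add: power2_eq_square mult_ac)
  qed
  have pp: "(\<Sum>y\<in>Y. p y * p y) = \<nu> * (\<Sum>a\<in>\<Omega>. (u a)\<^sup>2)"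
  proof -
    have "(\<Sum>y\<in>Y. p y * p y) = (\<Sum>y\<in>Y. \<Sum>a\<in>\<Omega>. \<Sum>b\<in>\<Omega>. (u a * u b) * (H a y * H b y))"
      unfolding p_def sum_product by (simp add: mult_ac)
    also have "\<dots> = (\<Sum>a\<in>\<Omega>. \<Sum>b\<in>\<Omega>. \<Sum>y\<in>Y. (u a * u b) * (H a y * H b y))"
      by (subst sum.swap, intro sum.cong refl, rule sum.swap)
    also have "\<dots> = (\<Sum>a\<in>\<Omega>. \<Sum>b\<in>\<Omega>. if a = b then u a * u b * \<nu> else 0)"
      unfolding sum_distrib_left[symmetric] by (intro sum.cong refl) (auto simp: orth)
    also have "\<dots> = \<nu> * (\<Sum>a\<in>\<Omega>. (u a)\<^sup>2)"
      using assms(1) by (simp add: sum_distrib_left power2_eq_square mult_ac)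
    finally show ?thesis .
  qed
  have "0 \<le> (\<Sum>y\<in>Y. (D y - p y)\<^sup>2)" by (intro sum_nonneg) auto
  also have "\<dots> = (\<Sum>y\<in>Y. (D y)\<^sup>2) - 2 * (\<Sum>y\<in>Y. D y * p y) + (\<Sum>y\<in>Y. p y * p y)"
    by (simp add: power2_eq_square algebra_simps sum.distrib sum_subtractf sum_distrib_left)
  finally have "\<nu> * (\<Sum>a\<in>\<Omega>. (u a)\<^sup>2) \<le> (\<Sum>y\<in>Y. (D y)\<^sup>2)"
    unfolding Dp pp by simp
  then have "\<nu> * (\<nu> * (\<Sum>a\<in>\<Omega>. (u a)\<^sup>2)) \<le> \<nu> * (\<Sum>y\<in>Y. (D y)\<^sup>2)"
    using assms by (intro mult_left_mono) auto
  moreover have "(\<Sum>a\<in>\<Omega>. (\<Sum>y\<in>Y. D y * H a y)\<^sup>2) = \<nu> * (\<nu> * (\<Sum>a\<in>\<Omega>. (u a)\<^sup>2))"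
    unfolding u power_mult_distrib by (simp add: sum_distrib_left power2_eq_square mult_ac)
  ultimately show ?thesis by simp
qed

text \<open>An index \<open>\<alpha>\<close> stands for the box with sides \<open>{k * 2 ^ (e + 1)..<(k + 1) * 2 ^ (e + 1)}\<close> where
  \<open>\<alpha> i = (e, k)\<close>.  It is good if it contains a single point of the support of \<open>w\<close>, and that point lies in
  the second quarter of every side, away from the zeros of the primitive of the Haar function.\<close>

lemma roth_lower_bound:
  fixes w :: "'s \<Rightarrow> real" and q :: "'s \<Rightarrow> 'i::finite \<Rightarrow> nat" and n :: "'i \<Rightarrow> nat"
    and \<Omega> :: "('i \<Rightarrow> nat \<times> nat) set"
  assumes fin: "finite S" "finite \<Omega>"
    and q: "\<And>s i. s \<in> S \<Longrightarrow> w s \<noteq> 0 \<Longrightarrow> q s i \<le> 2 ^ n i"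
    and index: "\<And>\<alpha> i. \<alpha> \<in> \<Omega> \<Longrightarrow>
      1 \<le> fst (\<alpha> i) \<and> fst (\<alpha> i) < n i \<and> snd (\<alpha> i) < 2 ^ (n i - 1 - fst (\<alpha> i))"
    and size: "\<And>\<alpha>. \<alpha> \<in> \<Omega> \<Longrightarrow> (\<Sum>i\<in>UNIV. fst (\<alpha> i) + 1) = E"
    and good: "\<And>\<alpha>. \<alpha> \<in> \<Omega> \<Longrightarrow> \<exists>s\<in>S. \<bar>w s\<bar> = 1 \<and>
      (\<forall>i. q s i div 2 ^ (fst (\<alpha> i) - 1) = 4 * snd (\<alpha> i) + 1) \<and>
      (\<forall>s'\<in>S - {s}. w s' = 0 \<or> (\<exists>i. q s' i div 2 ^ (fst (\<alpha> i) + 1) \<noteq> snd (\<alpha> i)))"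
  shows "\<exists>Y\<in>(\<Pi>\<^sub>E i\<in>UNIV. {..<2 ^ n i}). real (card \<Omega>) * 2 ^ E
    \<le> 16 ^ CARD('i) * 2 ^ (\<Sum>i\<in>UNIV. n i) * (\<Sum>s\<in>S. w s * of_bool (\<forall>i. q s i \<le> Y i))\<^sup>2"
proof -
  define G where "G = (\<Pi>\<^sub>E i\<in>(UNIV :: 'i set). {..<2 ^ n i :: nat})"
  \<comment> \<open>The discrepancy function of anchored boxes, evaluated at the corner
    \<open>Y\<close>.\<close>
  define D where "D Y = (\<Sum>s\<in>S. w s * of_bool (\<forall>i. q s i \<le> Y i))" for Y
  define H :: "('i \<Rightarrow> nat \<times> nat) \<Rightarrow> ('i \<Rightarrow> nat) \<Rightarrow> real" where "H \<alpha> Y = (\<Prod>i\<in>UNIV. haar (fst (\<alpha> i)) (snd (\<alpha> i)) (Y i))" for \<alpha> Y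
  \<comment> \<open>The Haar coefficient of a single point is the product of these one-dimensional
    ones over \<open>i\<close>.\<close>
  define \<phi> where "\<phi> \<alpha> s i = (\<Sum>y<2 ^ n i. of_bool (q s i \<le> y) * haar (fst (\<alpha> i)) (snd (\<alpha> i)) y)" for \<alpha> s i
  have fin_G: "finite G" by (auto simp: G_def intro: finite_PiE)
  have card_G: "real (card G) = 2 ^ (\<Sum>i\<in>UNIV. n i)"
    by (simp add: G_def card_PiE power_sum)
  have G_ne: "G \<noteq> {}" by (auto simp: G_def PiE_eq_empty_iff lessThan_empty_iff)
  have forall_of_bool: "(of_bool (\<forall>i. Q i) :: real) = (\<Prod>i\<in>UNIV. of_bool (Q i))" for Q :: "'i \<Rightarrow> bool"
    by (auto simp: of_bool_def)
  \<comment> \<open>Distinct indices differ in some coordinate, where the one-dimensional sum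
    vanishes; equal ones give the volume \<open>2 ^ E\<close>, common to all shapes by
    \<open>size\<close>.\<close>
  have orth: "(\<Sum>Y\<in>G. H \<alpha> Y * H \<beta> Y) = (if \<alpha> = \<beta> then 2 ^ E else 0)" if "\<alpha> \<in> \<Omega>" "\<beta> \<in> \<Omega>" for \<alpha> \<beta>
  proof -
    have "(\<Sum>Y\<in>G. H \<alpha> Y * H \<beta> Y)
        = (\<Prod>i\<in>UNIV. \<Sum>y<2 ^ n i. haar (fst (\<alpha> i)) (snd (\<alpha> i)) y * haar (fst (\<beta> i)) (snd (\<beta> i)) y)"
      unfolding H_def G_def prod.distrib[symmetric] by (rule prod_sum_PiE[symmetric]) auto
    also have "\<dots> = (if \<alpha> = \<beta> then 2 ^ E else 0)"
    proof (cases "\<alpha> = \<beta>")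
      case True
      have "(\<Prod>i\<in>UNIV. \<Sum>y<2 ^ n i. haar (fst (\<alpha> i)) (snd (\<alpha> i)) y * haar (fst (\<alpha> i)) (snd (\<alpha> i)) y)
          = (\<Prod>i\<in>UNIV. 2 ^ (fst (\<alpha> i) + 1))"
        using index[OF that(1)] by (intro prod.cong refl sum_haar_square) auto
      also have "\<dots> = 2 ^ E" unfolding size[OF that(1), symmetric] power_sum ..
      finally show ?thesis using True by simp
    next
      case False
      then obtain i where i: "\<alpha> i \<noteq> \<beta> i" by auto
      have "(\<Sum>y<2 ^ n i. haar (fst (\<alpha> i)) (snd (\<alpha> i)) y * haar (fst (\<beta> i)) (snd (\<beta> i)) y) = 0"
        using index[OF that(1), of i] index[OF that(2), of i] i by (intro sum_haar_orthogonal) auto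
      then show ?thesis using False by (subst prod_zero) auto
    qed
    finally show ?thesis .
  qed
  have coef: "(\<Sum>Y\<in>G. D Y * H \<alpha> Y) = (\<Sum>s\<in>S. w s * (\<Prod>i\<in>UNIV. \<phi> \<alpha> s i))" for \<alpha>
  proof -
    have prod_\<phi>: "(\<Prod>i\<in>UNIV. \<phi> \<alpha> s i) = (\<Sum>Y\<in>G. of_bool (\<forall>i. q s i \<le> Y i) * H \<alpha> Y)" for s
      unfolding \<phi>_def H_def G_def forall_of_bool prod.distrib[symmetric] by (rule prod_sum_PiE) auto
    show ?thesis
      unfolding D_def prod_\<phi> sum_distrib_right sum_distrib_left mult.assoc by (rule sum.swap)
  qed
  \<comment> \<open>The lone point of a good box contributes a product of tents, each at least a
    quarter of the side; any other point of nonzero weight misses the box in some coordinate, where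
    its tent is zero.\<close>
  have large: "2 ^ E / 4 ^ CARD('i) \<le> \<bar>\<Sum>Y\<in>G. D Y * H \<alpha> Y\<bar>" if \<alpha>: "\<alpha> \<in> \<Omega>" for \<alpha>
  proof -
    obtain s where s: "s \<in> S" "\<bar>w s\<bar> = 1" "\<And>i. q s i div 2 ^ (fst (\<alpha> i) - 1) = 4 * snd (\<alpha> i) + 1"
      and other: "\<And>s'. s' \<in> S - {s} \<Longrightarrow> w s' = 0 \<or> (\<exists>i. q s' i div 2 ^ (fst (\<alpha> i) + 1) \<noteq> snd (\<alpha> i))"
      using good[OF \<alpha>] by blast
    have zero: "w s' * (\<Prod>i\<in>UNIV. \<phi> \<alpha> s' i) = 0" if s': "s' \<in> S - {s}" for s'
    proof (cases "w s' = 0")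
      case False
      then obtain i where i: "q s' i div 2 ^ (fst (\<alpha> i) + 1) \<noteq> snd (\<alpha> i)" using other[OF s'] by blast
      have "\<phi> \<alpha> s' i = 0"
        unfolding \<phi>_def using index[OF \<alpha>, of i] q[of s' i] False s' i
        by (intro sum_haar_tail_outside) auto
      then show ?thesis by (subst prod_zero) auto
    qed simp
    have "(\<Sum>s\<in>S - {s}. w s * (\<Prod>i\<in>UNIV. \<phi> \<alpha> s i)) = 0"
      by (intro sum.neutral ballI zero)
    then have "(\<Sum>s\<in>S. w s * (\<Prod>i\<in>UNIV. \<phi> \<alpha> s i)) = w s * (\<Prod>i\<in>UNIV. \<phi> \<alpha> s i)"
      using sum.remove[OF fin(1) s(1), of "\<lambda>s. w s * (\<Prod>i\<in>UNIV. \<phi> \<alpha> s i)"] by simp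
    then have "\<bar>\<Sum>Y\<in>G. D Y * H \<alpha> Y\<bar> = (\<Prod>i\<in>UNIV. \<bar>\<phi> \<alpha> s i\<bar>)"
      unfolding coef using s(2) by (simp add: abs_mult abs_prod)
    also have "\<dots> \<ge> (\<Prod>i\<in>UNIV. 2 ^ (fst (\<alpha> i) + 1) / 4)"
    proof (intro prod_mono conjI)
      fix i
      have w: "w s \<noteq> 0" using s(2) by auto
      have "2 ^ (fst (\<alpha> i) - 1) \<le> \<bar>\<phi> \<alpha> s i\<bar>"
        unfolding \<phi>_def using index[OF \<alpha>, of i] q[OF s(1) w] s(3)
        by (intro sum_haar_tail_inside) auto
      moreover have "(2::real) ^ (fst (\<alpha> i) + 1) / 4 = 2 ^ (fst (\<alpha> i) - 1)"
      proof -
        obtain e where "fst (\<alpha> i) = Suc e" using index[OF \<alpha>, of i] by (cases "fst (\<alpha> i)") auto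
        then show ?thesis by simp
      qed
      ultimately show "(2::real) ^ (fst (\<alpha> i) + 1) / 4 \<le> \<bar>\<phi> \<alpha> s i\<bar>" by simp
    qed simp
    also have "(\<Prod>i\<in>UNIV. 2 ^ (fst (\<alpha> i) + 1) / 4 :: real) = 2 ^ E / 4 ^ CARD('i)"
      unfolding size[OF \<alpha>, symmetric] power_sum prod_dividef by simp
    finally show ?thesis .
  qed
  have "real (card \<Omega>) * (2 ^ E / 4 ^ CARD('i))\<^sup>2 = (\<Sum>\<alpha>\<in>\<Omega>. (2 ^ E / 4 ^ CARD('i))\<^sup>2)"
    by simp
  also have "\<dots> \<le> (\<Sum>\<alpha>\<in>\<Omega>. (\<Sum>Y\<in>G. D Y * H \<alpha> Y)\<^sup>2)"
  proof (intro sum_mono)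
    fix \<alpha> assume "\<alpha> \<in> \<Omega>"
    from power_mono[OF large[OF this], of 2]
    show "(2 ^ E / 4 ^ CARD('i))\<^sup>2 \<le> (\<Sum>Y\<in>G. D Y * H \<alpha> Y)\<^sup>2" by simp
  qed
  also have "\<dots> \<le> 2 ^ E * (\<Sum>Y\<in>G. (D Y)\<^sup>2)"
    by (rule bessel_finite[OF fin(2) _ orth]) auto
  finally have "2 ^ E * (real (card \<Omega>) * 2 ^ E / 16 ^ CARD('i)) \<le> 2 ^ E * (\<Sum>Y\<in>G. (D Y)\<^sup>2)"
    by (simp add: power_divide power2_eq_square mult_ac flip: power_mult_distrib)
  then have main: "real (card \<Omega>) * 2 ^ E \<le> 16 ^ CARD('i) * (\<Sum>Y\<in>G. (D Y)\<^sup>2)"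
    by (simp add: field_simps)
  \<comment> \<open>The largest square is at least the mean over all grid corners, which turns the
    mean square bound into a single corner.\<close>
  obtain Y where Y: "Y \<in> G" "\<And>Z. Z \<in> G \<Longrightarrow> (D Z)\<^sup>2 \<le> (D Y)\<^sup>2"
    using finite_has_maximal[of "(\<lambda>Y. (D Y)\<^sup>2) ` G"] fin_G G_ne by (force simp: not_le)
  have "(\<Sum>Z\<in>G. (D Z)\<^sup>2) \<le> (\<Sum>Z\<in>G. (D Y)\<^sup>2)" by (intro sum_mono Y)
  also have "\<dots> = 2 ^ (\<Sum>i\<in>UNIV. n i) * (D Y)\<^sup>2" by (simp add: card_G)
  finally have "16 ^ CARD('i) * (\<Sum>Z\<in>G. (D Z)\<^sup>2) \<le> 16 ^ CARD('i) * (2 ^ (\<Sum>i\<in>UNIV. n i) * (D Y)\<^sup>2)"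
    by (intro mult_left_mono) auto
  then have "real (card \<Omega>) * 2 ^ E \<le> 16 ^ CARD('i) * 2 ^ (\<Sum>i\<in>UNIV. n i) * (D Y)\<^sup>2"
    using main by (simp only: mult.assoc)
  then show ?thesis using Y(1) unfolding G_def D_def by blast
qed

section \<open>The lower bound\<close>

text \<open>Here \<open>j i\<close> is counted from the whole cube, so the side is
  \<open>1 / 2 ^ j i\<close>; in \<open>levels\<close> it was counted from the finest cells.
  Membership in the cube is explicit because \<open>cell\<close> sends negative coordinates to
  \<open>0\<close>.\<close>

definition dyadic_box :: "('d \<Rightarrow> nat) \<Rightarrow> ('d::finite \<Rightarrow> nat) \<Rightarrow> (real ^ 'd) set" where
  "dyadic_box j k = {x. (\<forall>i. cell (j i) x i = k i) \<and> x \<in> cbox 0 1}"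

text \<open>Times are cut off at a power of two and shifted to start from \<open>0\<close>, so that
  time behaves like one more dyadic coordinate.\<close>

definition time_block :: "nat \<Rightarrow> nat \<Rightarrow> nat \<Rightarrow> nat set" where
  "time_block m l k = {s \<in> {1..2 ^ m}. (s - 1) div 2 ^ l = k}"

text \<open>The block length is the reciprocal of the box volume, so the expected occupancy is one.
  Index \<open>4 * k i + 1\<close> at level \<open>j i + 2\<close> is the second quarter of side
  \<open>i\<close>.\<close>

definition isolated :: "nat \<Rightarrow> ('d::finite \<Rightarrow> nat) \<times> ('d \<Rightarrow> nat) \<times> nat \<Rightarrow> (nat \<Rightarrow> real ^ 'd) \<Rightarrow> nat \<Rightarrow> bool" where
  "isolated m = (\<lambda>(j, k, k0) x s. x s \<in> dyadic_box (\<lambda>i. j i + 2) (\<lambda>i. 4 * k i + 1) \<and>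
     (\<forall>s'\<in>time_block m (\<Sum>i\<in>UNIV. j i) k0 - {s}. x s' \<notin> dyadic_box j k))"

definition singly_occupied :: "nat \<Rightarrow> ('d::finite \<Rightarrow> nat) \<times> ('d \<Rightarrow> nat) \<times> nat \<Rightarrow> (nat \<Rightarrow> real ^ 'd) \<Rightarrow> bool" where
  "singly_occupied m = (\<lambda>(j, k, k0) x. \<exists>s\<in>time_block m ((\<Sum>i\<in>UNIV. j i) - 2) (4 * k0 + 1). isolated m (j, k, k0) x s)"

text \<open>The levels in space fix the length of the time block, so there are
  \<open>(J - 1) ^ CARD('d)\<close> shapes with \<open>2 ^ m\<close> boxes each. Levels start at
  \<open>2\<close> so that the time block can be quartered.\<close>

definition box_indices :: "nat \<Rightarrow> nat \<Rightarrow> (('d::finite \<Rightarrow> nat) \<times> ('d \<Rightarrow> nat) \<times> nat) set" where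
  "box_indices m J = (SIGMA j : UNIV \<rightarrow>\<^sub>E {2..J}. (\<Pi>\<^sub>E i\<in>UNIV. {..<2 ^ j i}) \<times> {..<2 ^ (m - (\<Sum>i\<in>UNIV. j i))})"

lemma card_time_block:
  assumes "l \<le> m" "k < 2 ^ (m - l)"
  shows "card (time_block m l k) = 2 ^ l"
proof -
  have "(k + 1) * 2 ^ l \<le> 2 ^ (m - l) * (2::nat) ^ l"
    using assms by (intro mult_right_mono) auto
  also have "\<dots> = 2 ^ m" unfolding power_add[symmetric] using assms by simp
  finally have le: "(k + 1) * 2 ^ l \<le> (2::nat) ^ m" .
  have "time_block m l k = {k * 2 ^ l + 1..(k + 1) * 2 ^ l}"
  proof (rule set_eqI)
    fix s
    have "(s - 1) div 2 ^ l = k \<longleftrightarrow> k * 2 ^ l \<le> s - 1 \<and> s - 1 < (k + 1) * 2 ^ l"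
      by (rule nat_div_eq_iff) simp
    then show "s \<in> time_block m l k \<longleftrightarrow> s \<in> {k * 2 ^ l + 1..(k + 1) * 2 ^ l}"
      unfolding time_block_def mem_Collect_eq atLeastAtMost_iff using le by linarith
  qed
  then show ?thesis by simp
qed

lemma finite_time_block [simp]: "finite (time_block m l k)"
  by (simp add: time_block_def)

lemma power_quarter: "2 \<le> l \<Longrightarrow> a ^ l = a ^ (l - 2) * a ^ 2" for a :: "'a::monoid_mult"
  by (subst power_add[symmetric], rule arg_cong[where f = "(^) a"]) simp

lemma time_block_quarter_subset:
  assumes "2 \<le> l"
  shows "time_block m (l - 2) (4 * k + 1) \<subseteq> time_block m l k"
proof
  fix s assume s: "s \<in> time_block m (l - 2) (4 * k + 1)"
  have "(2::nat) ^ l = 2 ^ (l - 2) * 2 ^ 2" by (rule power_quarter[OF assms])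
  then have "(s - 1) div 2 ^ l = (s - 1) div 2 ^ (l - 2) div 2 ^ 2" by (simp only: div_mult2_eq)
  also have "\<dots> = k" using s by (simp add: time_block_def)
  finally show "s \<in> time_block m l k" using s by (simp add: time_block_def)
qed

lemma dyadic_box_quarter_subset: "dyadic_box (\<lambda>i. j i + 2) (\<lambda>i. 4 * k i + 1) \<subseteq> dyadic_box j k"
proof
  fix x assume x: "x \<in> dyadic_box (\<lambda>i. j i + 2) (\<lambda>i. 4 * k i + 1)"
  have "cell (j i) x i = k i" for i
  proof -
    have "cell (j i) x i = cell (j i + 2) x i div 2 ^ 2"
      by (subst cell_div) auto
    also have "cell (j i + 2) x i = 4 * k i + 1" using x unfolding dyadic_box_def by blast
    finally show ?thesis by simp
  qed
  then show "x \<in> dyadic_box j k" using x by (simp add: dyadic_box_def)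
qed

lemma dyadic_box_borel [measurable]: "dyadic_box j k \<in> sets borel"
  unfolding dyadic_box_def by measurable

lemma prob_dyadic_box:
  assumes "\<And>i. k i < 2 ^ j i"
  shows "measure uniform_cube (dyadic_box j k) = 1 / 2 ^ (\<Sum>i\<in>UNIV. j i)"
  unfolding dyadic_box_def prob_cells[OF assms] by (simp add: power_sum prod_dividef)

text \<open>The chance that the other \<open>N - 1\<close> points avoid a box of probability
  \<open>1 / N\<close>; it is at least \<open>1 / e\<close>.\<close>

lemma one_minus_inverse_power_ge:
  assumes "2 \<le> N"
  shows "1 / 4 \<le> (1 - 1 / real N) ^ (N - 1)"
proof -
  have N: "1 < real N" using assms by simp
  have "1 / (1 - 1 / real N) = 1 + 1 / real (N - 1)"
    using assms by (simp add: of_nat_diff field_simps)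
  also have "\<dots> \<le> exp (1 / real (N - 1))" by (rule exp_ge_add_one_self)
  finally have "(1 / (1 - 1 / real N)) ^ (N - 1) \<le> exp (1 / real (N - 1)) ^ (N - 1)"
    using N by (intro power_mono) auto
  also have "\<dots> = exp 1" using assms by (simp flip: exp_of_nat_mult)
  also have "\<dots> \<le> 4" using exp_le by linarith
  finally show ?thesis using N by (simp add: power_divide field_simps)
qed

lemma box_indicesD:
  assumes "(j, k, k0) \<in> box_indices m J" "CARD('d) * J \<le> m"
  shows "\<And>i. 2 \<le> j i" "\<And>i. j i \<le> J" "\<And>i :: 'd::finite. k i < 2 ^ j i"
    "k0 < 2 ^ (m - (\<Sum>i\<in>UNIV. j i))" "2 \<le> (\<Sum>i\<in>UNIV. j i)" "(\<Sum>i\<in>UNIV. j i) \<le> m"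
proof -
  show j: "2 \<le> j i" "j i \<le> J" "k i < 2 ^ j i" for i
    using assms(1) by (auto simp: box_indices_def PiE_iff)
  show "k0 < 2 ^ (m - (\<Sum>i\<in>UNIV. j i))"
    using assms(1) by (auto simp: box_indices_def)
  have "2 * 1 \<le> 2 * CARD('d)" by (intro mult_left_mono) (auto simp: Suc_le_eq)
  also have "\<dots> = (\<Sum>i\<in>(UNIV :: 'd set). 2)" by simp
  also have "\<dots> \<le> (\<Sum>i\<in>UNIV. j i)" by (intro sum_mono j)
  finally show "2 \<le> (\<Sum>i\<in>UNIV. j i)" by simp
  have "(\<Sum>i\<in>UNIV. j i) \<le> (\<Sum>i\<in>(UNIV :: 'd set). J)" by (intro sum_mono j)
  then show "(\<Sum>i\<in>UNIV. j i) \<le> m" using assms(2) by simp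
qed

lemma finite_box_indices [simp]: "finite (box_indices m J)"
  unfolding box_indices_def by (intro finite_SigmaI finite_cartesian_product finite_PiE) auto

lemma card_box_indices:
  assumes "CARD('d::finite) * J \<le> m"
  shows "card (box_indices m J :: (('d \<Rightarrow> nat) \<times> ('d \<Rightarrow> nat) \<times> nat) set) = (J - 1) ^ CARD('d) * 2 ^ m"
proof -
  have "card ((\<Pi>\<^sub>E i\<in>(UNIV :: 'd set). {..<2 ^ j i :: nat}) \<times> {..<2 ^ (m - (\<Sum>i\<in>UNIV. j i)) :: nat}) = 2 ^ m"
    if "j \<in> UNIV \<rightarrow>\<^sub>E {2..J}" for j :: "'d \<Rightarrow> nat"
  proof -
    have "(\<Sum>i\<in>UNIV. j i) \<le> (\<Sum>i\<in>(UNIV :: 'd set). J)"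
      using that by (intro sum_mono) (auto simp: PiE_iff)
    then have "(\<Sum>i\<in>UNIV. j i) \<le> m" using assms by simp
    then show ?thesis
      by (simp add: card_cartesian_product card_PiE flip: power_sum power_add)
  qed
  then show ?thesis
    unfolding box_indices_def
    by (subst card_SigmaI) (auto simp: card_PiE intro!: finite_PiE)
qed

text \<open>With \<open>d\<close> the dimension, there are \<open>2 ^ (l - 2)\<close> admissible
  times; for each, the point hits the quarter box with probability
  \<open>1 / (4 ^ d * 2 ^ l)\<close> and the others avoid the box with probability at least
  \<open>1 / 4\<close>. These events exclude each other, so their probabilities add up.\<close>

lemma prob_singly_occupied:
  fixes \<theta> :: "('d::finite \<Rightarrow> nat) \<times> ('d \<Rightarrow> nat) \<times> nat" and T m J :: nat
  defines "P \<equiv> \<Pi>\<^sub>M s\<in>{1..T}. (uniform_cube :: (real ^ 'd) measure)"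
  assumes \<theta>: "\<theta> \<in> box_indices m J" and J: "CARD('d) * J \<le> m" and T: "2 ^ m \<le> T"
  shows "{x \<in> space P. singly_occupied m \<theta> x} \<in> sets P"
    and "1 / 4 ^ (CARD('d) + 2) \<le> measure P {x \<in> space P. singly_occupied m \<theta> x}"
proof -
  interpret U: prob_space "uniform_cube :: (real ^ 'd) measure" by (rule prob_space_uniform_cube)
  interpret product_prob_space "\<lambda>_. uniform_cube :: (real ^ 'd) measure" "{1..T}" ..
  obtain j k k0 where \<theta>_eq: "\<theta> = (j, k, k0)" by (cases \<theta>)
  note jk = box_indicesD[OF \<theta>[unfolded \<theta>_eq] J]
  define l where "l = (\<Sum>i\<in>UNIV. j i)"
  define A where "A = dyadic_box j k"
  define A' where "A' = dyadic_box (\<lambda>i. j i + 2) (\<lambda>i. 4 * k i + 1)"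
  define W where "W = time_block m l k0"
  define Q where "Q = time_block m (l - 2) (4 * k0 + 1)"
  have l: "2 \<le> l" "l \<le> m" "k0 < 2 ^ (m - l)" using jk by (auto simp: l_def)
  have QW: "Q \<subseteq> W" unfolding Q_def W_def by (rule time_block_quarter_subset[OF l(1)])
  have W_sub: "W \<subseteq> {1..T}" using T by (auto simp: W_def time_block_def)
  have card_W: "card W = 2 ^ l" unfolding W_def using l by (intro card_time_block)
  have card_Q: "card Q = 2 ^ (l - 2)" unfolding Q_def
  proof (rule card_time_block)
    have "4 * k0 + 1 < 4 * 2 ^ (m - l)" using l(3) by linarith
    also have "(4::nat) * 2 ^ (m - l) = 2 ^ (2 + (m - l))" by (simp only: power_add) simp
    also have "2 + (m - l) = m - (l - 2)" using l by simp
    finally show "4 * k0 + 1 < 2 ^ (m - (l - 2))" .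
  qed (use l in simp)
  have AA': "A' \<subseteq> A" unfolding A_def A'_def by (rule dyadic_box_quarter_subset)
  have pA: "U.prob A = 1 / 2 ^ l" unfolding A_def l_def by (rule prob_dyadic_box[OF jk(3)])
  have pA': "U.prob A' = 1 / (4 ^ CARD('d) * 2 ^ l)"
  proof -
    have "4 * k i + 1 < 2 ^ (j i + 2)" for i using jk(3)[of i] by (simp add: power_add)
    then have "U.prob A' = 1 / 2 ^ (\<Sum>i\<in>UNIV. j i + 2)" unfolding A'_def by (rule prob_dyadic_box)
    also have "(\<Sum>i\<in>UNIV. j i + 2) = 2 * CARD('d) + l" unfolding sum.distrib by (simp add: l_def)
    finally show ?thesis by (simp add: power_add power_mult)
  qed
  define E where "E s = {x \<in> space P. \<forall>u\<in>W. x u \<in> (if u = s then A' else - A)}" for s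
  have occ: "{x \<in> space P. singly_occupied m \<theta> x} = (\<Union>s\<in>Q. E s)"
  proof -
    have "isolated m \<theta> x s \<longleftrightarrow> (\<forall>u\<in>W. x u \<in> (if u = s then A' else - A))" if "s \<in> Q" for x s
      using that QW by (auto simp: isolated_def \<theta>_eq A_def A'_def W_def l_def)
    then show ?thesis
      by (auto simp: singly_occupied_def \<theta>_eq E_def Q_def l_def)
  qed
  have E_sets: "E s \<in> sets P" for s
  proof -
    have [measurable]: "(\<lambda>x. x u) \<in> P \<rightarrow>\<^sub>M borel" if "u \<in> W" for u
      using measurable_component_singleton[of u "{1..T}" "\<lambda>_. uniform_cube :: (real ^ 'd) measure"] that W_sub
      unfolding P_def by (auto cong: measurable_cong_sets)
    have [measurable]: "(if u = s then A' else - A) \<in> sets borel" for u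
      by (auto simp: A_def A'_def)
    have [simp]: "finite W" by (simp add: W_def)
    show ?thesis unfolding E_def by measurable
  qed
  have E_prob: "measure P (E s) = 1 / (4 ^ CARD('d) * 2 ^ l) * (1 - 1 / 2 ^ l) ^ (2 ^ l - 1)" if s: "s \<in> Q" for s
  proof -
    have "emeasure P (E s) = (\<Prod>u\<in>W. emeasure uniform_cube (if u = s then A' else - A))"
      unfolding E_def P_def using W_sub
      by (intro emeasure_PiM_Collect) (auto simp: W_def A_def A'_def)
    also have "\<dots> = ennreal (\<Prod>u\<in>W. U.prob (if u = s then A' else - A))"
      unfolding U.emeasure_eq_measure by (rule prod_ennreal) simp
    finally have "measure P (E s) = (\<Prod>u\<in>W. U.prob (if u = s then A' else - A))"
      by (simp add: measure_def prod_nonneg)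
    also have "\<dots> = U.prob A' * (\<Prod>u\<in>W - {s}. U.prob (- A))"
      using s QW by (subst prod.remove[of W s]) (auto simp: W_def intro!: prod.cong)
    also have "U.prob (- A) = 1 - 1 / 2 ^ l"
      using U.prob_compl[of A] by (simp add: A_def Compl_eq_Diff_UNIV flip: pA[unfolded A_def])
    also have "(\<Prod>u\<in>W - {s}. 1 - 1 / 2 ^ l :: real) = (1 - 1 / 2 ^ l) ^ (2 ^ l - 1)"
      using s QW card_W by (simp add: card_Diff_singleton subset_iff)
    finally show ?thesis unfolding pA' .
  qed
  show "{x \<in> space P. singly_occupied m \<theta> x} \<in> sets P"
    unfolding occ by (intro sets.finite_UN E_sets) (simp add: Q_def)
  have disj: "disjoint_family_on E Q"
    unfolding disjoint_family_on_def
  proof (intro ballI impI)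
    fix s t assume st: "s \<in> Q" "t \<in> Q" "s \<noteq> t"
    have "x s \<in> A' \<and> x s \<notin> A" if "x \<in> E s \<inter> E t" for x
    proof -
      have "s \<in> W" using st QW by blast
      moreover have "\<And>u. u \<in> W \<Longrightarrow> x u \<in> (if u = s then A' else - A)"
        "\<And>u. u \<in> W \<Longrightarrow> x u \<in> (if u = t then A' else - A)"
        using that by (auto simp only: E_def Int_iff mem_Collect_eq)
      ultimately have "x s \<in> (if s = s then A' else - A)" "x s \<in> (if s = t then A' else - A)"
        by blast+
      then show ?thesis using st(3) by simp
    qed
    then show "E s \<inter> E t = {}" using AA' by blast
  qed
  have "measure P (\<Union>s\<in>Q. E s) = (\<Sum>s\<in>Q. measure P (E s))"
    using E_sets disj unfolding P_def by (intro finite_measure_finite_Union) (auto simp: Q_def)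
  also have "\<dots> = 2 ^ (l - 2) * (1 / (4 ^ CARD('d) * 2 ^ l) * (1 - 1 / 2 ^ l) ^ (2 ^ l - 1))"
    by (simp add: E_prob card_Q)
  also have "\<dots> = 1 / 4 ^ (CARD('d) + 1) * (1 - 1 / 2 ^ l) ^ (2 ^ l - 1)"
  proof -
    have "(2::real) ^ l = 2 ^ (l - 2) * 2 ^ 2" by (rule power_quarter[OF l(1)])
    then have "(2::real) ^ (l - 2) * (1 / (4 ^ CARD('d) * 2 ^ l)) = 1 / 4 ^ (CARD('d) + 1)" by simp
    then show ?thesis by (simp only: mult.assoc[symmetric])
  qed
  also have "\<dots> \<ge> 1 / 4 ^ (CARD('d) + 1) * (1 / 4)"
  proof (intro mult_left_mono)
    have "(2::nat) ^ 1 \<le> 2 ^ l" using l by (intro power_increasing) auto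
    then show "1 / 4 \<le> (1 - 1 / 2 ^ l :: real) ^ (2 ^ l - 1)"
      using one_minus_inverse_power_ge[of "2 ^ l"] by simp
  qed simp
  finally show "1 / 4 ^ (CARD('d) + 2) \<le> measure P {x \<in> space P. singly_occupied m \<theta> x}"
    unfolding occ by simp
qed

section \<open>A box of large discrepancy from isolated points\<close>

lemma axis_parallel_box_cells_le:
  "axis_parallel_box {x :: real ^ 'd. x \<in> cbox 0 1 \<and> (\<forall>i. cell n x i \<le> y i)}"
  unfolding axis_parallel_box_def
proof (intro exI conjI allI)
  let ?I = "\<lambda>i :: 'd. {z. z \<in> {0..1::real} \<and> nat \<lfloor>2 ^ n * z\<rfloor> \<le> y i}"
  show "{x :: real ^ 'd. x \<in> cbox 0 1 \<and> (\<forall>i. cell n x i \<le> y i)} = {x. \<forall>i. x $ i \<in> ?I i}"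
    by (auto simp: mem_box_cart cell_def)
  show "?I i \<subseteq> {0..1}" for i by auto
  show "is_interval (?I i)" for i
    unfolding is_interval_1
  proof (intro ballI allI impI)
    fix a b z assume a: "a \<in> ?I i" and b: "b \<in> ?I i" and z: "a \<le> z \<and> z \<le> b"
    have "nat \<lfloor>2 ^ n * z\<rfloor> \<le> nat \<lfloor>2 ^ n * b\<rfloor>"
      using z by (intro nat_mono floor_mono mult_left_mono) auto
    then show "z \<in> ?I i" using a b z by auto
  qed
qed

lemma disc_ge_singly_occupied:
  fixes x :: "nat \<Rightarrow> real ^ 'd" and \<sigma> :: "nat \<Rightarrow> real"
  assumes J: "CARD('d) * J \<le> m" and T: "2 ^ m \<le> T"
    and \<sigma>: "\<And>s. s \<in> {1..T} \<Longrightarrow> \<sigma> s \<in> {-1, 1}"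
  shows "\<exists>B. axis_parallel_box B \<and> (\<exists>t\<in>{1..T}.
    real (card {\<theta> \<in> box_indices m J. singly_occupied m \<theta> x}) \<le> 16 ^ (CARD('d) + 1) * 2 ^ m * (disc \<sigma> x t B)\<^sup>2)"
proof -
  \<comment> \<open>Two levels finer than any box, so that the quarters of all sides are still
    unions of grid cells.\<close>
  define n where "n = J + 2"
  define \<Theta> where "\<Theta> = {\<theta> \<in> box_indices m J. singly_occupied m \<theta> x}"
  \<comment> \<open>Time is the extra coordinate \<open>None\<close>. The offset \<open>- 1\<close>
    appears because a Haar function with parameter \<open>e\<close> lives on
    \<open>2 ^ (e + 1)\<close> grid units: \<open>2 ^ (n - j i)\<close> in space, and the block
    length in time.\<close>
  define \<alpha> :: "('d \<Rightarrow> nat) \<times> ('d \<Rightarrow> nat) \<times> nat \<Rightarrow> 'd option \<Rightarrow> nat \<times> nat"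
    where "\<alpha> = (\<lambda>(j, k, k0) c. case c of None \<Rightarrow> ((\<Sum>i\<in>UNIV. j i) - 1, k0) | Some i \<Rightarrow> (n - j i - 1, k i))"
  define N where "N = (\<lambda>c :: 'd option. case c of None \<Rightarrow> m | Some _ \<Rightarrow> n)"
  \<comment> \<open>Points outside the cube get weight zero: they are almost surely absent, but the
    claim covers every \<open>x\<close>.\<close>
  define w where "w s = \<sigma> s * indicator (cbox 0 1) (x s)" for s
  define q where "q s c = (case c of None \<Rightarrow> s - 1 | Some i \<Rightarrow> cell n (x s) i)" for s and c :: "'d option"
  have sum_option: "(\<Sum>c\<in>UNIV. f c) = f None + (\<Sum>i\<in>UNIV. f (Some i))" for f :: "'d option \<Rightarrow> nat"
    unfolding UNIV_option_conv by (subst sum.insert) (auto simp: sum.reindex)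
  have fin: "finite \<Theta>" by (simp add: \<Theta>_def)
  have "\<exists>Y\<in>(\<Pi>\<^sub>E c\<in>UNIV. {..<2 ^ N c}). real (card (\<alpha> ` \<Theta>)) * 2 ^ (n * CARD('d))
    \<le> 16 ^ CARD('d option) * 2 ^ (\<Sum>c\<in>UNIV. N c) * (\<Sum>s\<in>{1..(2::nat) ^ m}. w s * of_bool (\<forall>c. q s c \<le> Y c))\<^sup>2"
  proof (rule roth_lower_bound)
    show "finite {1..(2::nat) ^ m}" "finite (\<alpha> ` \<Theta>)" using fin by auto
  next
    fix s c assume s: "s \<in> {1..2 ^ m}" "w s \<noteq> 0"
    then have "x s \<in> cbox 0 1" by (auto simp: w_def indicator_def split: if_splits)
    then show "q s c \<le> 2 ^ N c"
      using s by (auto simp: q_def N_def mem_box_cart intro: cell_le split: option.split)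
  next
    fix \<beta> c assume "\<beta> \<in> \<alpha> ` \<Theta>"
    then obtain j k k0 where \<beta>: "\<beta> = \<alpha> (j, k, k0)" and \<theta>: "(j, k, k0) \<in> box_indices m J"
      by (auto simp: \<Theta>_def)
    note jk = box_indicesD[OF \<theta> J]
    show "1 \<le> fst (\<beta> c) \<and> fst (\<beta> c) < N c \<and> snd (\<beta> c) < 2 ^ (N c - 1 - fst (\<beta> c))"
    proof (cases c)
      case None
      have "m - 1 - ((\<Sum>i\<in>UNIV. j i) - 1) = m - (\<Sum>i\<in>UNIV. j i)" using jk(5,6) by linarith
      moreover have "1 \<le> (\<Sum>i\<in>UNIV. j i) - 1" "(\<Sum>i\<in>UNIV. j i) - 1 < m" using jk(5,6) by linarith+
      ultimately show ?thesis using None jk(4) by (simp add: \<beta> \<alpha>_def N_def)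
    next
      case (Some i)
      have "n - 1 - (n - j i - 1) = j i" using jk(2)[of i] by (simp add: n_def)
      moreover have "1 \<le> n - j i - 1" "n - j i - 1 < n" using jk(2)[of i] by (auto simp: n_def)
      ultimately show ?thesis using Some jk(3)[of i] by (simp add: \<beta> \<alpha>_def N_def)
    qed
  next
    fix \<beta> assume "\<beta> \<in> \<alpha> ` \<Theta>"
    then obtain j k k0 where \<beta>: "\<beta> = \<alpha> (j, k, k0)" and \<theta>: "(j, k, k0) \<in> box_indices m J"
      by (auto simp: \<Theta>_def)
    note jk = box_indicesD[OF \<theta> J]
    have "(\<Sum>c\<in>UNIV. fst (\<beta> c) + 1) = (\<Sum>i\<in>UNIV. j i) + (\<Sum>i\<in>UNIV. n - j i)"
    proof -
      have "n - j i - 1 + 1 = n - j i" for i using jk(2)[of i] by (simp add: n_def)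
      then show ?thesis unfolding sum_option using jk(5) by (simp add: \<beta> \<alpha>_def)
    qed
    \<comment> \<open>What a finer level loses in space is regained in time, so all boxes have the
      same volume in grid units.\<close>
    also have "\<dots> = (\<Sum>i\<in>(UNIV :: 'd set). n)"
    proof (unfold sum.distrib[symmetric], intro sum.cong refl)
      show "j i + (n - j i) = n" for i using jk(2)[of i] by (simp add: n_def)
    qed
    finally show "(\<Sum>c\<in>UNIV. fst (\<beta> c) + 1) = n * CARD('d)" by simp
  next
    fix \<beta> assume "\<beta> \<in> \<alpha> ` \<Theta>"
    then obtain j k k0 where \<beta>: "\<beta> = \<alpha> (j, k, k0)" and \<theta>: "(j, k, k0) \<in> box_indices m J"
      and occ: "singly_occupied m (j, k, k0) x"
      by (auto simp: \<Theta>_def)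
    note jk = box_indicesD[OF \<theta> J]
    obtain s where s: "s \<in> time_block m ((\<Sum>i\<in>UNIV. j i) - 2) (4 * k0 + 1)"
      and iso: "isolated m (j, k, k0) x s"
      using occ unfolding singly_occupied_def by auto
    have s_m: "s \<in> {1..2 ^ m}" using s by (auto simp: time_block_def)
    have xs: "x s \<in> dyadic_box (\<lambda>i. j i + 2) (\<lambda>i. 4 * k i + 1)"
      using iso by (simp add: isolated_def)
    have ws: "\<bar>w s\<bar> = 1"
      using \<sigma>[of s] s_m T xs by (auto simp: w_def dyadic_box_def)
    have quarter: "q s c div 2 ^ (fst (\<beta> c) - 1) = 4 * snd (\<beta> c) + 1" for c
    proof (cases c)
      case None
      have "(\<Sum>i\<in>UNIV. j i) - 1 - 1 = (\<Sum>i\<in>UNIV. j i) - 2" by simp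
      then show ?thesis using s None by (simp add: \<beta> \<alpha>_def q_def time_block_def)
    next
      case (Some i)
      have e: "n - j i - 1 - 1 \<le> n" "n - (n - j i - 1 - 1) = j i + 2"
        using jk(2)[of i] by (auto simp: n_def)
      have "cell n (x s) i div 2 ^ (n - j i - 1 - 1) = cell (j i + 2) (x s) i"
        unfolding cell_div[OF e(1)] e(2) ..
      also have "\<dots> = 4 * k i + 1" using xs unfolding dyadic_box_def by blast
      finally show ?thesis using Some by (simp add: \<beta> \<alpha>_def q_def)
    qed
    have other: "w s' = 0 \<or> (\<exists>c. q s' c div 2 ^ (fst (\<beta> c) + 1) \<noteq> snd (\<beta> c))"
      if s': "s' \<in> {1..2 ^ m} - {s}" for s'
    proof (cases "s' \<in> time_block m (\<Sum>i\<in>UNIV. j i) k0")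
      case False
      then have "(s' - 1) div 2 ^ (\<Sum>i\<in>UNIV. j i) \<noteq> k0" using s' by (auto simp: time_block_def)
      moreover have "(\<Sum>i\<in>UNIV. j i) - 1 + 1 = (\<Sum>i\<in>UNIV. j i)" using jk(5) by simp
      ultimately have "q s' None div 2 ^ (fst (\<beta> None) + 1) \<noteq> snd (\<beta> None)"
        unfolding \<beta> \<alpha>_def q_def by simp
      then show ?thesis by blast
    next
      case True
      then have notin: "x s' \<notin> dyadic_box j k" using iso s' by (simp add: isolated_def)
      show ?thesis
      proof (cases "x s' \<in> cbox 0 1")
        case True
        then obtain i where i: "cell (j i) (x s') i \<noteq> k i" using notin by (auto simp: dyadic_box_def)
        have e: "n - j i - 1 + 1 \<le> n" "n - (n - j i - 1 + 1) = j i"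
          using jk(2)[of i] by (auto simp: n_def)
        have "cell n (x s') i div 2 ^ (n - j i - 1 + 1) = cell (j i) (x s') i"
          unfolding cell_div[OF e(1)] e(2) ..
        then have "q s' (Some i) div 2 ^ (fst (\<beta> (Some i)) + 1) \<noteq> snd (\<beta> (Some i))"
          using i unfolding \<beta> \<alpha>_def q_def by simp
        then show ?thesis by blast
      qed (simp add: w_def)
    qed
    show "\<exists>s\<in>{1..2 ^ m}. \<bar>w s\<bar> = 1 \<and> (\<forall>c. q s c div 2 ^ (fst (\<beta> c) - 1) = 4 * snd (\<beta> c) + 1) \<and>
      (\<forall>s'\<in>{1..2 ^ m} - {s}. w s' = 0 \<or> (\<exists>c. q s' c div 2 ^ (fst (\<beta> c) + 1) \<noteq> snd (\<beta> c)))"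
      using s_m ws quarter other by (intro bexI[of _ s] conjI allI ballI)
  qed
  then obtain Y where Y: "Y \<in> (\<Pi>\<^sub>E c\<in>UNIV. {..<2 ^ N c})"
    and le: "real (card (\<alpha> ` \<Theta>)) * 2 ^ (n * CARD('d))
    \<le> 16 ^ CARD('d option) * 2 ^ (\<Sum>c\<in>UNIV. N c) * (\<Sum>s\<in>{1..(2::nat) ^ m}. w s * of_bool (\<forall>c. q s c \<le> Y c))\<^sup>2"
    by blast
  define B where "B = {x :: real ^ 'd. x \<in> cbox 0 1 \<and> (\<forall>i. cell n x i \<le> Y (Some i))}"
  \<comment> \<open>As \<open>q s None\<close> is \<open>s - 1\<close>, a corner with time
    coordinate \<open>Y None\<close> captures exactly the times up to
    \<open>Y None + 1\<close>.\<close>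
  define t where "t = Y None + 1"
  have Ym: "Y None < 2 ^ m" using PiE_mem[OF Y, of None] by (simp add: N_def)
  then have tm: "t \<le> 2 ^ m" "1 \<le> t" by (auto simp: t_def)
  have "inj_on \<alpha> \<Theta>"
  proof (rule inj_onI)
    fix \<theta> \<theta>' assume \<theta>: "\<theta> \<in> \<Theta>" "\<theta>' \<in> \<Theta>" "\<alpha> \<theta> = \<alpha> \<theta>'"
    obtain j k k0 j' k' k0' where eq: "\<theta> = (j, k, k0)" "\<theta>' = (j', k', k0')"
      by (cases \<theta>, cases \<theta>')
    have "j i = j' i \<and> k i = k' i" for i
    proof -
      have "(n - j i - 1, k i) = (n - j' i - 1, k' i)"
        using fun_cong[OF \<theta>(3), of "Some i"] by (simp add: \<alpha>_def eq)
      moreover have "j i \<le> J" "j' i \<le> J"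
        using box_indicesD(2)[OF _ J, of j k k0] box_indicesD(2)[OF _ J, of j' k' k0'] \<theta> by (auto simp: \<Theta>_def eq)
      ultimately show ?thesis by (auto simp: n_def)
    qed
    moreover have "k0 = k0'" using fun_cong[OF \<theta>(3), of None] by (simp add: \<alpha>_def eq)
    ultimately show "\<theta> = \<theta>'" by (auto simp: eq)
  qed
  then have card: "card (\<alpha> ` \<Theta>) = card \<Theta>" by (rule card_image)
  have forall_option: "(\<forall>c. R c) \<longleftrightarrow> R None \<and> (\<forall>i. R (Some i))" for R :: "'d option \<Rightarrow> bool"
    by (metis option.exhaust)
  have "(\<Sum>s\<in>{1..(2::nat) ^ m}. w s * of_bool (\<forall>c. q s c \<le> Y c)) = (\<Sum>s\<in>{1..2 ^ m}. if s \<in> {1..t} then \<sigma> s * indicator B (x s) else 0)"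
    unfolding forall_option by (intro sum.cong refl) (auto simp: w_def q_def B_def t_def indicator_def)
  also have "\<dots> = (\<Sum>s=1..t. \<sigma> s * indicator B (x s))"
    using tm by (subst sum.inter_restrict[symmetric]) (auto intro!: sum.cong)
  finally have disc: "(\<Sum>s\<in>{1..(2::nat) ^ m}. w s * of_bool (\<forall>c. q s c \<le> Y c))\<^sup>2 = (disc \<sigma> x t B)\<^sup>2"
    unfolding disc_def by simp
  have N: "(\<Sum>c\<in>UNIV. N c) = m + n * CARD('d)"
    unfolding sum_option by (simp add: N_def)
  \<comment> \<open>The common box volume cancels against the spatial part of the grid size, so the
    fine resolution leaves no trace.\<close>
  have "2 ^ (n * CARD('d)) * real (card \<Theta>)
      \<le> 2 ^ (n * CARD('d)) * (16 ^ (CARD('d) + 1) * 2 ^ m * (disc \<sigma> x t B)\<^sup>2)"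
    using le unfolding card disc N by (simp add: power_add mult_ac)
  then have "real (card \<Theta>) \<le> 16 ^ (CARD('d) + 1) * 2 ^ m * (disc \<sigma> x t B)\<^sup>2"
    by (subst (asm) mult_le_cancel_left_pos) auto
  moreover have "axis_parallel_box B"
    unfolding B_def by (rule axis_parallel_box_cells_le)
  ultimately show ?thesis
    using tm T unfolding \<Theta>_def by (intro exI[of _ B] conjI bexI[of _ t]) auto
qed

text \<open>No independence among the events is needed: the count has mean at least
  \<open>p * card \<Theta>\<close>, is at most \<open>card \<Theta>\<close> on \<open>G\<close> and
  below half of that mean bound off \<open>G\<close>.\<close>

lemma reverse_markov_card:
  assumes "prob_space P" "finite \<Theta>" "\<Theta> \<noteq> {}" "0 \<le> p"
    and E: "\<And>\<theta>. \<theta> \<in> \<Theta> \<Longrightarrow> E \<theta> \<in> sets P" "\<And>\<theta>. \<theta> \<in> \<Theta> \<Longrightarrow> p \<le> measure P (E \<theta>)"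
  defines "G \<equiv> {x \<in> space P. p / 2 * card \<Theta> \<le> card {\<theta> \<in> \<Theta>. x \<in> E \<theta>}}"
  shows "G \<in> sets P" "p / 2 \<le> measure P G"
proof -
  interpret prob_space P by fact
  define f where "f x = (\<Sum>\<theta>\<in>\<Theta>. indicator (E \<theta>) x :: real)" for x
  have f_card: "f x = real (card {\<theta> \<in> \<Theta>. x \<in> E \<theta>})" for x
    unfolding f_def indicator_def using assms(2) by (simp add: Int_def)
  have [measurable]: "f \<in> borel_measurable P"
    unfolding f_def using E by (intro borel_measurable_sum borel_measurable_indicator) auto
  have G_eq: "G = {x \<in> space P. p / 2 * card \<Theta> \<le> f x}"
    unfolding G_def f_card ..
  show G: "G \<in> sets P" unfolding G_eq by measurable
  have f_le: "f x \<le> card \<Theta>" for x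
    unfolding f_card using assms(2) by (intro of_nat_mono card_mono) auto
  have int: "integrable P f"
    unfolding f_def using E by (intro Bochner_Integration.integrable_sum integrable_indicator) (auto simp: emeasure_eq_measure)
  have "p * card \<Theta> = (\<Sum>\<theta>\<in>\<Theta>. p)" by simp
  also have "\<dots> \<le> (\<Sum>\<theta>\<in>\<Theta>. measure P (E \<theta>))" by (intro sum_mono E)
  also have "\<dots> = (\<integral>x. f x \<partial>P)"
    unfolding f_def using E by (subst Bochner_Integration.integral_sum) (auto simp: emeasure_eq_measure intro!: sum.cong)
  also have "\<dots> \<le> (\<integral>x. p / 2 * card \<Theta> + real (card \<Theta>) * indicator G x \<partial>P)"
  proof (intro integral_mono int)
    show "integrable P (\<lambda>x. p / 2 * card \<Theta> + real (card \<Theta>) * indicator G x)"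
      using G by (intro Bochner_Integration.integrable_add integrable_mult_right integrable_const integrable_indicator)
        (auto simp: emeasure_eq_measure)
    fix x assume "x \<in> space P"
    then show "f x \<le> p / 2 * card \<Theta> + real (card \<Theta>) * indicator G x"
      using f_le[of x] \<open>0 \<le> p\<close> by (cases "x \<in> G") (auto simp: G_eq add_increasing)
  qed
  also have "\<dots> = p / 2 * card \<Theta> + card \<Theta> * measure P G"
    using G by (subst Bochner_Integration.integral_add) (auto simp: emeasure_eq_measure prob_space)
  finally have "card \<Theta> * (p / 2) \<le> card \<Theta> * measure P G" by (simp add: algebra_simps)
  then show "p / 2 \<le> measure P G"
    using assms(2,3) by (subst (asm) mult_le_cancel_left_pos) (auto simp: card_gt_0_iff)
qed

text \<open>\<open>G\<close> is chosen before the signing, so the result applies to any algorithm.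
  In \<open>c\<close>, the factor \<open>p / 2\<close> comes from
  \<open>reverse_markov_card\<close>, \<open>16 ^ (CARD('d) + 1)\<close> from Roth's bound in one
  dimension more, and \<open>4 * CARD('d)\<close> from bounding \<open>J - 1\<close> below.\<close>

lemma disc_lower_event:
  fixes T :: nat
  defines "P \<equiv> \<Pi>\<^sub>M s\<in>{1..T}. (uniform_cube :: (real ^ 'd) measure)"
    and "p \<equiv> 1 / 4 ^ (CARD('d) + 2) :: real"
  defines "c \<equiv> sqrt (p / 2 / (16 ^ (CARD('d) + 1) * (4 * real CARD('d)) ^ CARD('d)))"
  assumes T: "2 \<le> T"
  shows "\<exists>G\<in>sets P. p / 2 \<le> measure P G \<and> (\<forall>x\<in>G. \<forall>\<sigma>. (\<forall>s\<in>{1..T}. \<sigma> s \<in> {-1, 1}) \<longrightarrow>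
    (\<exists>B. axis_parallel_box B \<and> (\<exists>t\<in>{1..T}. c * log 2 (real T) powr (real CARD('d) / 2) \<le> disc \<sigma> x t B)))"
proof -
  let ?d = "CARD('d)"
  let ?l = "log 2 (real T)"
  have prob_P: "prob_space P"
    unfolding P_def by (intro prob_space_PiM prob_space_uniform_cube)
  define m where "m = nat \<lfloor>?l\<rfloor>"
  define b where "b = c * ?l powr (real ?d / 2)"
  have l: "1 \<le> ?l" using T by simp
  have d: "1 \<le> ?d" by (simp add: Suc_le_eq)
  have m: "real m \<le> ?l" "?l < real m + 1" "1 \<le> m"
    using l by (auto simp: m_def le_nat_floor)
  have Tm: "2 ^ m \<le> T"
  proof -
    have "2 powr real m \<le> 2 powr ?l" using m by simp
    then have "2 ^ m \<le> real T" using T by (simp add: powr_realpow)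
    then have "real (2 ^ m) \<le> real T" by simp
    then show ?thesis by (simp only: of_nat_le_iff)
  qed
  have "p \<le> 1 / 1" unfolding p_def by (intro frac_le one_le_power) auto
  then have p: "0 < p" "p \<le> 1" by (auto simp: p_def)
  have b: "0 \<le> b" "b\<^sup>2 = p / 2 / (16 ^ (?d + 1) * (4 * real ?d) ^ ?d) * ?l ^ ?d"
  proof -
    show "0 \<le> b" using p by (simp add: b_def c_def)
    have "(?l powr (real ?d / 2))\<^sup>2 = ?l powr real ?d"
      using l by (simp add: power2_eq_square flip: powr_add)
    then show "b\<^sup>2 = p / 2 / (16 ^ (?d + 1) * (4 * real ?d) ^ ?d) * ?l ^ ?d"
      using p l by (simp add: b_def c_def power_mult_distrib powr_realpow)
  qed
  show ?thesis
  \<comment> \<open>Below this size \<open>log T \<le> 4 * ?d\<close>, the target \<open>b\<close>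
    is at most \<open>1\<close>, and the whole cube at time \<open>1\<close> already reaches
    it.\<close>
  proof (cases "4 * ?d \<le> m")
    case True
    \<comment> \<open>The largest \<open>J\<close> for which the time blocks of all shapes fit into
      \<open>2 ^ m\<close>.\<close>
    define J where "J = m div ?d"
    have J: "?d * J \<le> m" by (simp add: J_def)
    let ?\<Theta> = "box_indices m J :: (('d \<Rightarrow> nat) \<times> ('d \<Rightarrow> nat) \<times> nat) set"
    \<comment> \<open>From \<open>m < ?d * (J + 1)\<close> and \<open>4 * ?d \<le> m\<close> follows
      \<open>4 * ?d * (J - 1) > 4 * m - 8 * ?d \<ge> 2 * m \<ge> log T\<close>.\<close>
    have J_ge: "?l / (4 * real ?d) \<le> real (J - 1)"
    proof -
      have "m < ?d * (J + 1)" using d by (simp add: J_def dividend_less_times_div)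
      then have "real m < real ?d * (real J + 1)"
        by (metis of_nat_1 of_nat_add of_nat_less_iff of_nat_mult)
      moreover have "4 * real ?d \<le> real m" using True by (metis of_nat_le_iff of_nat_mult of_nat_numeral)
      moreover have "?l \<le> 2 * real m" using m by linarith
      ultimately have "?l \<le> 4 * real ?d * (real J - 1)" by (simp add: algebra_simps)
      moreover have "4 \<le> J"
        unfolding J_def using True d by (simp add: less_eq_div_iff_mult_less_eq)
      ultimately show ?thesis using d by (simp add: field_simps of_nat_diff)
    qed
    then have J1: "0 < J - 1" using l d by (intro Nat.gr0I) (simp add: field_simps)
    have card: "card ?\<Theta> = (J - 1) ^ ?d * 2 ^ m" by (rule card_box_indices[OF J])
    have ne: "?\<Theta> \<noteq> {}" using card J1 by force
    let ?E = "\<lambda>\<theta>. {x \<in> space P. singly_occupied m \<theta> x}"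
    have E: "?E \<theta> \<in> sets P" "p \<le> measure P (?E \<theta>)" if "\<theta> \<in> ?\<Theta>" for \<theta>
      using prob_singly_occupied[OF that J Tm] unfolding P_def p_def by auto
    define G where "G = {x \<in> space P. p / 2 * card ?\<Theta> \<le> card {\<theta> \<in> ?\<Theta>. x \<in> ?E \<theta>}}"
    have G: "G \<in> sets P" "p / 2 \<le> measure P G"
      unfolding G_def using p by (intro reverse_markov_card prob_P ne E; simp)+
    moreover have "\<exists>B. axis_parallel_box B \<and> (\<exists>t\<in>{1..T}. b \<le> disc \<sigma> x t B)"
      if x: "x \<in> G" and \<sigma>: "\<forall>s\<in>{1..T}. \<sigma> s \<in> {-1, 1}" for x \<sigma>
    proof -
      obtain B t where B: "axis_parallel_box B" and t: "t \<in> {1..T}" and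
        le: "real (card {\<theta> \<in> ?\<Theta>. singly_occupied m \<theta> x}) \<le> 16 ^ (?d + 1) * 2 ^ m * (disc \<sigma> x t B)\<^sup>2"
        using disc_ge_singly_occupied[OF J Tm, of \<sigma> x] \<sigma> by blast
      have "b\<^sup>2 = p / 2 * (?l / (4 * real ?d)) ^ ?d / 16 ^ (?d + 1)"
        unfolding b(2) by (simp add: power_divide)
      also have "\<dots> \<le> p / 2 * real (J - 1) ^ ?d / 16 ^ (?d + 1)"
        using J_ge l p by (intro divide_right_mono mult_left_mono power_mono) auto
      also have "\<dots> = p / 2 * card ?\<Theta> / (16 ^ (?d + 1) * 2 ^ m)"
        unfolding card by simp
      also have "\<dots> \<le> (disc \<sigma> x t B)\<^sup>2"
      proof -
        have "p / 2 * card ?\<Theta> \<le> real (card {\<theta> \<in> ?\<Theta>. singly_occupied m \<theta> x})"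
          using x by (auto simp: G_def)
        then show ?thesis using le by (simp add: field_simps)
      qed
      finally have "b \<le> disc \<sigma> x t B"
        by (rule power2_le_imp_le) (simp add: disc_def)
      then show ?thesis using B t by blast
    qed
    ultimately show ?thesis unfolding b_def[symmetric] by (intro bexI[of _ G]) auto
  next
    case False
    have "?l \<le> 4 * real ?d"
    proof -
      have "real m + 1 \<le> 4 * real ?d" using False by linarith
      then show ?thesis using m by linarith
    qed
    then have "?l ^ ?d \<le> (4 * real ?d) ^ ?d" using l by (intro power_mono) auto
    then have "b\<^sup>2 \<le> p / 2 / (16 ^ (?d + 1) * (4 * real ?d) ^ ?d) * (4 * real ?d) ^ ?d"
      unfolding b(2) using p by (intro mult_left_mono) auto
    also have "\<dots> = p / 2 / 16 ^ (?d + 1)" using d by simp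
    also have "\<dots> \<le> 1 / 1" using p by (intro frac_le one_le_power) auto
    finally have b1: "b \<le> 1" using power2_le_imp_le[of b 1] by simp
    define G where "G = {x \<in> space P. x 1 \<in> cbox 0 (1 :: real ^ 'd)}"
    interpret U: prob_space "uniform_cube :: (real ^ 'd) measure" by (rule prob_space_uniform_cube)
    interpret product_prob_space "\<lambda>_. uniform_cube :: (real ^ 'd) measure" "{1..T}" ..
    have "emeasure P G = emeasure uniform_cube (cbox 0 (1 :: real ^ 'd))"
      unfolding G_def P_def using T by (intro emeasure_PiM_Collect_single) auto
    also have "\<dots> = 1"
      unfolding uniform_cube_def by (rule emeasure_uniform_measure_1) (auto simp: emeasure_cube)
    finally have "measure P G = 1" by (simp add: measure_def)
    moreover have "G \<in> sets P"
    proof -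
      have [measurable]: "(\<lambda>x. x 1) \<in> P \<rightarrow>\<^sub>M borel"
        using measurable_component_singleton[of 1 "{1..T}" "\<lambda>_. uniform_cube :: (real ^ 'd) measure"] T
        unfolding P_def by (auto cong: measurable_cong_sets)
      show ?thesis unfolding G_def by measurable
    qed
    moreover have "\<exists>B. axis_parallel_box B \<and> (\<exists>t\<in>{1..T}. b \<le> disc \<sigma> x t B)"
      if x: "x \<in> G" and \<sigma>: "\<forall>s\<in>{1..T}. \<sigma> s \<in> {-1, 1}" for x \<sigma>
    proof -
      have "axis_parallel_box (cbox 0 (1 :: real ^ 'd))"
        unfolding axis_parallel_box_def
        by (intro exI[of _ "\<lambda>_. {0..1}"]) (auto simp: mem_box_cart is_interval_cc)
      moreover have "\<sigma> 1 \<in> {-1, 1}" using \<sigma> T by auto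
      then have "disc \<sigma> x 1 (cbox 0 1) = 1" using x by (auto simp: disc_def G_def)
      ultimately show ?thesis using b1 T by (intro exI[of _ "cbox 0 1"] conjI bexI[of _ 1]) auto
    qed
    ultimately show ?thesis using p unfolding b_def[symmetric] by (intro bexI[of _ G]) auto
  qed
qed

theorem online_disc_lower_bound:
  "\<exists>p>0. \<exists>c>0. \<forall>T\<ge>2. \<forall>(R :: real measure) (A :: nat \<Rightarrow> real \<times> (nat \<Rightarrow> real ^ 'd) \<Rightarrow> real).
     online_algorithm T R A \<longrightarrow>
       \<P>((r, x) in random_input T R.
          \<exists>B. axis_parallel_box B \<and>
            (MAX t\<in>{1..T}. disc (signing A r x) x t B)
              \<ge> c * log 2 (real T) powr (real CARD('d) / 2))
       \<ge> p"
proof -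
  define p :: real where "p = 1 / 4 ^ (CARD('d) + 2)"
  define c where "c = sqrt (p / 2 / (16 ^ (CARD('d) + 1) * (4 * real CARD('d)) ^ CARD('d)))"
  have pos: "0 < p / 2" "0 < c" by (auto simp: p_def c_def)
  have "p / 2 \<le> \<P>((r, x) in random_input T R. \<exists>B. axis_parallel_box B \<and>
      (MAX t\<in>{1..T}. disc (signing A r x) x t B) \<ge> c * log 2 (real T) powr (real CARD('d) / 2))"
    if T: "2 \<le> T" and online: "online_algorithm T R A"
    for T R and A :: "nat \<Rightarrow> real \<times> (nat \<Rightarrow> real ^ 'd) \<Rightarrow> real"
  proof -
    let ?P = "\<Pi>\<^sub>M s\<in>{1..T}. (uniform_cube :: (real ^ 'd) measure)"
    define b where "b = c * log 2 (real T) powr (real CARD('d) / 2)"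
    define \<Omega> where "\<Omega> = (random_input T R :: (real \<times> (nat \<Rightarrow> real ^ 'd)) measure)"
    have prob_R: "prob_space R" using online by (simp add: online_algorithm_def)
    interpret R: prob_space R by fact
    interpret Q: prob_space ?P by (intro prob_space_PiM prob_space_uniform_cube)
    interpret \<Omega>: prob_space \<Omega> unfolding \<Omega>_def by (rule prob_space_random_input[OF prob_R])
    obtain G where G: "G \<in> sets ?P" "p / 2 \<le> measure ?P G"
      and box: "\<And>x \<sigma>. x \<in> G \<Longrightarrow> (\<forall>s\<in>{1..T}. \<sigma> s \<in> {-1, 1}) \<Longrightarrow>
        (\<exists>B. axis_parallel_box B \<and> (\<exists>t\<in>{1..T}. b \<le> disc \<sigma> x t B))"
      using disc_lower_event[OF T, where 'd = 'd] unfolding b_def c_def p_def by blast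
    let ?E = "{w \<in> space \<Omega>. \<exists>B. axis_parallel_box B \<and>
      b \<le> (MAX t\<in>{1..T}. disc (signing A (fst w) (snd w)) (snd w) t B)}"
    have E_sets: "?E \<in> sets \<Omega>"
      unfolding \<Omega>_def by (rule sets_ex_box_disc_random_input[OF online]) simp
    \<comment> \<open>The event on the points is paired with all seeds; since seed and points are
      independent, its probability is unchanged.\<close>
    have "emeasure \<Omega> (space R \<times> G) = emeasure R (space R) * emeasure ?P G"
      unfolding \<Omega>_def random_input_def using G(1) by (intro Q.emeasure_pair_measure_Times) auto
    then have "measure \<Omega> (space R \<times> G) = measure ?P G"
      by (simp add: measure_def R.emeasure_space_1)
    moreover have "space R \<times> G \<subseteq> ?E"
    proof
      fix w assume w: "w \<in> space R \<times> G"
      have w\<Omega>: "w \<in> space \<Omega>"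
        using w sets.sets_into_space[OF G(1)] by (auto simp: \<Omega>_def random_input_def space_pair_measure)
      then have "\<forall>s\<in>{1..T}. signing A (fst w) (snd w) s \<in> {-1, 1}"
        using borel_measurable_signing(2)[OF online] unfolding \<Omega>_def by blast
      then obtain B t where B: "axis_parallel_box B" and t: "t \<in> {1..T}"
        and le: "b \<le> disc (signing A (fst w) (snd w)) (snd w) t B"
        using box[of "snd w" "signing A (fst w) (snd w)"] w by auto
      have "disc (signing A (fst w) (snd w)) (snd w) t B
          \<le> (MAX t\<in>{1..T}. disc (signing A (fst w) (snd w)) (snd w) t B)"
        using t by (intro Max_ge) auto
      then show "w \<in> ?E" using w\<Omega> B le by (auto intro: order_trans)
    qed
    then have "measure \<Omega> (space R \<times> G) \<le> measure \<Omega> ?E"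
      using E_sets by (rule \<Omega>.finite_measure_mono)
    moreover have "?E = {(r, x). (r, x) \<in> space \<Omega> \<and> (\<exists>B. axis_parallel_box B \<and>
        b \<le> (MAX t\<in>{1..T}. disc (signing A r x) x t B))}"
      by auto
    ultimately show ?thesis
      using G(2) unfolding b_def[symmetric] \<Omega>_def[symmetric] by (simp only:)
  qed
  then show ?thesis using pos by blast
qed

theorem theorem1p3:
  shows "(\<exists>(R :: nat \<Rightarrow> real measure) (A :: nat \<Rightarrow> nat \<Rightarrow> real \<times> (nat \<Rightarrow> real ^ 'd) \<Rightarrow> real).
            (\<forall>T. online_algorithm T (R T) (A T)) \<and>
            (\<forall>k>0. \<exists>C>0. \<forall>T\<ge>2.
               \<P>((r, x) in random_input T (R T).
                  \<forall>B. axis_parallel_box B \<longrightarrow>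
                    (MAX t\<in>{1..T}. disc (signing (A T) r x) x t B)
                      \<le> C * log 2 (real T) ^ (2 * CARD('d) + 1))
               \<ge> 1 - real T powr (- k)))
       \<and> (\<exists>p>0. \<exists>c>0. \<forall>T\<ge>2. \<forall>(R :: real measure) (A :: nat \<Rightarrow> real \<times> (nat \<Rightarrow> real ^ 'd) \<Rightarrow> real).
            online_algorithm T R A \<longrightarrow>
               \<P>((r, x) in random_input T R.
                  \<exists>B. axis_parallel_box B \<and>
                    (MAX t\<in>{1..T}. disc (signing A r x) x t B)
                      \<ge> c * log 2 (real T) powr (real CARD('d) / 2))
               \<ge> p)"
  using online_disc_upper_bound online_disc_lower_bound by (rule conjI)

end
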